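(* Let $d\ge1$ and let $f\in L^2_{\mathrm{rad}}(\mathbb{R}^d)$ be radial. Let $0<\delta\le1$ and assume that there exists an interval $I\subseteq[\frac12,2]$ such that $|I|\le\delta$ and $\operatorname{supp}\hat f\subseteq\{\xi:|\xi|\in I\}$. Then $$\big\||x|^\alpha e^{\pm it|\nabla|}f\big\|_{L_t^qL_x^p(\mathbb{R}\times\mathbb{R}^d)}\lesssim_{\alpha,q,p}\delta^{\frac12-\frac1{\min(p,q)}}\|f\|_{L^2_x(\mathbb{R}^d)}$$ as long as $$\begin{aligned} -\tfrac dp&<\alpha<(d-1)\left(\tfrac12-\tfrac1p\right)-\tfrac1q &&\text{if }2\le q,p<\infty,\\ -\tfrac dp&<\alpha\le(d-1)\left(\tfrac12-\tfrac1p\right)&&\text{if }q=\infty,\ 2\le p<\infty,\\ 0&\le\alpha<\tfrac{d-1}2-\tfrac1q&&\text{if }2\le q<\infty,\ p=\infty,\\ 0&\le\alpha\le\tfrac{d-1}2&&\text{if }q=p=\infty. \end{aligned}$$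
   Context: $e^{\pm it|\nabla|}$ is the Fourier multiplier with symbol $e^{\pm it|\xi|}$ (the estimate holds for either sign). The implicit constant depends only on $\alpha,q,p$ (and the fixed dimension $d$), not on $f$, $\delta$ or $I$. Convention: $1/\infty=0$. *)

theory Defs
  imports "HOL-Analysis.Analysis" "HOL-Probability.Essential_Supremum"
begin

text \<open>
  Real powers of extended nonnegative reals, meant for exponents \<open>r > 0\<close>
  (in particular \<open>\<infinity>\<close> is sent to \<open>\<infinity>\<close> and \<open>0\<close> to \<open>0\<close>).
\<close>

definition ennpowr :: "ennreal \<Rightarrow> real \<Rightarrow> ennreal" where
  "ennpowr a r = (if a = \<infinity> then \<infinity> else ennreal (enn2real a powr r))"

text \<open>The convention \<open>1/\<infinity> = 0\<close> is that of division on \<^typ>\<open>ennreal\<close>.\<close>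

definition recip :: "ennreal \<Rightarrow> real" where
  "recip p = enn2real (1 / p)"

text \<open>
  The \<open>L\<^sup>p\<close> norm, \<open>1 \<le> p \<le> \<infinity>\<close>, of a nonnegative extended-real-valued function. Since the value
  may be infinite, mixed norms are iterations of this one, and a bound by a finite quantity
  includes the assertion that the norm is finite.
\<close>

definition Lp_norm :: "ennreal \<Rightarrow> 'b measure \<Rightarrow> ('b \<Rightarrow> ennreal) \<Rightarrow> ennreal" where
  "Lp_norm p M g =
     (if p = \<infinity> then esssup M g
      else ennpowr (\<integral>\<^sup>+ x. ennpowr (g x) (enn2real p) \<partial>M) (recip p))"

definition L2_norm :: "('a::euclidean_space \<Rightarrow> complex) \<Rightarrow> ennreal" where
  "L2_norm f = Lp_norm 2 lborel (\<lambda>x. ennreal (cmod (f x)))"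

text \<open>Elements of \<open>L\<^sup>2\<close> are represented by Borel functions; no quotient is formed.\<close>

definition in_L2 :: "('a::euclidean_space \<Rightarrow> complex) \<Rightarrow> bool" where
  "in_L2 f \<longleftrightarrow> f \<in> borel_measurable borel \<and> L2_norm f < \<infinity>"

definition radial :: "('a::euclidean_space \<Rightarrow> complex) \<Rightarrow> bool" where
  "radial f \<longleftrightarrow>
     (\<exists>F :: real \<Rightarrow> complex. F \<in> borel_measurable borel \<and> (AE x in lborel. f x = F (norm x)))"

text \<open>
  The support of an almost-everywhere class: the complement of the largest open set on which
  the function vanishes almost everywhere.
\<close>

definition ess_support :: "('a::euclidean_space \<Rightarrow> complex) \<Rightarrow> 'a set" where
  "ess_support g =
     {\<xi>. \<forall>U. open U \<and> \<xi> \<in> U \<longrightarrow> \<not> (AE \<eta> in lborel. \<eta> \<in> U \<longrightarrow> g \<eta> = 0)}"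

text \<open>The Fourier transform of an integrable function, with the unitary normalisation.\<close>

definition fourier_integral :: "('a::euclidean_space \<Rightarrow> complex) \<Rightarrow> 'a \<Rightarrow> complex" where
  "fourier_integral f \<xi> =
     complex_of_real ((2 * pi) powr (- real DIM('a) / 2)) *
       (LINT x|lborel. cis (- (x \<bullet> \<xi>)) * f x)"

text \<open>
  The Fourier transform on \<open>L\<^sup>2\<close> is the extension by continuity from \<open>L\<^sup>1 \<inter> L\<^sup>2\<close>: the \<open>L\<^sup>2\<close> limit of
  the transforms of the truncations of \<open>f\<close> to balls. It is determined up to null sets, and
  \<open>SOME\<close> picks a representative.
\<close>

definition has_fourier_L2 ::
    "('a::euclidean_space \<Rightarrow> complex) \<Rightarrow> ('a \<Rightarrow> complex) \<Rightarrow> bool" where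
  "has_fourier_L2 f g \<longleftrightarrow> in_L2 g \<and>
     (\<lambda>n::nat. L2_norm (\<lambda>\<xi>.
        fourier_integral (\<lambda>x. if norm x \<le> real n then f x else 0) \<xi> - g \<xi>))
       \<longlonglongrightarrow> 0"

definition fourier_L2 :: "('a::euclidean_space \<Rightarrow> complex) \<Rightarrow> 'a \<Rightarrow> complex" where
  "fourier_L2 f = (SOME g. has_fourier_L2 f g)"

text \<open>
  With the unitary normalisation the inverse Fourier transform is the Fourier transform
  followed by the reflection \<open>x \<mapsto> -x\<close>.
\<close>

definition inverse_fourier_L2 :: "('a::euclidean_space \<Rightarrow> complex) \<Rightarrow> 'a \<Rightarrow> complex" where
  "inverse_fourier_L2 g x = fourier_L2 g (- x)"

definition fourier_multiplier ::
    "('a::euclidean_space \<Rightarrow> complex) \<Rightarrow> ('a \<Rightarrow> complex) \<Rightarrow> 'a \<Rightarrow> complex" where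
  "fourier_multiplier m f = inverse_fourier_L2 (\<lambda>\<xi>. m \<xi> * fourier_L2 f \<xi>)"

text \<open>The half-wave propagator \<open>e\<^sup>i\<^sup>t\<^sup>|\<^sup>\<nabla>\<^sup>|\<close>.\<close>

definition half_wave ::
    "real \<Rightarrow> ('a::euclidean_space \<Rightarrow> complex) \<Rightarrow> 'a \<Rightarrow> complex" where
  "half_wave t = fourier_multiplier (\<lambda>\<xi>. cis (t * norm \<xi>))"

text \<open>
  \<open>\<parallel> |x|\<^sup>\<alpha> u \<parallel>\<close> in \<open>L\<^sup>q\<close> in time of \<open>L\<^sup>p\<close> in space. The value of the weight at the origin is
  irrelevant, a single point being a null set.
\<close>

definition weighted_mixed_norm ::
    "real \<Rightarrow> ennreal \<Rightarrow> ennreal \<Rightarrow> (real \<Rightarrow> 'a::euclidean_space \<Rightarrow> complex) \<Rightarrow> ennreal" where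
  "weighted_mixed_norm \<alpha> q p u =
     Lp_norm q lborel (\<lambda>t. Lp_norm p lborel (\<lambda>x. ennreal (norm x powr \<alpha> * cmod (u t x))))"

definition admissible :: "nat \<Rightarrow> real \<Rightarrow> ennreal \<Rightarrow> ennreal \<Rightarrow> bool" where
  "admissible d \<alpha> q p \<longleftrightarrow>
     (2 \<le> q \<and> q < \<infinity> \<and> 2 \<le> p \<and> p < \<infinity> \<and>
        - (real d * recip p) < \<alpha> \<and> \<alpha> < (real d - 1) * (1/2 - recip p) - recip q) \<or>
     (q = \<infinity> \<and> 2 \<le> p \<and> p < \<infinity> \<and>
        - (real d * recip p) < \<alpha> \<and> \<alpha> \<le> (real d - 1) * (1/2 - recip p)) \<or>
     (2 \<le> q \<and> q < \<infinity> \<and> p = \<infinity> \<and>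
        0 \<le> \<alpha> \<and> \<alpha> < (real d - 1) / 2 - recip q) \<or>
     (q = \<infinity> \<and> p = \<infinity> \<and>
        0 \<le> \<alpha> \<and> \<alpha> \<le> (real d - 1) / 2)"

end

theory Submission
  imports Defs "HOL-Probability.Characteristic_Functions"
begin

text \<open>
  By radiality \<open>e\<^sup>i\<^sup>t\<^sup>|\<^sup>\<nabla>\<^sup>| f (x) = v (t, |x|)\<close>, where \<open>v (t, s)\<close> is up to a constant the integral of
  \<open>e\<^sup>i\<^sup>t\<^sup>r G (r) k (s r) r\<^sup>d\<^sup>-\<^sup>1\<close> over \<open>r \<in> I\<close>, with \<open>G\<close> the profile of the Fourier transform and \<open>k\<close> the Fourier
  transform of the unit sphere. Bessel's equation and an energy argument show that \<open>k\<close> and \<open>k'\<close> are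
  \<open>O ((1 + s)\<^sup>-\<^sup>a)\<close> with \<open>a = (d - 1) / 2\<close>. Everything follows by interpolating between four bounds, in which
  \<open>M\<close> is the \<open>L\<^sup>2\<close> norm of \<open>f\<close>: Cauchy-Schwarz gives \<open>|v| \<lesssim> \<delta>\<^sup>1\<^sup>/\<^sup>2 M (1 + s)\<^sup>-\<^sup>a\<close>; Plancherel in \<open>x\<close> bounds \<open>v\<close> in \<open>L\<^sup>2\<close> of
  space by \<open>M\<close>; Plancherel in \<open>t\<close> bounds \<open>v (\<cdot>, s)\<close> and \<open>\<partial>\<^sub>s v (\<cdot>, s)\<close> in \<open>L\<^sup>2\<close> of time by \<open>M (1 + s)\<^sup>-\<^sup>a\<close>, hence, on
  integrating in \<open>s\<close> against weights, a space-time bound and (through a local Sobolev inequality in \<open>s\<close>)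
  a bound for the weighted maximal function of \<open>v\<close> in \<open>s\<close>.
\<close>

section \<open>Plancherel's inequality\<close>


text \<open>The exponent of \<delta> comes from counting pointwise bounds. Only Cauchy-Schwarz over
  the band gains: a factor \<open>\<delta> powr (1/2)\<close> for each power of v spent on it; the
  Plancherel bounds gain nothing but are needed for a remaining square. If p \<le> q, one spends p -
  2 of the p powers pointwise, and Jensen with exponent q/p moves the outer power inside the space
  integral; this leads to 1/2 - 1/p. If q < p, Jensen goes the wrong way, so p - q powers go to the
  maximal function in s and q - 2 of the other q are spent pointwise; this leads to 1/2 - 1/q. The
  conditions on \<alpha> are convergence conditions. For finite q the strict upper bound makes an
  integral over a half-line in s converge, while for infinite q a bounded weight is enough and
  equality is allowed. For finite p the lower bound makes \<open>norm x powr (\<alpha> * p)\<close>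
  integrable at the origin, where v is simply bounded; the factors of \<delta> gained there in
  excess are harmless because \<delta> \<le> 1. No surface measure is built: polar coordinates and
  Bessel's equation are derived from Lebesgue integrals over balls, with k obtained by
  differentiating in the radius.\<close>

lemma ennpowr_ennreal: "0 \<le> c \<Longrightarrow> ennpowr (ennreal c) r = ennreal (c powr r)"
  by (simp add: ennpowr_def)

lemma ennpowr_mono: "a \<le> b \<Longrightarrow> 0 \<le> r \<Longrightarrow> ennpowr a r \<le> ennpowr b r"
  by (auto simp: ennpowr_def top_unique less_top[symmetric] intro!: ennreal_leI powr_mono2 enn2real_mono)

lemma measurable_ennpowr [measurable]: "(\<lambda>a. ennpowr a r) \<in> borel_measurable borel"
  unfolding ennpowr_def by measurable

lemma recip_top [simp]: "recip \<infinity> = 0"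
  by (simp add: recip_def)

lemma recip_ennreal: "0 < p \<Longrightarrow> recip (ennreal p) = 1 / p"
  by (simp add: recip_def divide_ennreal[of 1 p, simplified])

section \<open>Squared norms and convergence in mean square\<close>

definition sqint :: "('a::euclidean_space \<Rightarrow> complex) \<Rightarrow> ennreal" where
  "sqint f = (\<integral>\<^sup>+x. ennreal ((cmod (f x))\<^sup>2) \<partial>lborel)"

lemma enn2real_two: "enn2real 2 = 2"
  using enn2real_ennreal[of 2] by simp

lemma L2_norm_eq_sqint: "L2_norm f = ennpowr (sqint f) (1/2)"
proof -
  have 1: "recip 2 = 1/2"
    using recip_ennreal[of 2] by simp
  have 2: "ennpowr (ennreal (cmod z)) 2 = ennreal ((cmod z)\<^sup>2)" for z
    by (cases "z = 0") (auto simp: ennpowr_def powr_numeral)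
  show ?thesis
    by (simp add: L2_norm_def Lp_norm_def 1 2 sqint_def enn2real_two)
qed

lemma L2_norm_finite_iff: "L2_norm f < \<infinity> \<longleftrightarrow> sqint f < \<infinity>"
  by (auto simp: L2_norm_eq_sqint ennpowr_def less_top)

lemma in_L2_iff: "in_L2 f \<longleftrightarrow> f \<in> borel_measurable borel \<and> sqint f < \<infinity>"
  unfolding in_L2_def L2_norm_finite_iff ..

lemma L2_norm_eq_sqrt: "sqint f = ennreal c \<Longrightarrow> 0 \<le> c \<Longrightarrow> L2_norm f = ennreal (sqrt c)"
  by (simp add: L2_norm_eq_sqint ennpowr_ennreal powr_half_sqrt)

text \<open>Finite real thresholds and a non-strict inequality: in this form a threshold e can be
  exchanged for its square or square root, which is how norms are replaced by squared norms
  below.\<close>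

lemma tendsto_0_ennreal_iff:
  fixes x :: "nat \<Rightarrow> ennreal"
  shows "x \<longlonglongrightarrow> 0 \<longleftrightarrow> (\<forall>e>0. \<forall>\<^sub>F n in sequentially. x n \<le> ennreal e)"
proof
  assume L: "x \<longlonglongrightarrow> 0"
  show "\<forall>e>0. \<forall>\<^sub>F n in sequentially. x n \<le> ennreal e"
  proof (intro allI impI)
    fix e :: real assume "e > 0"
    then have "\<forall>\<^sub>F n in sequentially. x n < ennreal e"
      using L by (intro order_tendstoD) auto
    then show "\<forall>\<^sub>F n in sequentially. x n \<le> ennreal e"
      by (rule eventually_mono) auto
  qed
next
  assume R: "\<forall>e>0. \<forall>\<^sub>F n in sequentially. x n \<le> ennreal e"
  show "x \<longlonglongrightarrow> 0"
  proof (rule order_tendstoI)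
    fix a :: ennreal assume "0 < a"
    then obtain e where e: "0 < e" "ennreal e < a"
    proof -
      obtain b where "0 < b" "b < a" using dense \<open>0 < a\<close> by blast
      moreover then obtain e where "b = ennreal e" "e \<ge> 0"
        by (cases b) auto
      ultimately show ?thesis using that[of e] by auto
    qed
    with R have "\<forall>\<^sub>F n in sequentially. x n \<le> ennreal e" by blast
    then show "\<forall>\<^sub>F n in sequentially. x n < a"
      by (rule eventually_mono) (use e in auto)
  qed auto
qed

lemma L2_norm_tendsto_0_iff:
  "(\<lambda>n. L2_norm (h n)) \<longlonglongrightarrow> 0 \<longleftrightarrow> (\<lambda>n. sqint (h n)) \<longlonglongrightarrow> 0"
proof -
  have 1: "L2_norm f \<le> ennreal e \<longleftrightarrow> sqint f \<le> ennreal (e\<^sup>2)" if "e > 0" for f :: "'a \<Rightarrow> complex" and e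
  proof (cases "sqint f")
    case (real r)
    then have "L2_norm f = ennreal (sqrt r)" by (intro L2_norm_eq_sqrt) auto
    moreover have "sqrt r \<le> e \<longleftrightarrow> r \<le> e\<^sup>2"
      using that real by (metis abs_of_pos real_sqrt_abs real_sqrt_le_iff)
    ultimately show ?thesis using real that by (simp add: ennreal_le_iff)
  next
    case top
    then show ?thesis by (simp add: L2_norm_eq_sqint ennpowr_def top_unique)
  qed
  show ?thesis unfolding tendsto_0_ennreal_iff
  proof safe
    fix e :: real assume *: "\<forall>e>0. \<forall>\<^sub>F n in sequentially. L2_norm (h n) \<le> ennreal e" "e > 0"
    then have "\<forall>\<^sub>F n in sequentially. L2_norm (h n) \<le> ennreal (sqrt e)" by simp
    then show "\<forall>\<^sub>F n in sequentially. sqint (h n) \<le> ennreal e"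
      using 1[of "sqrt e"] * by (simp add: real_sqrt_pow2)
  next
    fix e :: real assume *: "\<forall>e>0. \<forall>\<^sub>F n in sequentially. sqint (h n) \<le> ennreal e" "e > 0"
    then have "\<forall>\<^sub>F n in sequentially. sqint (h n) \<le> ennreal (e\<^sup>2)" by simp
    then show "\<forall>\<^sub>F n in sequentially. L2_norm (h n) \<le> ennreal e"
      using 1[of e] * by simp
  qed
qed

lemma cmod_add_square_le: "(cmod (x + y))\<^sup>2 \<le> 2 * (cmod x)\<^sup>2 + 2 * (cmod y)\<^sup>2"
proof -
  have "(cmod (x + y))\<^sup>2 \<le> (cmod x + cmod y)\<^sup>2"
    by (intro power_mono norm_triangle_ineq) auto
  also have "\<dots> \<le> 2 * (cmod x)\<^sup>2 + 2 * (cmod y)\<^sup>2"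
    using sum_squares_bound[of "cmod x" "cmod y"] by (simp add: power2_sum)
  finally show ?thesis .
qed

lemma sqint_add_le:
  assumes [measurable]: "f \<in> borel_measurable borel" "g \<in> borel_measurable borel"
  shows "sqint (\<lambda>x. f x + g x) \<le> 2 * sqint f + 2 * sqint g"
proof -
  have "sqint (\<lambda>x. f x + g x) \<le> (\<integral>\<^sup>+x. 2 * ennreal ((cmod (f x))\<^sup>2) + 2 * ennreal ((cmod (g x))\<^sup>2) \<partial>lborel)"
    unfolding sqint_def
  proof (intro nn_integral_mono)
    fix x
    have "ennreal ((cmod (f x + g x))\<^sup>2) \<le> ennreal (2 * (cmod (f x))\<^sup>2 + 2 * (cmod (g x))\<^sup>2)"
      by (intro ennreal_leI cmod_add_square_le)
    then show "ennreal ((cmod (f x + g x))\<^sup>2) \<le> 2 * ennreal ((cmod (f x))\<^sup>2) + 2 * ennreal ((cmod (g x))\<^sup>2)"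
      by (simp add: ennreal_plus ennreal_mult)
  qed
  also have "\<dots> = 2 * sqint f + 2 * sqint g"
    unfolding sqint_def by (subst nn_integral_add) (auto simp: nn_integral_cmult)
  finally show ?thesis .
qed

lemma sqint_cong_AE: "AE x in lborel. f x = g x \<Longrightarrow> sqint f = sqint g"
  unfolding sqint_def by (rule nn_integral_cong_AE) auto

lemma sqint_eq_0_imp_AE:
  assumes [measurable]: "f \<in> borel_measurable borel" and "sqint f = 0"
  shows "AE x in lborel. f x = 0"
  using assms(2) unfolding sqint_def by (subst (asm) nn_integral_0_iff_AE) auto

text \<open>Both candidates approximate the same sequence of truncated transforms, so the inequality
  for the square of a sum bounds their distance by twice the two errors, which tend to 0.\<close>

lemma has_fourier_L2_unique:
  assumes f: "f \<in> borel_measurable borel"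
    and meas: "\<And>n::nat. fourier_integral (\<lambda>x. if norm x \<le> real n then f x else 0) \<in> borel_measurable borel"
    and g: "has_fourier_L2 f g" and h: "has_fourier_L2 f h"
  shows "AE x in lborel. g x = h x"
proof -
  define F where "F n = fourier_integral (\<lambda>x. if norm x \<le> real n then f x else 0)" for n :: nat
  have [measurable]: "F n \<in> borel_measurable borel" "g \<in> borel_measurable borel" "h \<in> borel_measurable borel" for n
    using meas g h by (auto simp: F_def has_fourier_L2_def in_L2_def)
  have gl: "(\<lambda>n. sqint (\<lambda>x. F n x - g x)) \<longlonglongrightarrow> 0" and hl: "(\<lambda>n. sqint (\<lambda>x. F n x - h x)) \<longlonglongrightarrow> 0"
    using g h by (auto simp: has_fourier_L2_def L2_norm_tendsto_0_iff F_def)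
  have le: "sqint (\<lambda>x. g x - h x) \<le> 2 * sqint (\<lambda>x. F n x - g x) + 2 * sqint (\<lambda>x. F n x - h x)" for n
  proof -
    have "sqint (\<lambda>x. g x - h x) = sqint (\<lambda>x. (g x - F n x) + (F n x - h x))" by simp
    also have "\<dots> \<le> 2 * sqint (\<lambda>x. g x - F n x) + 2 * sqint (\<lambda>x. F n x - h x)"
      by (intro sqint_add_le) auto
    also have "sqint (\<lambda>x. g x - F n x) = sqint (\<lambda>x. F n x - g x)"
      by (simp add: sqint_def norm_minus_commute)
    finally show ?thesis .
  qed
  have "(\<lambda>n. 2 * sqint (\<lambda>x. F n x - g x) + 2 * sqint (\<lambda>x. F n x - h x)) \<longlonglongrightarrow> 2 * 0 + 2 * 0"
    by (intro tendsto_add ennreal_tendsto_cmult gl hl) auto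
  then have "sqint (\<lambda>x. g x - h x) \<le> 0"
    by (intro LIMSEQ_le_const) (use le in auto)
  then have "AE x in lborel. g x - h x = 0"
    by (intro sqint_eq_0_imp_AE) auto
  then show ?thesis by auto
qed


section \<open>Gaussians and their Fourier transforms\<close>

lemma measurable_cis [measurable]:
  assumes [measurable]: "f \<in> borel_measurable M"
  shows "(\<lambda>z. cis (f z)) \<in> borel_measurable M"
proof -
  have "cis \<in> borel_measurable borel"
    by (intro borel_measurable_continuous_onI continuous_intros)
  then show ?thesis by measurable
qed

lemma measurable_cnj [measurable]:
  assumes [measurable]: "f \<in> borel_measurable M"
  shows "(\<lambda>z. cnj (f z)) \<in> borel_measurable M"
proof -
  have "cnj \<in> borel_measurable borel"
    by (intro borel_measurable_continuous_onI continuous_intros)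
  then show ?thesis by measurable
qed

lemma norm_integral_le_nn_integral:
  fixes f :: "'b \<Rightarrow> complex"
  shows "ennreal (norm (integral\<^sup>L M f)) \<le> (\<integral>\<^sup>+x. ennreal (norm (f x)) \<partial>M)"
  by (cases "integrable M f") (auto simp: integral_norm_bound_ennreal not_integrable_integral_eq)

lemma integrable_real_gaussian:
  fixes \<epsilon> :: real assumes "0 < \<epsilon>"
  shows "integrable lborel (\<lambda>y. exp (- (\<epsilon> * y)\<^sup>2 / 2))"
proof -
  have "integrable lborel (\<lambda>y. sqrt (2 * pi) * normal_density 0 1 y)"
    by simp
  then have "integrable lborel (\<lambda>y::real. exp (- y\<^sup>2 / 2))"
    by (simp add: normal_density_def)
  then have "integrable lborel (\<lambda>y. (\<lambda>y::real. exp (- y\<^sup>2 / 2)) (0 + \<epsilon> * y))"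
    using assms by (subst lborel_integrable_real_affine_iff) auto
  then show ?thesis by simp
qed

text \<open>Read off from the characteristic function of the standard normal distribution; the
  substitution of \<epsilon> y for y then brings in the scale.\<close>

lemma real_gaussian_fourier:
  fixes \<epsilon> t :: real assumes "0 < \<epsilon>"
  shows "(LINT y|lborel. exp (- (\<epsilon> * y)\<^sup>2 / 2) *\<^sub>R cis (t * y))
           = complex_of_real (sqrt (2 * pi) / \<epsilon> * exp (- (t / \<epsilon>)\<^sup>2 / 2))"
proof -
  have 1: "(LINT y|lborel. exp (- y\<^sup>2 / 2) *\<^sub>R cis (s * y)) = complex_of_real (sqrt (2 * pi) * exp (- s\<^sup>2 / 2))" for s :: real
  proof -
    have "complex_of_real (exp (- s\<^sup>2 / 2)) = char std_normal_distribution s"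
      by (simp add: char_std_normal_distribution)
    also have "\<dots> = (LINT y|lborel. std_normal_density y *\<^sub>R iexp (s * y))"
      unfolding char_def
      by (subst integral_density) (auto intro!: AE_I2)
    also have "\<dots> = (LINT y|lborel. (1 / sqrt (2 * pi)) *\<^sub>R (exp (- y\<^sup>2 / 2) *\<^sub>R cis (s * y)))"
      by (intro Bochner_Integration.integral_cong)
        (auto simp: std_normal_density_def cis_conv_exp)
    also have "\<dots> = (1 / sqrt (2 * pi)) *\<^sub>R (LINT y|lborel. exp (- y\<^sup>2 / 2) *\<^sub>R cis (s * y))"
      by (rule integral_scaleR_right)
    finally have "sqrt (2 * pi) *\<^sub>R complex_of_real (exp (- s\<^sup>2 / 2)) = (LINT y|lborel. exp (- y\<^sup>2 / 2) *\<^sub>R cis (s * y))"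
      by simp
    then show ?thesis by (simp add: scaleR_conv_of_real)
  qed
  have "(LINT y|lborel. exp (- y\<^sup>2 / 2) *\<^sub>R cis (t / \<epsilon> * y))
      = \<bar>\<epsilon>\<bar> *\<^sub>R (LINT y|lborel. exp (- (0 + \<epsilon> * y)\<^sup>2 / 2) *\<^sub>R cis (t / \<epsilon> * (0 + \<epsilon> * y)))"
    using assms by (intro lborel_integral_real_affine) auto
  then have "complex_of_real (sqrt (2 * pi) * exp (- (t/\<epsilon>)\<^sup>2 / 2)) = \<epsilon> *\<^sub>R (LINT y|lborel. exp (- (\<epsilon> * y)\<^sup>2 / 2) *\<^sub>R cis (t * y))"
    using assms unfolding 1 by simp
  then have "(1/\<epsilon>) *\<^sub>R complex_of_real (sqrt (2 * pi) * exp (- (t/\<epsilon>)\<^sup>2 / 2)) = (LINT y|lborel. exp (- (\<epsilon> * y)\<^sup>2 / 2) *\<^sub>R cis (t * y))"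
    using assms by simp
  then show ?thesis by (simp add: scaleR_conv_of_real)
qed

lemma norm_square_eq_sum_Basis: "(norm (x::'a::euclidean_space))\<^sup>2 = (\<Sum>b\<in>Basis. (x \<bullet> b)\<^sup>2)"
  by (subst power2_norm_eq_inner, subst euclidean_inner) (simp add: power2_eq_square)

text \<open>Lebesgue measure is the image of the product measure indexed by \<open>Basis\<close>, so
  the integral factors over the coordinates. This reduces Gaussians to dimension one.\<close>

lemma lborel_integral_prod:
  fixes f :: "'a::euclidean_space \<Rightarrow> real \<Rightarrow> complex"
  assumes f: "\<And>b. b \<in> Basis \<Longrightarrow> integrable lborel (f b)"
  shows "integrable lborel (\<lambda>x::'a. \<Prod>b\<in>Basis. f b (x \<bullet> b))"
    and "(LINT x::'a|lborel. (\<Prod>b\<in>Basis. f b (x \<bullet> b))) = (\<Prod>b\<in>Basis. LINT y|lborel. f b y)"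
proof -
  interpret product_sigma_finite "\<lambda>b::'a. lborel :: real measure"
    by unfold_locales
  have m[measurable]: "b \<in> Basis \<Longrightarrow> f b \<in> borel_measurable borel" for b
    using f[of b] borel_measurable_integrable by fastforce
  have M: "(\<lambda>f. \<Sum>b\<in>Basis. f b *\<^sub>R b) \<in> (\<Pi>\<^sub>M b\<in>Basis. lborel) \<rightarrow>\<^sub>M (borel :: 'a measure)"
    by measurable
  have P: "(\<lambda>x::'a. \<Prod>b\<in>Basis. f b (x \<bullet> b)) \<in> borel_measurable borel"
    by measurable
  have e: "(\<Prod>b\<in>Basis. f b ((\<Sum>b\<in>Basis. g b *\<^sub>R b) \<bullet> b)) = (\<Prod>b\<in>Basis. f b (g b))" for g :: "'a \<Rightarrow> real"
    by (intro prod.cong refl) (simp add: inner_sum_left_Basis)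
  have "integrable (\<Pi>\<^sub>M b\<in>Basis. lborel) (\<lambda>g. \<Prod>b\<in>Basis. f b (g b))"
    by (rule product_integrable_prod) (use f in auto)
  then show "integrable lborel (\<lambda>x::'a. \<Prod>b\<in>Basis. f b (x \<bullet> b))"
    unfolding lborel_eq[where 'a='a] by (subst integrable_distr_eq[OF M P]) (simp only: e)
  have "(LINT x::'a|lborel. (\<Prod>b\<in>Basis. f b (x \<bullet> b))) = integral\<^sup>L (\<Pi>\<^sub>M b\<in>Basis. lborel) (\<lambda>g. \<Prod>b\<in>Basis. f b (g b))"
    unfolding lborel_eq[where 'a='a] by (subst integral_distr[OF M P]) (simp only: e)
  also have "\<dots> = (\<Prod>b\<in>Basis. LINT y|lborel. f b y)"
    by (rule product_integral_prod) (use f in auto)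
  finally show "(LINT x::'a|lborel. (\<Prod>b\<in>Basis. f b (x \<bullet> b))) = (\<Prod>b\<in>Basis. LINT y|lborel. f b y)" .
qed

lemma gaussian_fourier:
  fixes x :: "'a::euclidean_space" and \<epsilon> :: real
  assumes "0 < \<epsilon>"
  defines "g \<equiv> \<lambda>\<xi>::'a. exp (- (\<epsilon> * norm \<xi>)\<^sup>2 / 2) *\<^sub>R cis (x \<bullet> \<xi>)"
  shows "integrable lborel g"
    and "(LINT \<xi>|lborel. g \<xi>)
      = complex_of_real ((sqrt (2 * pi) / \<epsilon>) ^ DIM('a) * exp (- (norm x / \<epsilon>)\<^sup>2 / 2))"
proof -
  define f where "f b y = exp (- (\<epsilon> * y)\<^sup>2 / 2) *\<^sub>R cis ((x \<bullet> b) * y)" for b and y :: real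
  have cs: "cis (sum h A) = (\<Prod>b\<in>A. cis (h b))" for h and A :: "'a set"
    by (induction A rule: infinite_finite_induct) (auto simp: cis_mult[symmetric])
  have g: "g \<xi> = (\<Prod>b\<in>Basis. f b (\<xi> \<bullet> b))" for \<xi>
  proof -
    have "exp (- (\<epsilon> * norm \<xi>)\<^sup>2 / 2) = exp (\<Sum>b\<in>Basis. - (\<epsilon> * (\<xi> \<bullet> b))\<^sup>2 / 2)"
      by (simp add: power_mult_distrib norm_square_eq_sum_Basis sum_distrib_left sum_divide_distrib sum_negf)
    also have "\<dots> = (\<Prod>b\<in>Basis. exp (- (\<epsilon> * (\<xi> \<bullet> b))\<^sup>2 / 2))"
      by (simp add: exp_sum)
    finally have 1: "exp (- (\<epsilon> * norm \<xi>)\<^sup>2 / 2) = (\<Prod>b\<in>Basis. exp (- (\<epsilon> * (\<xi> \<bullet> b))\<^sup>2 / 2))" .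
    have 2: "cis (x \<bullet> \<xi>) = (\<Prod>b\<in>Basis. cis ((x \<bullet> b) * (\<xi> \<bullet> b)))"
      by (subst euclidean_inner) (simp add: cs)
    show ?thesis unfolding g_def 1 2 f_def
      by (simp add: scaleR_conv_of_real prod.distrib)
  qed
  have fi: "integrable lborel (f b)" for b
    unfolding f_def
    by (rule Bochner_Integration.integrable_bound[OF integrable_real_gaussian[OF \<open>0 < \<epsilon>\<close>]]) auto
  show "integrable lborel g"
    unfolding g by (rule lborel_integral_prod(1)) (rule fi)
  have "(LINT \<xi>|lborel. g \<xi>) = (\<Prod>b\<in>Basis. LINT y|lborel. f b y)"
    unfolding g by (rule lborel_integral_prod(2)) (rule fi)
  also have "\<dots> = (\<Prod>b\<in>(Basis::'a set). complex_of_real (sqrt (2 * pi) / \<epsilon> * exp (- ((x \<bullet> b) / \<epsilon>)\<^sup>2 / 2)))"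
    unfolding f_def by (simp only: real_gaussian_fourier[OF \<open>0 < \<epsilon>\<close>])
  also have "\<dots> = complex_of_real ((sqrt (2 * pi) / \<epsilon>) ^ DIM('a) * (\<Prod>b\<in>(Basis::'a set). exp (- ((x \<bullet> b) / \<epsilon>)\<^sup>2 / 2)))"
    by (simp only: of_real_prod[symmetric] prod.distrib prod_constant)
  also have "(\<Prod>b\<in>(Basis::'a set). exp (- ((x \<bullet> b) / \<epsilon>)\<^sup>2 / 2)) = exp (- (norm x / \<epsilon>)\<^sup>2 / 2)"
    by (subst exp_sum[symmetric])
      (auto simp: power_divide norm_square_eq_sum_Basis sum_divide_distrib sum_negf)
  finally show "(LINT \<xi>|lborel. g \<xi>)
      = complex_of_real ((sqrt (2 * pi) / \<epsilon>) ^ DIM('a) * exp (- (norm x / \<epsilon>)\<^sup>2 / 2))" .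
qed

lemma nn_integral_gaussian:
  fixes \<epsilon> :: real
  assumes "0 < \<epsilon>"
  shows "(\<integral>\<^sup>+x. ennreal (exp (- (norm (x::'a::euclidean_space) / \<epsilon>)\<^sup>2 / 2)) \<partial>lborel) = ennreal ((sqrt (2 * pi) * \<epsilon>) ^ DIM('a))"
proof -
  have p: "0 < 1 / \<epsilon>" using assms by simp
  have e: "exp (- (1 / \<epsilon> * norm \<xi>)\<^sup>2 / 2) *\<^sub>R cis (0 \<bullet> \<xi>) = complex_of_real (exp (- (norm \<xi> / \<epsilon>)\<^sup>2 / 2))" for \<xi> :: 'a
    by (simp add: scaleR_conv_of_real)
  have i: "integrable lborel (\<lambda>x::'a. complex_of_real (exp (- (norm x / \<epsilon>)\<^sup>2 / 2)))"
    using gaussian_fourier(1)[OF p, of "0::'a"] unfolding e .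
  have "(LINT x::'a|lborel. complex_of_real (exp (- (norm x / \<epsilon>)\<^sup>2 / 2))) = complex_of_real ((sqrt (2 * pi) * \<epsilon>) ^ DIM('a))"
    using gaussian_fourier(2)[OF p, of "0::'a"] unfolding e by simp
  then have "(LINT x::'a|lborel. exp (- (norm x / \<epsilon>)\<^sup>2 / 2)) = (sqrt (2 * pi) * \<epsilon>) ^ DIM('a)"
    by (simp only: integral_complex_of_real of_real_eq_iff)
  moreover have "integrable lborel (\<lambda>x::'a. exp (- (norm x / \<epsilon>)\<^sup>2 / 2))"
    using i by (simp only: complex_of_real_integrable_eq)
  ultimately show ?thesis
    by (subst nn_integral_eq_integral) auto
qed

text \<open>A majorant in product form supplies the joint integrability that every use of Fubini's
  theorem below asks for. The sign of \<open>B\<close> is not prescribed, hence the absolute value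
  in the proof.\<close>

lemma integrable_lborel_pair:
  fixes a :: "'a::euclidean_space \<Rightarrow> complex" and b :: "'b::euclidean_space \<Rightarrow> complex"
  assumes a: "integrable lborel a" and b: "integrable lborel b"
    and h[measurable]: "h \<in> borel_measurable (lborel \<Otimes>\<^sub>M lborel)"
    and le: "\<And>x y. cmod (h (x, y)) \<le> B * cmod (a x) * cmod (b y)"
  shows "integrable (lborel \<Otimes>\<^sub>M lborel) h"
proof (rule integrableI_bounded)
  have [measurable]: "a \<in> borel_measurable borel" "b \<in> borel_measurable borel"
    using a b borel_measurable_integrable by fastforce+
  have fa: "(\<integral>\<^sup>+x. ennreal (cmod (a x)) \<partial>lborel) < \<infinity>" and fb: "(\<integral>\<^sup>+x. ennreal (cmod (b x)) \<partial>lborel) < \<infinity>"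
    using a b by (auto simp: integrable_iff_bounded)
  have "(\<integral>\<^sup>+z. ennreal (cmod (h z)) \<partial>(lborel \<Otimes>\<^sub>M lborel)) = (\<integral>\<^sup>+x. \<integral>\<^sup>+y. ennreal (cmod (h (x, y))) \<partial>lborel \<partial>lborel)"
    by (rule lborel.nn_integral_fst[symmetric]) auto
  also have "\<dots> \<le> (\<integral>\<^sup>+x. \<integral>\<^sup>+y. (ennreal \<bar>B\<bar> * ennreal (cmod (a x))) * ennreal (cmod (b y)) \<partial>lborel \<partial>lborel)"
  proof (intro nn_integral_mono)
    fix x y
    have "B * cmod (a x) * cmod (b y) \<le> \<bar>B\<bar> * cmod (a x) * cmod (b y)"
      by (intro mult_right_mono) auto
    then have "cmod (h (x, y)) \<le> \<bar>B\<bar> * cmod (a x) * cmod (b y)"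
      using le[of x y] by linarith
    then show "ennreal (cmod (h (x, y))) \<le> (ennreal \<bar>B\<bar> * ennreal (cmod (a x))) * ennreal (cmod (b y))"
      by (simp add: ennreal_mult[symmetric])
  qed
  also have "\<dots> = ennreal \<bar>B\<bar> * (\<integral>\<^sup>+x. ennreal (cmod (a x)) \<partial>lborel) * (\<integral>\<^sup>+y. ennreal (cmod (b y)) \<partial>lborel)"
    by (simp add: nn_integral_cmult nn_integral_multc)
  also have "\<dots> < \<infinity>" using fa fb by (auto simp: ennreal_mult_less_top)
  finally show "(\<integral>\<^sup>+z. ennreal (cmod (h z)) \<partial>(lborel \<Otimes>\<^sub>M lborel)) < \<infinity>" .
qed simp

lemma integrable_exp_gaussian:
  assumes "0 < \<epsilon>"
  shows "integrable lborel (\<lambda>\<xi>::'a::euclidean_space. complex_of_real (exp (- (\<epsilon> * norm \<xi>)\<^sup>2 / 2)))"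
  using gaussian_fourier(1)[OF assms, of "0::'a"] by (simp add: scaleR_conv_of_real)

lemma integrable_cis_times:
  fixes f :: "'a::euclidean_space \<Rightarrow> complex" and x :: 'a
  assumes "integrable lborel f"
  shows "integrable lborel (\<lambda>\<xi>. cis (x \<bullet> \<xi>) * f \<xi>)" "integrable lborel (\<lambda>\<xi>. cis (- (x \<bullet> \<xi>)) * f \<xi>)"
proof -
  have [measurable]: "f \<in> borel_measurable borel"
    using assms borel_measurable_integrable by fastforce
  show "integrable lborel (\<lambda>\<xi>. cis (x \<bullet> \<xi>) * f \<xi>)" "integrable lborel (\<lambda>\<xi>. cis (- (x \<bullet> \<xi>)) * f \<xi>)"
    by (rule Bochner_Integration.integrable_bound[OF assms]; simp add: norm_mult)+
qed

text \<open>Schur's test for an even convolution kernel. The product of the two moduli is at most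
  half the sum of their squares; in each half the variable missing from the square is integrated
  first and yields the total mass of the kernel.\<close>

lemma sqint_schur:
  fixes f :: "'a::euclidean_space \<Rightarrow> complex" and K :: "'a \<Rightarrow> ennreal"
  assumes [measurable]: "f \<in> borel_measurable borel" "K \<in> borel_measurable borel"
    and sym: "\<And>x. K (- x) = K x"
  shows "(\<integral>\<^sup>+x. \<integral>\<^sup>+y. ennreal (cmod (f x) * cmod (f y)) * K (y - x) \<partial>lborel \<partial>lborel)
           \<le> sqint f * (\<integral>\<^sup>+x. K x \<partial>lborel)"
proof -
  have K1: "(\<integral>\<^sup>+y. K (y - x) \<partial>lborel) = (\<integral>\<^sup>+x. K x \<partial>lborel)" for x
  proof -
    have "(\<integral>\<^sup>+y. K y \<partial>distr lborel borel ((+) (- x))) = (\<integral>\<^sup>+y. K (- x + y) \<partial>lborel)"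
      by (rule nn_integral_distr) auto
    then show ?thesis by (simp add: lborel_distr_plus)
  qed
  have K2: "(\<integral>\<^sup>+x. K (y - x) \<partial>lborel) = (\<integral>\<^sup>+x. K x \<partial>lborel)" for y
    using K1[of y] by (subst sym[symmetric]) simp
  have am: "ennreal (cmod a * cmod b) \<le> ennreal ((cmod a)\<^sup>2) / 2 + ennreal ((cmod b)\<^sup>2) / 2" for a b
  proof -
    have "cmod a * cmod b \<le> (cmod a)\<^sup>2 / 2 + (cmod b)\<^sup>2 / 2"
      using sum_squares_bound[of "cmod a" "cmod b"] by simp
    then have "ennreal (cmod a * cmod b) \<le> ennreal ((cmod a)\<^sup>2 / 2 + (cmod b)\<^sup>2 / 2)"
      by (rule ennreal_leI)
    also have "\<dots> = ennreal ((cmod a)\<^sup>2) / 2 + ennreal ((cmod b)\<^sup>2) / 2"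
      using divide_ennreal[of _ 2] by (simp add: ennreal_plus)
    finally show ?thesis .
  qed
  have "(\<integral>\<^sup>+x. \<integral>\<^sup>+y. ennreal (cmod (f x) * cmod (f y)) * K (y - x) \<partial>lborel \<partial>lborel)
      \<le> (\<integral>\<^sup>+x. \<integral>\<^sup>+y. (ennreal ((cmod (f x))\<^sup>2) / 2) * K (y - x) + (ennreal ((cmod (f y))\<^sup>2) / 2) * K (y - x) \<partial>lborel \<partial>lborel)"
    by (intro nn_integral_mono) (simp add: distrib_right[symmetric] mult_right_mono am)
  also have "\<dots> = (\<integral>\<^sup>+x. \<integral>\<^sup>+y. (ennreal ((cmod (f x))\<^sup>2) / 2) * K (y - x) \<partial>lborel \<partial>lborel)
      + (\<integral>\<^sup>+x. \<integral>\<^sup>+y. (ennreal ((cmod (f y))\<^sup>2) / 2) * K (y - x) \<partial>lborel \<partial>lborel)"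
    by (subst nn_integral_add[symmetric]) (auto simp: nn_integral_add)
  also have "(\<integral>\<^sup>+x. \<integral>\<^sup>+y. (ennreal ((cmod (f y))\<^sup>2) / 2) * K (y - x) \<partial>lborel \<partial>lborel)
      = (\<integral>\<^sup>+y. \<integral>\<^sup>+x. (ennreal ((cmod (f y))\<^sup>2) / 2) * K (y - x) \<partial>lborel \<partial>lborel)"
    by (rule lborel_pair.Fubini') simp
  also have "\<dots> = sqint f / 2 * (\<integral>\<^sup>+x. K x \<partial>lborel)"
    unfolding sqint_def by (simp add: nn_integral_cmult K2 nn_integral_multc nn_integral_divide)
  also have "(\<integral>\<^sup>+x. \<integral>\<^sup>+y. (ennreal ((cmod (f x))\<^sup>2) / 2) * K (y - x) \<partial>lborel \<partial>lborel) = sqint f / 2 * (\<integral>\<^sup>+x. K x \<partial>lborel)"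
    unfolding sqint_def by (simp add: nn_integral_cmult K1 nn_integral_multc nn_integral_divide)
  also have "sqint f / 2 * (\<integral>\<^sup>+x. K x \<partial>lborel) + sqint f / 2 * (\<integral>\<^sup>+x. K x \<partial>lborel) = sqint f * (\<integral>\<^sup>+x. K x \<partial>lborel)"
  proof -
    have "z / 2 + z / 2 = z" for z :: ennreal
      by (cases z) (auto simp: divide_ennreal[of _ 2, simplified] ennreal_plus[symmetric] ennreal_top_divide simp del: ennreal_plus)
    then show ?thesis by (simp only: distrib_right[symmetric])
  qed
  finally show ?thesis .
qed

text \<open>The Gaussian weight makes the triple integral behind the square of \<open>F\<close>
  absolutely convergent. Integrating in the frequency first turns the weight into its own transform
  \<open>k\<close>, a positive Gaussian whose mass does not depend on \<epsilon>, and Schur's test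
  finishes.\<close>

lemma sqint_fourier_gaussian_le:
  fixes f :: "'a::euclidean_space \<Rightarrow> complex"
  assumes f: "integrable lborel f" and \<epsilon>: "0 < \<epsilon>"
  defines "F \<equiv> \<lambda>\<xi>. LINT x|lborel. cis (- (x \<bullet> \<xi>)) * f x"
  shows "(\<integral>\<^sup>+\<xi>. ennreal (exp (- (\<epsilon> * norm \<xi>)\<^sup>2 / 2) * (cmod (F \<xi>))\<^sup>2) \<partial>lborel) \<le> ennreal ((2 * pi) ^ DIM('a)) * sqint f"
proof -
  have [measurable]: "f \<in> borel_measurable borel"
    using f borel_measurable_integrable by fastforce
  have [measurable]: "F \<in> borel_measurable borel"
    unfolding F_def by measurable
  define w where "w \<xi> = exp (- (\<epsilon> * norm \<xi>)\<^sup>2 / 2)" for \<xi> :: 'a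
  have [measurable]: "w \<in> borel_measurable borel" unfolding w_def by measurable
  have wi: "integrable lborel (\<lambda>\<xi>. complex_of_real (w \<xi>))"
    unfolding w_def by (rule integrable_exp_gaussian[OF \<epsilon>])
  have w0: "0 \<le> w \<xi>" for \<xi> by (simp add: w_def)
  define M where "M = (LINT x|lborel. cmod (f x))"
  have FM: "cmod (F \<xi>) \<le> M" for \<xi>
  proof -
    have "cmod (F \<xi>) \<le> (LINT x|lborel. cmod (cis (- (x \<bullet> \<xi>)) * f x))"
      unfolding F_def by (rule integral_norm_bound)
    then show ?thesis by (simp add: M_def norm_mult)
  qed
  have FMw: "w \<xi> * (cmod (F \<xi>) * cmod (f x)) \<le> M * (w \<xi> * cmod (f x))" for \<xi> x
    using mult_right_mono[OF FM[of \<xi>], of "w \<xi> * cmod (f x)"] w0[of \<xi>] by (simp add: mult_ac)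
  define k where "k z = (sqrt (2 * pi) / \<epsilon>) ^ DIM('a) * exp (- (norm z / \<epsilon>)\<^sup>2 / 2)" for z :: 'a
  have k0: "0 \<le> k z" for z using \<epsilon> by (simp add: k_def)
  have [measurable]: "k \<in> borel_measurable borel" unfolding k_def by measurable
  have keq: "(LINT \<xi>|lborel. complex_of_real (w \<xi>) * cis (z \<bullet> \<xi>)) = complex_of_real (k z)" for z
    using gaussian_fourier(2)[OF \<epsilon>, of z] by (simp add: w_def k_def scaleR_conv_of_real)
  \<comment> \<open>One of the two factors \<open>F\<close> is expanded here, the other in the main
    computation; Fubini is thus applied twice, each time with a product majorant in two
    variables.\<close>
  have inner: "(LINT \<xi>|lborel. complex_of_real (w \<xi>) * cis (- (x \<bullet> \<xi>)) * cnj (F \<xi>))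
      = (LINT y|lborel. cnj (f y) * complex_of_real (k (y - x)))" for x
  proof -
    have cF: "cnj (F \<xi>) = (LINT y|lborel. cis (y \<bullet> \<xi>) * cnj (f y))" for \<xi>
    proof -
      have "cnj (F \<xi>) = (LINT y|lborel. cnj (cis (- (y \<bullet> \<xi>)) * f y))"
        unfolding F_def by (rule Bochner_Integration.integral_cnj[symmetric])
      then show ?thesis by (simp add: cis_cnj)
    qed
    have "(LINT \<xi>|lborel. complex_of_real (w \<xi>) * cis (- (x \<bullet> \<xi>)) * cnj (F \<xi>))
       = (LINT \<xi>|lborel. LINT y|lborel. complex_of_real (w \<xi>) * cis (- (x \<bullet> \<xi>)) * (cis (y \<bullet> \<xi>) * cnj (f y)))"
      by (simp add: cF)
    also have "\<dots> = (LINT y|lborel. LINT \<xi>|lborel. complex_of_real (w \<xi>) * cis (- (x \<bullet> \<xi>)) * (cis (y \<bullet> \<xi>) * cnj (f y)))"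
      by (rule lborel_pair.Fubini_integral, rule integrable_lborel_pair[OF f wi, where B=1])
        (auto simp: norm_mult case_prod_beta w0)
    also have "\<dots> = (LINT y|lborel. cnj (f y) * complex_of_real (k (y - x)))"
    proof (rule Bochner_Integration.integral_cong[OF refl])
      fix y
      have "(LINT \<xi>|lborel. complex_of_real (w \<xi>) * cis (- (x \<bullet> \<xi>)) * (cis (y \<bullet> \<xi>) * cnj (f y)))
          = (LINT \<xi>|lborel. cnj (f y) * (complex_of_real (w \<xi>) * cis ((y - x) \<bullet> \<xi>)))"
      proof (intro Bochner_Integration.integral_cong refl)
        fix \<xi>
        have "cis (- (x \<bullet> \<xi>)) * cis (y \<bullet> \<xi>) = cis ((y - x) \<bullet> \<xi>)"
          by (simp add: cis_mult inner_diff_left)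
        then show "complex_of_real (w \<xi>) * cis (- (x \<bullet> \<xi>)) * (cis (y \<bullet> \<xi>) * cnj (f y))
            = cnj (f y) * (complex_of_real (w \<xi>) * cis ((y - x) \<bullet> \<xi>))"
          by (metis mult.assoc mult.commute)
      qed
      also have "\<dots> = cnj (f y) * complex_of_real (k (y - x))"
        by (simp add: keq)
      finally show "(LINT \<xi>|lborel. complex_of_real (w \<xi>) * cis (- (x \<bullet> \<xi>)) * (cis (y \<bullet> \<xi>) * cnj (f y)))
        = cnj (f y) * complex_of_real (k (y - x))" .
    qed
    finally show ?thesis .
  qed
  \<comment> \<open>\<open>F\<close> is bounded by the integral of the modulus of f, so the weight
    alone provides integrability.\<close>
  have cfi: "integrable lborel (\<lambda>\<xi>. complex_of_real (w \<xi>) * (F \<xi> * cnj (F \<xi>)))"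
  proof (rule Bochner_Integration.integrable_bound)
    show "integrable lborel (\<lambda>\<xi>. complex_of_real (M * M) * complex_of_real (w \<xi>))"
      using wi by simp
    show "AE \<xi> in lborel. cmod (complex_of_real (w \<xi>) * (F \<xi> * cnj (F \<xi>))) \<le> cmod (complex_of_real (M * M) * complex_of_real (w \<xi>))"
    proof (intro AE_I2)
      fix \<xi>
      have "cmod (F \<xi>) * cmod (F \<xi>) \<le> M * M"
        using FM[of \<xi>] by (intro mult_mono) (auto intro: order_trans[OF norm_ge_zero])
      then have "w \<xi> * (cmod (F \<xi>) * cmod (F \<xi>)) \<le> w \<xi> * (M * M)"
        using w0 by (rule mult_left_mono)
      then show "cmod (complex_of_real (w \<xi>) * (F \<xi> * cnj (F \<xi>))) \<le> cmod (complex_of_real (M * M) * complex_of_real (w \<xi>))"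
        using w0[of \<xi>] by (simp add: norm_mult mult.commute)
    qed
  qed measurable
  have "(LINT \<xi>|lborel. complex_of_real (w \<xi>) * (F \<xi> * cnj (F \<xi>)))
     = (LINT \<xi>|lborel. LINT x|lborel. complex_of_real (w \<xi>) * (cis (- (x \<bullet> \<xi>)) * f x) * cnj (F \<xi>))"
  proof (intro Bochner_Integration.integral_cong refl)
    fix \<xi>
    have Fx: "(LINT x|lborel. cis (- (x \<bullet> \<xi>)) * f x) = F \<xi>"
      by (simp add: F_def)
    have "(LINT x|lborel. complex_of_real (w \<xi>) * (cis (- (x \<bullet> \<xi>)) * f x) * cnj (F \<xi>))
        = complex_of_real (w \<xi>) * (LINT x|lborel. cis (- (x \<bullet> \<xi>)) * f x) * cnj (F \<xi>)"
      by (simp only: integral_mult_left_zero integral_mult_right_zero)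
    then show "complex_of_real (w \<xi>) * (F \<xi> * cnj (F \<xi>)) = (LINT x|lborel. complex_of_real (w \<xi>) * (cis (- (x \<bullet> \<xi>)) * f x) * cnj (F \<xi>))"
      by (simp only: Fx mult.assoc)
  qed
  also have "\<dots> = (LINT x|lborel. LINT \<xi>|lborel. complex_of_real (w \<xi>) * (cis (- (x \<bullet> \<xi>)) * f x) * cnj (F \<xi>))"
    by (rule lborel_pair.Fubini_integral, rule integrable_lborel_pair[OF f wi, where B=M])
      (use FMw in \<open>auto simp: norm_mult case_prod_beta w0 mult.commute mult.left_commute\<close>)
  also have "\<dots> = (LINT x|lborel. f x * (LINT y|lborel. cnj (f y) * complex_of_real (k (y - x))))"
  proof (rule Bochner_Integration.integral_cong[OF refl])
    fix x
    have "(LINT \<xi>|lborel. complex_of_real (w \<xi>) * (cis (- (x \<bullet> \<xi>)) * f x) * cnj (F \<xi>))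
        = (LINT \<xi>|lborel. f x * (complex_of_real (w \<xi>) * cis (- (x \<bullet> \<xi>)) * cnj (F \<xi>)))"
      by (simp add: mult_ac)
    then show "(LINT \<xi>|lborel. complex_of_real (w \<xi>) * (cis (- (x \<bullet> \<xi>)) * f x) * cnj (F \<xi>))
        = f x * (LINT y|lborel. cnj (f y) * complex_of_real (k (y - x)))"
      by (simp add: inner)
  qed
  finally have main: "(LINT \<xi>|lborel. complex_of_real (w \<xi>) * (F \<xi> * cnj (F \<xi>)))
     = (LINT x|lborel. f x * (LINT y|lborel. cnj (f y) * complex_of_real (k (y - x))))" .
  have re: "complex_of_real (w \<xi>) * (F \<xi> * cnj (F \<xi>)) = complex_of_real (w \<xi> * (cmod (F \<xi>))\<^sup>2)" for \<xi>
    by (simp add: complex_norm_square[symmetric])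
  have "(\<integral>\<^sup>+\<xi>. ennreal (w \<xi> * (cmod (F \<xi>))\<^sup>2) \<partial>lborel) = ennreal (LINT \<xi>|lborel. w \<xi> * (cmod (F \<xi>))\<^sup>2)"
    using cfi unfolding re complex_of_real_integrable_eq by (intro nn_integral_eq_integral) (auto simp: w0)
  also have "\<dots> \<le> ennreal (cmod (LINT x|lborel. f x * (LINT y|lborel. cnj (f y) * complex_of_real (k (y - x)))))"
    unfolding main[symmetric] re integral_complex_of_real by (intro ennreal_leI) simp
  also have "\<dots>
     \<le> (\<integral>\<^sup>+x. ennreal (cmod (f x * (LINT y|lborel. cnj (f y) * complex_of_real (k (y - x))))) \<partial>lborel)"
    by (rule norm_integral_le_nn_integral)
  also have "\<dots> \<le> (\<integral>\<^sup>+x. \<integral>\<^sup>+y. ennreal (cmod (f x) * cmod (f y)) * ennreal (k (y - x)) \<partial>lborel \<partial>lborel)"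
  proof (intro nn_integral_mono)
    fix x
    have "ennreal (cmod (f x * (LINT y|lborel. cnj (f y) * complex_of_real (k (y - x)))))
       = ennreal (cmod (f x)) * ennreal (cmod (LINT y|lborel. cnj (f y) * complex_of_real (k (y - x))))"
      by (simp add: norm_mult ennreal_mult)
    also have "\<dots> \<le> ennreal (cmod (f x)) * (\<integral>\<^sup>+y. ennreal (cmod (cnj (f y) * complex_of_real (k (y - x)))) \<partial>lborel)"
      by (intro mult_left_mono norm_integral_le_nn_integral) auto
    also have "\<dots> = (\<integral>\<^sup>+y. ennreal (cmod (f x) * cmod (f y)) * ennreal (k (y - x)) \<partial>lborel)"
      by (subst nn_integral_cmult[symmetric]) (auto simp: norm_mult ennreal_mult k0 mult_ac)
    finally show "ennreal (cmod (f x * (LINT y|lborel. cnj (f y) * complex_of_real (k (y - x)))))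
      \<le> (\<integral>\<^sup>+y. ennreal (cmod (f x) * cmod (f y)) * ennreal (k (y - x)) \<partial>lborel)" .
  qed
  also have "\<dots> \<le> sqint f * (\<integral>\<^sup>+z. ennreal (k z) \<partial>lborel)"
    by (rule sqint_schur) (auto simp: k_def)
  \<comment> \<open>The height of \<open>k\<close> and its width carry opposite powers of
    \<epsilon>, which cancel in the mass.\<close>
  also have "(\<integral>\<^sup>+z. ennreal (k z) \<partial>lborel) = ennreal ((2 * pi) ^ DIM('a))"
  proof -
    have "(\<integral>\<^sup>+z. ennreal (k z) \<partial>lborel) = ennreal ((sqrt (2 * pi) / \<epsilon>) ^ DIM('a)) * ennreal ((sqrt (2 * pi) * \<epsilon>) ^ DIM('a))"
      unfolding nn_integral_gaussian[OF \<epsilon>, where 'a='a, symmetric] k_def using \<epsilon>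
      by (subst nn_integral_cmult[symmetric]) (auto simp: ennreal_mult)
    also have "\<dots> = ennreal ((2 * pi) ^ DIM('a))"
    proof -
      have "(sqrt (2 * pi) / \<epsilon>) ^ DIM('a) * (sqrt (2 * pi) * \<epsilon>) ^ DIM('a) = (sqrt (2 * pi) / \<epsilon> * (sqrt (2 * pi) * \<epsilon>)) ^ DIM('a)"
        by (simp only: power_mult_distrib)
      also have "sqrt (2 * pi) / \<epsilon> * (sqrt (2 * pi) * \<epsilon>) = 2 * pi"
        using \<epsilon> real_sqrt_mult_self[of "2 * pi"] by (simp add: field_simps del: real_sqrt_mult_self)
      finally show ?thesis using \<epsilon> by (simp only: ennreal_mult[symmetric] divide_nonneg_pos zero_le_power real_sqrt_ge_zero mult_nonneg_nonneg less_imp_le pi_ge_zero zero_le_numeral)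
    qed
    finally show ?thesis .
  qed
  finally show ?thesis by (simp add: w_def mult.commute)
qed

lemma measurable_fourier_integral:
  assumes [measurable]: "f \<in> borel_measurable borel"
  shows "fourier_integral f \<in> borel_measurable borel"
  unfolding fourier_integral_def by measurable

text \<open>The regularised bound is uniform in \<epsilon>, so Fatou's lemma removes the weight as
  \<epsilon> tends to 0. The unitary normalisation cancels the power of 2 pi exactly. An inequality
  suffices, as norms only have to be bounded from above.\<close>

theorem sqint_fourier_integral_le:
  fixes f :: "'a::euclidean_space \<Rightarrow> complex"
  assumes f: "integrable lborel f"
  shows "sqint (fourier_integral f) \<le> sqint f"
proof -
  have [measurable]: "f \<in> borel_measurable borel"
    using f borel_measurable_integrable by fastforce
  note [measurable] = measurable_fourier_integral[of f]
  define F where "F = (\<lambda>\<xi>. LINT x|lborel. cis (- (x \<bullet> \<xi>)) * f x)"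
  have [measurable]: "F \<in> borel_measurable borel"
    unfolding F_def by measurable
  define \<epsilon> where "\<epsilon> n = 1 / real (Suc n)" for n
  have \<epsilon>0: "0 < \<epsilon> n" for n by (simp add: \<epsilon>_def)
  have \<epsilon>l: "\<epsilon> \<longlonglongrightarrow> 0" unfolding \<epsilon>_def by (rule LIMSEQ_Suc[OF lim_1_over_n])
  have "sqint F \<le> (\<integral>\<^sup>+\<xi>. liminf (\<lambda>n. ennreal (exp (- (\<epsilon> n * norm \<xi>)\<^sup>2 / 2) * (cmod (F \<xi>))\<^sup>2)) \<partial>lborel)"
    unfolding sqint_def
  proof (intro nn_integral_mono)
    fix \<xi>
    have "(\<lambda>n. ennreal (exp (- (\<epsilon> n * norm \<xi>)\<^sup>2 / 2) * (cmod (F \<xi>))\<^sup>2)) \<longlonglongrightarrow> ennreal (exp (- (0 * norm \<xi>)\<^sup>2 / 2) * (cmod (F \<xi>))\<^sup>2)"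
      by (intro tendsto_intros \<epsilon>l) auto
    then show "ennreal ((cmod (F \<xi>))\<^sup>2) \<le> liminf (\<lambda>n. ennreal (exp (- (\<epsilon> n * norm \<xi>)\<^sup>2 / 2) * (cmod (F \<xi>))\<^sup>2))"
      using lim_imp_Liminf[OF sequentially_bot] by fastforce
  qed
  also have "\<dots> \<le> liminf (\<lambda>n. \<integral>\<^sup>+\<xi>. ennreal (exp (- (\<epsilon> n * norm \<xi>)\<^sup>2 / 2) * (cmod (F \<xi>))\<^sup>2) \<partial>lborel)"
    by (rule nn_integral_liminf) auto
  also have "\<dots> \<le> liminf (\<lambda>n. ennreal ((2 * pi) ^ DIM('a)) * sqint f)"
    unfolding F_def by (intro Liminf_mono always_eventually allI sqint_fourier_gaussian_le f \<epsilon>0)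
  finally have F: "sqint F \<le> ennreal ((2 * pi) ^ DIM('a)) * sqint f"
    by (simp add: Liminf_const)
  define c where "c = (2 * pi) powr (- real DIM('a) / 2)"
  have c2: "c\<^sup>2 * (2 * pi) ^ DIM('a) = 1"
  proof -
    have "c\<^sup>2 = (2 * pi) powr (- real DIM('a))"
      by (simp add: c_def power2_eq_square powr_add[symmetric])
    then show ?thesis by (simp add: powr_minus powr_realpow power_mult_distrib field_simps)
  qed
  have "sqint (fourier_integral f) = (\<integral>\<^sup>+\<xi>. ennreal (c\<^sup>2) * ennreal ((cmod (F \<xi>))\<^sup>2) \<partial>lborel)"
    unfolding sqint_def fourier_integral_def F_def c_def
    by (intro nn_integral_cong) (simp add: norm_mult power_mult_distrib ennreal_mult)
  also have "\<dots> = ennreal (c\<^sup>2) * sqint F"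
    unfolding sqint_def by (rule nn_integral_cmult) auto
  also have "\<dots> \<le> ennreal (c\<^sup>2) * (ennreal ((2 * pi) ^ DIM('a)) * sqint f)"
    by (intro mult_left_mono F) auto
  also have "\<dots> = sqint f"
    using c2 by (simp add: mult.assoc[symmetric] ennreal_mult[symmetric])
  finally show ?thesis .
qed


section \<open>The Fourier transform on square-integrable functions\<close>

text \<open>Lower semicontinuity of the squared norm. It is used twice for the construction of the
  transform: for the error of an approximation and for the size of the limit.\<close>

lemma sqint_Fatou:
  assumes [measurable]: "\<And>k::nat. h k \<in> borel_measurable borel"
    and conv: "AE x in lborel. (\<lambda>k. h k x) \<longlonglongrightarrow> g x"
    and le: "\<forall>\<^sub>F k in sequentially. sqint (h k) \<le> c"
  shows "sqint g \<le> c"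
proof -
  have "sqint g \<le> (\<integral>\<^sup>+x. liminf (\<lambda>k. ennreal ((cmod (h k x))\<^sup>2)) \<partial>lborel)"
    unfolding sqint_def
  proof (rule nn_integral_mono_AE, use conv in eventually_elim)
    fix x assume "(\<lambda>k. h k x) \<longlonglongrightarrow> g x"
    then have "(\<lambda>k. ennreal ((cmod (h k x))\<^sup>2)) \<longlonglongrightarrow> ennreal ((cmod (g x))\<^sup>2)"
      by (intro tendsto_intros)
    then show "ennreal ((cmod (g x))\<^sup>2) \<le> liminf (\<lambda>k. ennreal ((cmod (h k x))\<^sup>2))"
      using lim_imp_Liminf[OF sequentially_bot] by fastforce
  qed
  also have "\<dots> \<le> liminf (\<lambda>k. sqint (h k))"
    unfolding sqint_def by (rule nn_integral_liminf) auto
  also have "\<dots> \<le> liminf (\<lambda>k. c)"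
    by (rule Liminf_mono[OF le])
  finally show ?thesis by (simp add: Liminf_const)
qed

text \<open>A name for the truncation that is spelled out inside
  \<open>has_fourier_L2\<close>.\<close>

definition ball_truncation :: "('a::euclidean_space \<Rightarrow> complex) \<Rightarrow> nat \<Rightarrow> 'a \<Rightarrow> complex" where
  "ball_truncation f n = (\<lambda>x. if norm x \<le> real n then f x else 0)"

lemma measurable_ball_truncation [measurable]:
  assumes [measurable]: "f \<in> borel_measurable borel"
  shows "ball_truncation f n \<in> borel_measurable borel"
  unfolding ball_truncation_def by measurable

text \<open>Since t \<le> 1 + t^2, the integral of the modulus over a ball is at most the volume
  plus the squared norm.\<close>

lemma in_L2_bounded_support_integrable:
  fixes f :: "'a::euclidean_space \<Rightarrow> complex"
  assumes f: "in_L2 f" and supp: "\<And>x. R < norm x \<Longrightarrow> f x = 0"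
  shows "integrable lborel f"
proof (rule integrableI_bounded)
  have [measurable]: "f \<in> borel_measurable borel" using f by (simp add: in_L2_iff)
  have [measurable]: "cball (0::'a) R \<in> sets borel" by simp
  have "(\<integral>\<^sup>+x. ennreal (cmod (f x)) \<partial>lborel) \<le> (\<integral>\<^sup>+x. indicator (cball 0 R) x + ennreal ((cmod (f x))\<^sup>2) \<partial>lborel)"
  proof (rule nn_integral_mono)
    fix x
    show "ennreal (cmod (f x)) \<le> indicator (cball 0 R) x + ennreal ((cmod (f x))\<^sup>2)"
    proof (cases "norm x \<le> R")
      case True
      have "cmod (f x) \<le> 1 + (cmod (f x))\<^sup>2"
        using sum_squares_bound[of 1 "cmod (f x)"] norm_ge_zero[of "f x"] unfolding power2_eq_square by linarith
      then have "ennreal (cmod (f x)) \<le> ennreal (1 + (cmod (f x))\<^sup>2)" by (rule ennreal_leI)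
      then show ?thesis using True by (simp add: ennreal_plus)
    qed (simp add: supp)
  qed
  also have "\<dots> = emeasure lborel (cball (0::'a) R) + sqint f"
    unfolding sqint_def by (subst nn_integral_add) auto
  also have "\<dots> < \<infinity>"
    using f emeasure_lborel_cball_finite[of "0::'a" R] by (auto simp: in_L2_iff)
  finally show "(\<integral>\<^sup>+x. ennreal (cmod (f x)) \<partial>lborel) < \<infinity>" .
  show "f \<in> borel_measurable lborel" by simp
qed

lemma in_L2_ball_truncation:
  assumes f: "in_L2 f"
  shows "in_L2 (ball_truncation f n)"
proof -
  have [measurable]: "f \<in> borel_measurable borel" using f by (simp add: in_L2_iff)
  have "sqint (ball_truncation f n) \<le> sqint f"
    unfolding sqint_def ball_truncation_def by (intro nn_integral_mono) auto
  then show ?thesis using f by (auto simp: in_L2_iff)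
qed

lemma integrable_ball_truncation:
  assumes "in_L2 f"
  shows "integrable lborel (ball_truncation f n)"
  by (rule in_L2_bounded_support_integrable[OF in_L2_ball_truncation[OF assms], of "real n"])
    (auto simp: ball_truncation_def)

lemma fourier_integral_diff:
  assumes "integrable lborel f" "integrable lborel g"
  shows "fourier_integral f \<xi> - fourier_integral g \<xi> = fourier_integral (\<lambda>x. f x - g x) \<xi>"
proof -
  have "integrable lborel (\<lambda>x. cis (- (x \<bullet> \<xi>)) * f x)" "integrable lborel (\<lambda>x. cis (- (x \<bullet> \<xi>)) * g x)"
    using assms[THEN integrable_cis_times(2), of \<xi>] by (simp_all add: inner_commute)
  then show ?thesis
    by (simp add: fourier_integral_def right_diff_distrib)
qed

text \<open>Completeness is proved by hand, because the form of the limit matters: it is the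
  pointwise \<open>lim\<close> of explicit transforms along a subsequence, so that a property such
  as radiality passes to it at every point. Plancherel's inequality bounds the distance of two
  truncated transforms by a tail \<tau> of f.\<close>

theorem has_fourier_L2_exists:
  fixes f :: "'a::euclidean_space \<Rightarrow> complex"
  assumes f: "in_L2 f"
  shows "\<exists>\<nu>. has_fourier_L2 f (\<lambda>\<xi>. lim (\<lambda>k. fourier_integral (ball_truncation f (\<nu> k)) \<xi>)) \<and>
      sqint (\<lambda>\<xi>. lim (\<lambda>k. fourier_integral (ball_truncation f (\<nu> k)) \<xi>)) \<le> sqint f"
proof -
  have fm[measurable]: "f \<in> borel_measurable borel" using f by (simp add: in_L2_iff)
  define F where "F n = fourier_integral (ball_truncation f n)" for n
  have [measurable]: "F n \<in> borel_measurable borel" for n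
    unfolding F_def by (rule measurable_fourier_integral) measurable
  define \<tau> where "\<tau> n = (\<integral>\<^sup>+x. ennreal ((cmod (f x))\<^sup>2) * indicator {x. real n < norm x} x \<partial>lborel)" for n :: nat
  have diff: "sqint (\<lambda>\<xi>. F m \<xi> - F n \<xi>) \<le> \<tau> (min m n)" for m n
  proof -
    have "sqint (\<lambda>\<xi>. F m \<xi> - F n \<xi>) = sqint (fourier_integral (\<lambda>x. ball_truncation f m x - ball_truncation f n x))"
      unfolding F_def
      by (rule arg_cong[where f=sqint], rule ext)
        (intro fourier_integral_diff integrable_ball_truncation f)
    also have "\<dots> \<le> sqint (\<lambda>x. ball_truncation f m x - ball_truncation f n x)"
      by (intro sqint_fourier_integral_le Bochner_Integration.integrable_diff integrable_ball_truncation f)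
    also have "\<dots> \<le> \<tau> (min m n)"
      unfolding sqint_def \<tau>_def
      by (intro nn_integral_mono) (auto simp: ball_truncation_def indicator_def)
    finally show ?thesis .
  qed
  have \<tau>0: "\<tau> \<longlonglongrightarrow> 0"
  proof -
    have "\<tau> \<longlonglongrightarrow> (\<integral>\<^sup>+x. 0 \<partial>(lborel :: 'a measure))"
      unfolding \<tau>_def
    proof (rule nn_integral_dominated_convergence[where w="\<lambda>x. ennreal ((cmod (f x))\<^sup>2)"])
      show "(\<integral>\<^sup>+x. ennreal ((cmod (f x))\<^sup>2) \<partial>lborel) < \<infinity>"
        using f by (simp add: in_L2_iff sqint_def)
      show "AE x in lborel. (\<lambda>n. ennreal ((cmod (f x))\<^sup>2) * indicator {x. real n < norm x} x) \<longlonglongrightarrow> 0"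
      proof (rule AE_I2)
        fix x :: 'a
        have "\<forall>\<^sub>F n in sequentially. ennreal ((cmod (f x))\<^sup>2) * indicator {x. real n < norm x} x = 0"
          using eventually_ge_at_top[of "nat \<lceil>norm x\<rceil>"]
          by eventually_elim (auto simp: indicator_def ceiling_le_iff nat_le_iff)
        then show "(\<lambda>n. ennreal ((cmod (f x))\<^sup>2) * indicator {x. real n < norm x} x) \<longlonglongrightarrow> 0"
          by (rule tendsto_eventually)
      qed
    qed (auto simp: indicator_def)
    then show ?thesis by simp
  qed
  \<comment> \<open>The rate 8^-k leaves room for the weight 4^k in the series \<open>S\<close>
    below: its integral is at most the sum of 2^-k, and where \<open>S\<close> is finite the
    increments are of size at most a constant times 2^-k, hence summable.\<close>
  have "\<exists>n\<ge>k. \<tau> n \<le> ennreal ((1/8) ^ k)" for k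
  proof -
    have "\<forall>\<^sub>F n in sequentially. \<tau> n \<le> ennreal ((1/8) ^ k)"
      using \<tau>0 unfolding tendsto_0_ennreal_iff by simp
    then have "\<forall>\<^sub>F n in sequentially. k \<le> n \<and> \<tau> n \<le> ennreal ((1/8) ^ k)"
      using eventually_ge_at_top[of k] by eventually_elim simp
    then show ?thesis
      unfolding eventually_sequentially by blast
  qed
  then obtain \<nu> where \<nu>: "\<And>k. k \<le> \<nu> k" "\<And>k. \<tau> (\<nu> k) \<le> ennreal ((1/8) ^ k)"
    by metis
  define D where "D k \<xi> = F (\<nu> (Suc k)) \<xi> - F (\<nu> k) \<xi>" for k \<xi>
  have [measurable]: "D k \<in> borel_measurable borel" for k unfolding D_def by measurable
  have D: "sqint (D k) \<le> ennreal ((1/8) ^ k)" for k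
  proof -
    have "sqint (D k) \<le> \<tau> (min (\<nu> (Suc k)) (\<nu> k))" unfolding D_def by (rule diff)
    also have "\<dots> \<le> max (\<tau> (\<nu> (Suc k))) (\<tau> (\<nu> k))" by (auto simp: min_def)
    also have "\<dots> \<le> ennreal ((1/8) ^ k)"
      using \<nu>(2)[of k] order_trans[OF \<nu>(2)[of "Suc k"], of "ennreal ((1/8) ^ k)"]
      by (auto intro!: ennreal_leI)
    finally show ?thesis .
  qed
  define S where "S \<xi> = (\<Sum>k. ennreal (4 ^ k) * ennreal ((cmod (D k \<xi>))\<^sup>2))" for \<xi>
  have "(\<integral>\<^sup>+\<xi>. S \<xi> \<partial>lborel) = (\<Sum>k. ennreal (4 ^ k) * sqint (D k))"
    unfolding S_def sqint_def by (subst nn_integral_suminf) (auto simp: nn_integral_cmult)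
  also have "\<dots> \<le> (\<Sum>k. ennreal ((1/2) ^ k))"
  proof (intro suminf_le allI)
    fix k
    have "ennreal (4 ^ k) * sqint (D k) \<le> ennreal (4 ^ k) * ennreal ((1/8) ^ k)"
      by (intro mult_left_mono D) auto
    also have "\<dots> = ennreal ((1/2) ^ k)"
      using power_mult_distrib[of "4::real" "1/8" k] by (simp add: ennreal_mult[symmetric])
    finally show "ennreal (4 ^ k) * sqint (D k) \<le> ennreal ((1/2) ^ k)" .
  qed auto
  also have "\<dots> < \<infinity>"
    by (subst suminf_ennreal2) (auto intro!: summable_geometric)
  finally have "AE \<xi> in lborel. S \<xi> \<noteq> \<infinity>"
    by (intro nn_integral_noteq_infinite) (auto simp: S_def)
  then have conv: "AE \<xi> in lborel. (\<lambda>k. F (\<nu> k) \<xi>) \<longlonglongrightarrow> lim (\<lambda>k. F (\<nu> k) \<xi>)"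
  proof eventually_elim
    fix \<xi> assume "S \<xi> \<noteq> \<infinity>"
    then obtain s where s: "S \<xi> = ennreal s" "0 \<le> s" by (cases "S \<xi>") auto
    have "norm (D k \<xi>) \<le> sqrt s * (1/2) ^ k" for k
    proof -
      have "ennreal (4 ^ k) * ennreal ((cmod (D k \<xi>))\<^sup>2) \<le> ennreal s"
        unfolding s(1)[symmetric] S_def
        using sum_le_suminf[of "\<lambda>k. ennreal (4 ^ k) * ennreal ((cmod (D k \<xi>))\<^sup>2)" "{k}"] by auto
      then have "4 ^ k * (cmod (D k \<xi>))\<^sup>2 \<le> s"
        using s by (simp add: ennreal_mult[symmetric] ennreal_le_iff)
      then have "(2 ^ k * cmod (D k \<xi>))\<^sup>2 \<le> s"
        using power_mult_distrib[of "2::real" 2 k] by (simp add: power2_eq_square mult_ac)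
      then have "2 ^ k * cmod (D k \<xi>) \<le> sqrt s"
        by (rule real_le_rsqrt)
      then show ?thesis by (simp add: power_one_over field_simps)
    qed
    moreover have "summable (\<lambda>k. sqrt s * (1/2 :: real) ^ k)"
      by (intro summable_mult summable_geometric) simp
    ultimately have "summable (\<lambda>k. D k \<xi>)"
      by (rule summable_comparison_test'[where N=0, rotated])
    then have "convergent (\<lambda>k. \<Sum>j<k. D j \<xi>)"
      by (simp add: summable_iff_convergent)
    moreover have "(\<Sum>j<k. D j \<xi>) = F (\<nu> k) \<xi> - F (\<nu> 0) \<xi>" for k
      unfolding D_def by (rule sum_lessThan_telescope)
    ultimately have "convergent (\<lambda>k. F (\<nu> k) \<xi> - F (\<nu> 0) \<xi>)" by simp
    then have "convergent (\<lambda>k. F (\<nu> k) \<xi>)"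
      by (simp add: convergent_diff_const_right_iff)
    then show "(\<lambda>k. F (\<nu> k) \<xi>) \<longlonglongrightarrow> lim (\<lambda>k. F (\<nu> k) \<xi>)"
      by (simp add: convergent_LIMSEQ_iff)
  qed
  define g where "g \<xi> = lim (\<lambda>k. F (\<nu> k) \<xi>)" for \<xi>
  have [measurable]: "g \<in> borel_measurable borel"
    unfolding g_def by (rule borel_measurable_lim_metric) measurable
  \<comment> \<open>Fatou's lemma in k with m fixed. The tail beyond m does not depend on k, so the
    whole sequence converges to \<open>g\<close>, not just the chosen subsequence.\<close>
  have close: "sqint (\<lambda>\<xi>. F m \<xi> - g \<xi>) \<le> \<tau> m" for m
  proof (rule sqint_Fatou)
    show "AE \<xi> in lborel. (\<lambda>k. F m \<xi> - F (\<nu> k) \<xi>) \<longlonglongrightarrow> F m \<xi> - g \<xi>"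
      using conv unfolding g_def by eventually_elim (intro tendsto_intros)
    show "\<forall>\<^sub>F k in sequentially. sqint (\<lambda>\<xi>. F m \<xi> - F (\<nu> k) \<xi>) \<le> \<tau> m"
      using eventually_ge_at_top[of m]
    proof eventually_elim
      fix k assume "m \<le> k"
      then have "min m (\<nu> k) = m" using \<nu>(1)[of k] by simp
      then show "sqint (\<lambda>\<xi>. F m \<xi> - F (\<nu> k) \<xi>) \<le> \<tau> m" using diff[of m "\<nu> k"] by simp
    qed
  qed measurable
  have gle: "sqint g \<le> sqint f"
  proof (rule sqint_Fatou)
    show "AE \<xi> in lborel. (\<lambda>k. F (\<nu> k) \<xi>) \<longlonglongrightarrow> g \<xi>" using conv unfolding g_def .
    show "\<forall>\<^sub>F k in sequentially. sqint (F (\<nu> k)) \<le> sqint f"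
    proof (intro always_eventually allI)
      fix k
      have "sqint (F (\<nu> k)) \<le> sqint (ball_truncation f (\<nu> k))"
        unfolding F_def by (intro sqint_fourier_integral_le integrable_ball_truncation f)
      also have "\<dots> \<le> sqint f"
        unfolding sqint_def ball_truncation_def by (intro nn_integral_mono) auto
      finally show "sqint (F (\<nu> k)) \<le> sqint f" .
    qed
  qed measurable
  have "(\<lambda>m. sqint (\<lambda>\<xi>. F m \<xi> - g \<xi>)) \<longlonglongrightarrow> 0"
    by (rule tendsto_sandwich[OF _ _ tendsto_const \<tau>0]) (auto intro!: always_eventually close)
  then have "has_fourier_L2 f g"
    unfolding has_fourier_L2_def L2_norm_tendsto_0_iff
    using gle f by (auto simp: in_L2_iff F_def ball_truncation_def)
  then show ?thesis using gle unfolding g_def F_def by blast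
qed

lemma has_fourier_L2_fourier_L2: "in_L2 f \<Longrightarrow> has_fourier_L2 f (fourier_L2 f)"
  unfolding fourier_L2_def using has_fourier_L2_exists by (metis someI)

lemma fourier_L2_AE_eqI:
  assumes f: "in_L2 f" and g: "has_fourier_L2 f g"
  shows "AE \<xi> in lborel. fourier_L2 f \<xi> = g \<xi>"
proof (rule has_fourier_L2_unique[OF _ _ has_fourier_L2_fourier_L2[OF f] g])
  show [measurable]: "f \<in> borel_measurable borel" using f by (simp add: in_L2_iff)
  show "fourier_integral (\<lambda>x. if norm x \<le> real n then f x else 0) \<in> borel_measurable borel" for n :: nat
    by (rule measurable_fourier_integral) measurable
qed

lemma sqint_fourier_L2_le:
  assumes f: "in_L2 f"
  shows "sqint (fourier_L2 f) \<le> sqint f"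
proof -
  obtain g where "has_fourier_L2 f g" "sqint g \<le> sqint f"
    using has_fourier_L2_exists[OF f] by blast
  with fourier_L2_AE_eqI[OF f] show ?thesis
    using sqint_cong_AE by metis
qed

text \<open>The truncations of such an f eventually coincide with f, so the defining sequence is
  eventually constant.\<close>

lemma fourier_L2_bounded_support:
  fixes f :: "'a::euclidean_space \<Rightarrow> complex"
  assumes f: "in_L2 f" and supp: "\<And>x. R < norm x \<Longrightarrow> f x = 0"
  shows "AE \<xi> in lborel. fourier_L2 f \<xi> = fourier_integral f \<xi>"
proof (rule fourier_L2_AE_eqI[OF f])
  have [measurable]: "f \<in> borel_measurable borel" using f by (simp add: in_L2_iff)
  have i: "integrable lborel f" by (rule in_L2_bounded_support_integrable[OF f supp])
  have "in_L2 (fourier_integral f)"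
    using sqint_fourier_integral_le[OF i] f measurable_fourier_integral[of f] by (auto simp: in_L2_iff)
  moreover have "\<forall>\<^sub>F n in sequentially. sqint (\<lambda>\<xi>. fourier_integral (\<lambda>x. if norm x \<le> real n then f x else 0) \<xi> - fourier_integral f \<xi>) = 0"
    using eventually_ge_at_top[of "nat \<lceil>R\<rceil>"]
  proof eventually_elim
    fix n assume "nat \<lceil>R\<rceil> \<le> n"
    then have "(\<lambda>x. if norm x \<le> real n then f x else 0) = f"
      using supp by (fastforce simp: nat_le_iff ceiling_le_iff)
    then show "sqint (\<lambda>\<xi>. fourier_integral (\<lambda>x. if norm x \<le> real n then f x else 0) \<xi> - fourier_integral f \<xi>) = 0"
      by (simp add: sqint_def)
  qed
  ultimately show "has_fourier_L2 f (fourier_integral f)"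
    unfolding has_fourier_L2_def L2_norm_tendsto_0_iff by (auto intro: tendsto_eventually)
qed


section \<open>Isometries and radial functions\<close>

lemma nn_integral_lborel_shift:
  fixes c :: "'a::euclidean_space"
  assumes [measurable]: "h \<in> borel_measurable borel"
  shows "(\<integral>\<^sup>+x. h (c + x) \<partial>lborel) = (\<integral>\<^sup>+x. h x \<partial>lborel)"
proof -
  have "(\<integral>\<^sup>+x. h x \<partial>distr lborel borel ((+) c)) = (\<integral>\<^sup>+x. h (c + x) \<partial>lborel)"
    by (rule nn_integral_distr) auto
  then show ?thesis by (simp add: lborel_distr_plus)
qed

lemma measurable_orthogonal_transformation:
  fixes T :: "'a::euclidean_space \<Rightarrow> 'a"
  assumes "orthogonal_transformation T"
  shows "T \<in> borel_measurable borel"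
  by (intro borel_measurable_continuous_onI linear_continuous_on linear_conv_bounded_linear[THEN iffD1]
      orthogonal_transformation_linear assms)

text \<open>Both integrals are compared with the double integral of \<open>h (T x) * b (y - T x)\<close>,
  \<open>b\<close> the indicator of the unit ball: translation invariance in \<open>y\<close> and the invariance of the ball
  under \<open>T\<close> evaluate it in two ways.\<close>

lemma nn_integral_orthogonal_transformation:
  fixes T :: "'a::euclidean_space \<Rightarrow> 'a"
  assumes T: "orthogonal_transformation T" and [measurable]: "h \<in> borel_measurable borel"
  shows "(\<integral>\<^sup>+x. h (T x) \<partial>lborel) = (\<integral>\<^sup>+x. h x \<partial>lborel)"
proof -
  note [measurable] = measurable_orthogonal_transformation[OF T]
  define b :: "'a \<Rightarrow> ennreal" where "b = indicator (ball 0 1)"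
  have [measurable]: "ball (0::'a) 1 \<in> sets borel" by simp
  have [measurable]: "b \<in> borel_measurable borel" unfolding b_def by measurable
  have b_norm: "b x = b y" if "norm x = norm y" for x y using that by (simp add: b_def indicator_def)
  define \<beta> where "\<beta> = (\<integral>\<^sup>+x. b x \<partial>lborel)"
  have \<beta>: "\<beta> = emeasure lborel (ball (0::'a) 1)" by (simp add: \<beta>_def b_def)
  \<comment> \<open>The mass of the ball is cancelled at the end, which requires it to be nonzero
    and finite.\<close>
  have "unit_ball_vol (real DIM('a)) \<noteq> 0"
    by (rule less_imp_neq[OF unit_ball_vol_pos, symmetric]) simp
  then have nz: "\<beta> \<noteq> 0" "\<beta> \<noteq> \<infinity>"
    by (simp_all add: \<beta> emeasure_ball)
  have Tadd: "T (x + y) = T x + T y" for x y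
    using T by (simp add: orthogonal_transformation_linear linear_add)
  have b_shift: "(\<integral>\<^sup>+y. b (- T x + y) \<partial>lborel) = \<beta>" for x
    unfolding \<beta>_def by (rule nn_integral_lborel_shift) measurable
  have "(\<integral>\<^sup>+x. h (T x) \<partial>lborel) * \<beta> = (\<integral>\<^sup>+x. h (T x) * (\<integral>\<^sup>+y. b (- T x + y) \<partial>lborel) \<partial>lborel)"
    unfolding b_shift by (simp add: nn_integral_multc)
  also have "\<dots> = (\<integral>\<^sup>+x. \<integral>\<^sup>+y. h (T x) * b (- T x + y) \<partial>lborel \<partial>lborel)"
    by (simp add: nn_integral_cmult)
  also have "\<dots> = (\<integral>\<^sup>+y. \<integral>\<^sup>+x. h (T x) * b (- T x + y) \<partial>lborel \<partial>lborel)"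
    by (rule lborel_pair.Fubini') simp
  also have "\<dots> = (\<integral>\<^sup>+y. \<integral>\<^sup>+x. h (y + T x) * b x \<partial>lborel \<partial>lborel)"
  proof (rule nn_integral_cong)
    fix y :: 'a
    \<comment> \<open>Translating x by the preimage of y leaves \<open>b\<close> at the point - T x,
      which has the norm of x.\<close>
    obtain z where z: "y = T z" using orthogonal_transformation_surj[OF T] by blast
    have "(\<integral>\<^sup>+x. h (T x) * b (- T x + y) \<partial>lborel) = (\<integral>\<^sup>+x. h (T (z + x)) * b (- T (z + x) + y) \<partial>lborel)"
      by (rule nn_integral_lborel_shift[symmetric]) measurable
    also have "\<dots> = (\<integral>\<^sup>+x. h (y + T x) * b x \<partial>lborel)"
      by (intro nn_integral_cong arg_cong2[where f=times] b_norm)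
        (auto simp: Tadd z orthogonal_transformation_norm[OF T])
    finally show "(\<integral>\<^sup>+x. h (T x) * b (- T x + y) \<partial>lborel) = (\<integral>\<^sup>+x. h (y + T x) * b x \<partial>lborel)" .
  qed
  also have "\<dots> = (\<integral>\<^sup>+x. \<integral>\<^sup>+y. h (T x + y) * b x \<partial>lborel \<partial>lborel)"
    by (subst lborel_pair.Fubini') (auto simp: add.commute)
  also have "\<dots> = (\<integral>\<^sup>+x. h x \<partial>lborel) * \<beta>"
    by (simp add: nn_integral_multc nn_integral_cmult nn_integral_lborel_shift \<beta>_def)
  finally show ?thesis
    using nz by (metis ennreal_mult_divide_eq infinity_ennreal_def)
qed

lemma lborel_distr_orthogonal_transformation:
  fixes T :: "'a::euclidean_space \<Rightarrow> 'a"
  assumes T: "orthogonal_transformation T"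
  shows "distr lborel borel T = lborel"
proof (rule measure_eqI)
  note [measurable] = measurable_orthogonal_transformation[OF T]
  fix A assume "A \<in> sets (distr lborel borel T)"
  then have [measurable]: "A \<in> sets borel" by simp
  have "emeasure (distr lborel borel T) A = (\<integral>\<^sup>+x. indicator A x \<partial>distr lborel borel T)"
    by simp
  also have "\<dots> = (\<integral>\<^sup>+x. indicator A (T x) \<partial>lborel)"
    by (rule nn_integral_distr) auto
  also have "\<dots> = (\<integral>\<^sup>+x. indicator A x \<partial>lborel)"
    by (rule nn_integral_orthogonal_transformation[OF T]) auto
  finally show "emeasure (distr lborel borel T) A = emeasure lborel A" by simp
qed simp

lemma lborel_integral_orthogonal_transformation:
  fixes T :: "'a::euclidean_space \<Rightarrow> 'a" and h :: "'a \<Rightarrow> complex"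
  assumes T: "orthogonal_transformation T" and [measurable]: "h \<in> borel_measurable borel"
  shows "(LINT x|lborel. h (T x)) = (LINT x|lborel. h x)"
proof -
  note [measurable] = measurable_orthogonal_transformation[OF T]
  have "(LINT x|distr lborel borel T. h x) = (LINT x|lborel. h (T x))"
    by (rule integral_distr) auto
  then show ?thesis by (simp add: lborel_distr_orthogonal_transformation[OF T])
qed

lemma AE_lborel_uminus:
  fixes P :: "'a::euclidean_space \<Rightarrow> bool"
  assumes "AE x in lborel. P x"
  shows "AE x in lborel. P (- x)"
proof -
  have T: "orthogonal_transformation (uminus :: 'a \<Rightarrow> 'a)"
    by (simp add: orthogonal_transformation_neg)
  have "AE x in distr lborel borel (uminus :: 'a \<Rightarrow> 'a). P x"
    using assms by (subst lborel_distr_orthogonal_transformation[OF T])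
  then show ?thesis
    by (rule AE_distrD[of "uminus :: 'a \<Rightarrow> 'a" lborel borel, rotated]) simp
qed

text \<open>The reflection in the hyperplane orthogonal to \<open>x - y\<close>.\<close>

lemma orthogonal_transformation_exists:
  fixes x y :: "'a::euclidean_space"
  assumes xy: "norm x = norm y"
  shows "\<exists>T. orthogonal_transformation T \<and> T x = y"
proof (cases "x = y")
  case True
  then show ?thesis using orthogonal_transformation_id by blast
next
  case False
  define u where "u = x - y"
  have uu: "u \<bullet> u \<noteq> 0" using False by (simp add: u_def)
  define T where "T z = z - (2 * (z \<bullet> u) / (u \<bullet> u)) *\<^sub>R u" for z
  have "linear T"
    unfolding T_def by (rule linearI) (simp_all add: inner_add_left distrib_left add_divide_distrib scaleR_add_left scaleR_diff_right)
  moreover have "T v \<bullet> T w = v \<bullet> w" for v w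
  proof -
    have "T v \<bullet> T w = v \<bullet> w - 2 * (w \<bullet> u) / (u \<bullet> u) * (v \<bullet> u) - 2 * (v \<bullet> u) / (u \<bullet> u) * (u \<bullet> w)
        + 2 * (v \<bullet> u) / (u \<bullet> u) * (2 * (w \<bullet> u) / (u \<bullet> u) * (u \<bullet> u))"
      unfolding T_def by (simp only: inner_diff_left inner_diff_right inner_scaleR_left inner_scaleR_right) argo
    also have "u \<bullet> w = w \<bullet> u" by (rule inner_commute)
    also have "2 * (w \<bullet> u) / (u \<bullet> u) * (u \<bullet> u) = 2 * (w \<bullet> u)" using uu by simp
    also have "v \<bullet> w - 2 * (w \<bullet> u) / (u \<bullet> u) * (v \<bullet> u) - 2 * (v \<bullet> u) / (u \<bullet> u) * (w \<bullet> u)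
        + 2 * (v \<bullet> u) / (u \<bullet> u) * (2 * (w \<bullet> u)) = v \<bullet> w"
      by (simp add: mult_ac)
    finally show ?thesis .
  qed
  moreover have "T x = y"
  proof -
    have "x \<bullet> x = y \<bullet> y" using xy by (simp add: norm_eq_sqrt_inner)
    then have "2 * (x \<bullet> u) = u \<bullet> u"
      by (simp add: u_def inner_diff_left inner_diff_right inner_commute)
    then show ?thesis using uu by (simp add: T_def) (simp add: u_def)
  qed
  ultimately show ?thesis unfolding orthogonal_transformation_def by blast
qed

lemma fourier_integral_radial:
  fixes f :: "'a::euclidean_space \<Rightarrow> complex"
  assumes [measurable]: "f \<in> borel_measurable borel" and f: "\<And>x y. norm x = norm y \<Longrightarrow> f x = f y"
    and \<xi>: "norm \<xi> = norm \<eta>"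
  shows "fourier_integral f \<xi> = fourier_integral f \<eta>"
proof -
  obtain T where T: "orthogonal_transformation T" "T \<xi> = \<eta>"
    using orthogonal_transformation_exists[OF \<xi>] by blast
  have "(LINT x|lborel. cis (- (x \<bullet> \<eta>)) * f x) = (LINT x|lborel. cis (- (T x \<bullet> \<eta>)) * f (T x))"
    by (rule lborel_integral_orthogonal_transformation[OF T(1), symmetric]) measurable
  also have "\<dots> = (LINT x|lborel. cis (- (x \<bullet> \<xi>)) * f x)"
    using T f[OF orthogonal_transformation_norm[OF T(1)]] unfolding orthogonal_transformation_def by auto
  finally show ?thesis by (simp add: fourier_integral_def)
qed

lemma fourier_integral_cong_AE:
  assumes [measurable]: "f \<in> borel_measurable borel" "g \<in> borel_measurable borel"
    and "AE x in lborel. f x = g x"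
  shows "fourier_integral f = fourier_integral g"
proof
  fix \<xi>
  have "(LINT x|lborel. cis (- (x \<bullet> \<xi>)) * f x) = (LINT x|lborel. cis (- (x \<bullet> \<xi>)) * g x)"
    by (rule integral_cong_AE) (use assms(3) in auto)
  then show "fourier_integral f \<xi> = fourier_integral g \<xi>" by (simp add: fourier_integral_def)
qed

text \<open>Equality at every point, not just almost everywhere: the integrals of the truncations
  agree everywhere, so \<open>SOME\<close> is applied to one and the same predicate.\<close>

lemma fourier_L2_cong_AE:
  assumes [measurable]: "f \<in> borel_measurable borel" "g \<in> borel_measurable borel"
    and fg: "AE x in lborel. f x = g x"
  shows "fourier_L2 f = fourier_L2 g"
proof -
  have "fourier_integral (\<lambda>x. if norm x \<le> real n then f x else 0)
      = fourier_integral (\<lambda>x. if norm x \<le> real n then g x else 0)" for n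
    by (rule fourier_integral_cong_AE) (use fg in auto)
  then show ?thesis by (simp add: fourier_L2_def has_fourier_L2_def)
qed

text \<open>f is replaced by an exactly radial representative. Its truncated transforms are then
  exactly radial by rotation invariance, and so is their pointwise limit; the profile is the
  restriction of that limit to a ray.\<close>

lemma fourier_L2_radial:
  fixes f :: "'a::euclidean_space \<Rightarrow> complex"
  assumes f: "in_L2 f" and rad: "radial f"
  shows "\<exists>G. G \<in> borel_measurable borel \<and> (AE \<xi> in lborel. fourier_L2 f \<xi> = G (norm \<xi>))"
proof -
  have [measurable]: "f \<in> borel_measurable borel" using f by (simp add: in_L2_iff)
  obtain F where [measurable]: "F \<in> borel_measurable borel" and F: "AE x in lborel. f x = F (norm x)"
    using rad by (auto simp: radial_def)
  define f' where "f' x = F (norm x)" for x :: 'a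
  have [measurable]: "f' \<in> borel_measurable borel" unfolding f'_def by measurable
  have ff': "AE x in lborel. f x = f' x" using F by (simp add: f'_def)
  have f': "in_L2 f'"
    using f sqint_cong_AE[OF ff'] by (simp add: in_L2_iff)
  obtain \<nu> where \<nu>: "has_fourier_L2 f' (\<lambda>\<xi>. lim (\<lambda>k. fourier_integral (ball_truncation f' (\<nu> k)) \<xi>))"
    using has_fourier_L2_exists[OF f'] by blast
  define g where "g \<xi> = lim (\<lambda>k. fourier_integral (ball_truncation f' (\<nu> k)) \<xi>)" for \<xi>
  have gm[measurable]: "g \<in> borel_measurable borel"
    using \<nu> unfolding g_def has_fourier_L2_def in_L2_def by blast
  have "AE \<xi> in lborel. fourier_L2 f' \<xi> = g \<xi>"
    unfolding g_def by (rule fourier_L2_AE_eqI[OF f' \<nu>])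
  then have fg: "AE \<xi> in lborel. fourier_L2 f \<xi> = g \<xi>"
    using fourier_L2_cong_AE[OF _ _ ff'] by simp
  obtain e :: 'a where e: "norm e = 1" using nonempty_Basis norm_Basis by blast
  \<comment> \<open>The two sequences under \<open>lim\<close> are identical, so this holds whether
    or not they converge.\<close>
  have "g \<xi> = g (norm \<xi> *\<^sub>R e)" for \<xi>
    unfolding g_def
    by (intro arg_cong[where f=lim] ext fourier_integral_radial)
      (auto simp: ball_truncation_def f'_def e)
  with fg show ?thesis
    by (intro exI[of _ "\<lambda>r. g (r *\<^sub>R e)"] conjI) (auto intro: measurable_compose[OF _ gm])
qed

text \<open>The complement of the support is a union of possibly uncountably many open sets on which
  g vanishes almost everywhere; by Lindelof's theorem countably many of them already cover
  it.\<close>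

lemma AE_eq_0_outside_ess_support:
  fixes g :: "'a::euclidean_space \<Rightarrow> complex"
  shows "AE \<xi> in lborel. \<xi> \<notin> ess_support g \<longrightarrow> g \<xi> = 0"
proof -
  define \<U> where "\<U> = {U. open U \<and> (AE \<eta> in lborel. \<eta> \<in> U \<longrightarrow> g \<eta> = 0)}"
  obtain \<V> where \<V>: "\<V> \<subseteq> \<U>" "countable \<V>" "\<Union>\<V> = \<Union>\<U>"
    using Lindelof[of \<U>] unfolding \<U>_def by blast
  have "AE \<eta> in lborel. \<forall>U\<in>\<V>. \<eta> \<in> U \<longrightarrow> g \<eta> = 0"
    by (subst AE_ball_countable[OF \<V>(2)]) (use \<V>(1) in \<open>auto simp: \<U>_def\<close>)
  then show ?thesis
  proof eventually_elim
    fix \<xi> assume "\<forall>U\<in>\<V>. \<xi> \<in> U \<longrightarrow> g \<xi> = 0"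
    moreover have "\<xi> \<notin> ess_support g \<Longrightarrow> \<xi> \<in> \<Union>\<U>"
      by (auto simp: ess_support_def \<U>_def)
    ultimately show "\<xi> \<notin> ess_support g \<longrightarrow> g \<xi> = 0" using \<V>(3) by blast
  qed
qed

lemma fourier_L2_radial_support:
  fixes f :: "'a::euclidean_space \<Rightarrow> complex"
  assumes f: "in_L2 f" "radial f" and [measurable]: "I \<in> sets borel"
    and supp: "ess_support (fourier_L2 f) \<subseteq> {\<xi>. norm \<xi> \<in> I}"
  shows "\<exists>G. G \<in> borel_measurable borel \<and> (\<forall>r. r \<notin> I \<longrightarrow> G r = 0) \<and> (AE \<xi> in lborel. fourier_L2 f \<xi> = G (norm \<xi>))"
proof -
  obtain G where [measurable]: "G \<in> borel_measurable borel" and G: "AE \<xi> in lborel. fourier_L2 f \<xi> = G (norm \<xi>)"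
    using fourier_L2_radial[OF f] by blast
  have "AE \<xi> in lborel. fourier_L2 f \<xi> = (if norm \<xi> \<in> I then G (norm \<xi>) else 0)"
    using G AE_eq_0_outside_ess_support[of "fourier_L2 f"] by eventually_elim (use supp in auto)
  then show ?thesis
    by (intro exI[of _ "\<lambda>r. if r \<in> I then G r else 0"]) auto
qed

text \<open>The multiplied transform has bounded support, so its abstract transform is given by an
  honest integral; the argument - x is the reflection in the inverse transform.\<close>

lemma half_wave_AE_eq:
  fixes f :: "'a::euclidean_space \<Rightarrow> complex"
  assumes f: "in_L2 f" and [measurable]: "G \<in> borel_measurable borel"
    and G: "AE \<xi> in lborel. fourier_L2 f \<xi> = G (norm \<xi>)" and supp: "\<And>r. R < r \<Longrightarrow> G r = 0"
  shows "AE x in lborel. half_wave t f x = fourier_integral (\<lambda>\<xi>. cis (t * norm \<xi>) * G (norm \<xi>)) (- x)"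
proof -
  define h where "h \<xi> = cis (t * norm \<xi>) * G (norm \<xi>)" for \<xi> :: 'a
  have [measurable]: "h \<in> borel_measurable borel" unfolding h_def by measurable
  have [measurable]: "fourier_L2 f \<in> borel_measurable borel"
    using has_fourier_L2_fourier_L2[OF f] by (simp add: has_fourier_L2_def in_L2_def)
  have h: "AE \<xi> in lborel. cis (t * norm \<xi>) * fourier_L2 f \<xi> = h \<xi>"
    using G by eventually_elim (simp add: h_def)
  have "sqint h = sqint (fourier_L2 f)"
    by (subst sqint_cong_AE[OF h, symmetric]) (simp add: sqint_def norm_mult)
  then have hL2: "in_L2 h"
    using sqint_fourier_L2_le[OF f] f by (auto simp: in_L2_iff)
  have "AE x in lborel. fourier_L2 h x = fourier_integral h x"
    by (rule fourier_L2_bounded_support[OF hL2, where R=R]) (simp add: h_def supp)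
  then have "AE x in lborel. fourier_L2 h (- x) = fourier_integral h (- x)"
    by (rule AE_lborel_uminus)
  moreover have "half_wave t f x = fourier_L2 h (- x)" for x
    unfolding half_wave_def fourier_multiplier_def inverse_fourier_L2_def
    by (subst fourier_L2_cong_AE[OF _ _ h]) auto
  ultimately show ?thesis unfolding h_def by simp
qed


section \<open>The Fourier transform of the sphere\<close>

text \<open>A remainder estimate that can be integrated as it stands. With it, differentiation under
  the integral sign needs no limit theorem.\<close>

lemma DERIV_quadratic_remainder:
  fixes F :: "real \<Rightarrow> real"
  assumes "\<And>h. \<bar>F (s + h) - F s - h * D\<bar> \<le> C * h\<^sup>2"
  shows "(F has_real_derivative D) (at s)"
  unfolding DERIV_def
proof (rule LIM_I)
  fix r :: real assume "0 < r"
  have C: "0 \<le> C" using assms[of 1] by (simp add: order_trans[OF abs_ge_zero])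
  show "\<exists>sa>0. \<forall>h. h \<noteq> 0 \<and> norm (h - 0) < sa \<longrightarrow> norm ((F (s + h) - F s) / h - D) < r"
  proof (intro exI[of _ "r / (C + 1)"] conjI allI impI)
    show "0 < r / (C + 1)" using C \<open>0 < r\<close> by simp
    fix h :: real assume h: "h \<noteq> 0 \<and> norm (h - 0) < r / (C + 1)"
    have "\<bar>(F (s + h) - F s) / h - D\<bar> = \<bar>F (s + h) - F s - h * D\<bar> / \<bar>h\<bar>"
      using h by (simp add: abs_divide[symmetric] diff_divide_distrib)
    also have "\<dots> \<le> C * h\<^sup>2 / \<bar>h\<bar>" by (intro divide_right_mono assms) simp
    also have "\<dots> = C * \<bar>h\<bar>" using h by (simp add: power2_eq_square abs_if)
    also have "\<dots> \<le> (C + 1) * \<bar>h\<bar>" by (intro mult_right_mono) auto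
    also have "\<dots> < r" using h C by (simp add: field_simps)
    finally show "norm ((F (s + h) - F s) / h - D) < r" by simp
  qed
qed

lemma sin_quadratic_remainder: "\<bar>sin (y + h) - sin y - h * cos y\<bar> \<le> (h::real)\<^sup>2"
proof -
  have c: "\<bar>cos u - cos v\<bar> \<le> \<bar>u - v\<bar>" for u v :: real
  proof -
    have "norm (cos u - cos v) \<le> 1 * norm (u - v)"
      by (rule field_differentiable_bound[of UNIV cos "\<lambda>x. - sin x"]) (auto intro!: derivative_eq_intros)
    then show ?thesis by simp
  qed
  define g where "g t = sin (y + t) - t * cos y" for t
  have "norm (g h - g 0) \<le> \<bar>h\<bar> * norm (h - 0)"
  proof (rule field_differentiable_bound[of "{- \<bar>h\<bar>..\<bar>h\<bar>}" g "\<lambda>t. cos (y + t) - cos y"])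
    show "(g has_field_derivative cos (y + t) - cos y) (at t within {- \<bar>h\<bar>..\<bar>h\<bar>})" for t
      unfolding g_def by (auto intro!: derivative_eq_intros)
    show "norm (cos (y + t) - cos y) \<le> \<bar>h\<bar>" if "t \<in> {- \<bar>h\<bar>..\<bar>h\<bar>}" for t
      using c[of "y + t" y] that by auto
  qed auto
  then show ?thesis by (simp add: g_def power2_eq_square algebra_simps)
qed

text \<open>The bound on \<open>q\<close> is asked only where \<open>p\<close> is nonzero, so that
  the indicator of a ball can be part of \<open>p\<close>. The quadratic remainder of the sine is
  then uniform on that set.\<close>

lemma DERIV_sin_integral:
  fixes p q r :: "'b \<Rightarrow> real"
  assumes p: "integrable M p" and [measurable]: "q \<in> borel_measurable M" "r \<in> borel_measurable M"
    and K: "\<And>x. p x \<noteq> 0 \<Longrightarrow> \<bar>q x\<bar> \<le> K"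
  shows "((\<lambda>s. LINT x|M. p x * sin (s * q x + r x)) has_real_derivative
     (LINT x|M. p x * q x * cos (s * q x + r x))) (at s)"
proof (rule DERIV_quadratic_remainder)
  fix h
  have [measurable]: "p \<in> borel_measurable M" using p by auto
  have pq: "\<bar>p x * q x\<bar> \<le> \<bar>K * p x\<bar>" for x
    using K[of x] by (cases "p x = 0") (auto simp: abs_mult mult.commute intro!: mult_right_mono)
  have i1: "integrable M (\<lambda>x. p x * sin (t * q x + r x))" for t
    by (rule Bochner_Integration.integrable_bound[OF p]) (auto simp: abs_mult mult_left_le)
  have Kp: "integrable M (\<lambda>x. K * p x)" using p by simp
  have "\<bar>p x * q x * cos y\<bar> \<le> \<bar>K * p x\<bar>" for x y
    using pq[of x] mult_left_le[of "\<bar>cos y\<bar>" "\<bar>p x * q x\<bar>"] by (simp add: abs_mult)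
  then have i2: "integrable M (\<lambda>x. p x * q x * cos (t * q x + r x))" for t
    by (intro Bochner_Integration.integrable_bound[OF Kp]) auto
  have lin: "(LINT x|M. p x * sin ((s + h) * q x + r x)) - (LINT x|M. p x * sin (s * q x + r x))
       - h * (LINT x|M. p x * q x * cos (s * q x + r x))
     = (LINT x|M. p x * sin ((s + h) * q x + r x) - p x * sin (s * q x + r x) - h * (p x * q x * cos (s * q x + r x)))"
    by (simp add: i1 i2)
  have "\<bar>LINT x|M. p x * sin ((s + h) * q x + r x) - p x * sin (s * q x + r x) - h * (p x * q x * cos (s * q x + r x))\<bar>
      \<le> (LINT x|M. K\<^sup>2 * h\<^sup>2 * \<bar>p x\<bar>)"
  proof (rule integral_abs_bound[THEN order_trans], rule integral_mono)
    show "integrable M (\<lambda>x. \<bar>p x * sin ((s + h) * q x + r x) - p x * sin (s * q x + r x) - h * (p x * q x * cos (s * q x + r x))\<bar>)"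
      using i1 i2 by simp
    show "integrable M (\<lambda>x. K\<^sup>2 * h\<^sup>2 * \<bar>p x\<bar>)" using p by simp
    fix x
    show "\<bar>p x * sin ((s + h) * q x + r x) - p x * sin (s * q x + r x) - h * (p x * q x * cos (s * q x + r x))\<bar>
       \<le> K\<^sup>2 * h\<^sup>2 * \<bar>p x\<bar>"
    proof (cases "p x = 0")
      case False
      have fac: "p x * sin ((s + h) * q x + r x) - p x * sin (s * q x + r x) - h * (p x * q x * cos (s * q x + r x))
        = p x * (sin ((s * q x + r x) + h * q x) - sin (s * q x + r x) - (h * q x) * cos (s * q x + r x))"
        by (simp add: algebra_simps)
      have "\<bar>p x * (sin ((s * q x + r x) + h * q x) - sin (s * q x + r x) - (h * q x) * cos (s * q x + r x))\<bar>
        \<le> \<bar>p x\<bar> * (h * q x)\<^sup>2"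
        unfolding abs_mult by (intro mult_left_mono sin_quadratic_remainder) auto
      also have "\<dots> \<le> \<bar>p x\<bar> * (h\<^sup>2 * K\<^sup>2)"
        unfolding power_mult_distrib using K[OF False]
        by (intro mult_left_mono) (auto intro: power_mono[of "\<bar>q x\<bar>" K 2, simplified])
      finally show ?thesis unfolding fac by (simp add: mult_ac)
    qed simp
  qed
  also have "\<dots> = (K\<^sup>2 * (LINT x|M. \<bar>p x\<bar>)) * h\<^sup>2" by simp
  finally show "\<bar>(LINT x|M. p x * sin ((s + h) * q x + r x)) - (LINT x|M. p x * sin (s * q x + r x))
       - h * (LINT x|M. p x * q x * cos (s * q x + r x))\<bar> \<le> (K\<^sup>2 * (LINT x|M. \<bar>p x\<bar>)) * h\<^sup>2"
    unfolding lin .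
qed

text \<open>The sine version with the phase moved by a quarter period.\<close>

lemma DERIV_cos_integral:
  fixes p q r :: "'b \<Rightarrow> real"
  assumes p: "integrable M p" and [measurable]: "q \<in> borel_measurable M" "r \<in> borel_measurable M"
    and K: "\<And>x. p x \<noteq> 0 \<Longrightarrow> \<bar>q x\<bar> \<le> K"
  shows "((\<lambda>s. LINT x|M. p x * cos (s * q x + r x)) has_real_derivative
     - (LINT x|M. p x * q x * sin (s * q x + r x))) (at s)"
proof -
  have 1: "cos y = sin (y + pi / 2)" and 2: "cos (y + pi / 2) = - sin y" for y :: real
    by (simp_all add: sin_add cos_add)
  have "((\<lambda>s. LINT x|M. p x * sin (s * q x + (r x + pi / 2))) has_real_derivative
     (LINT x|M. p x * q x * cos (s * q x + (r x + pi / 2)))) (at s)"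
    by (rule DERIV_sin_integral) (use assms in auto)
  then show ?thesis
    by (simp only: add.assoc[symmetric] 1[symmetric] 2 mult_minus_right Bochner_Integration.integral_minus)
qed

definition ball_integral :: "('a::euclidean_space \<Rightarrow> real) \<Rightarrow> real" where
  "ball_integral g = (LINT \<xi>|lborel. indicator (cball 0 1) \<xi> * g \<xi>)"

lemma measurable_indicator_cball [measurable]:
  "(indicator (cball (0::'a::euclidean_space) R) :: 'a \<Rightarrow> real) \<in> borel_measurable borel"
  by (intro borel_measurable_indicator) simp

lemma integrable_on_cball:
  fixes g :: "'a::euclidean_space \<Rightarrow> real"
  assumes "continuous_on UNIV g"
  shows "integrable lborel (\<lambda>\<xi>. indicator (cball 0 R) \<xi> * g \<xi>)"
  using borel_integrable_compact[of "cball 0 R" g] assms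
  by (simp add: continuous_on_subset)

lemma DERIV_ball_integral_cos:
  fixes p q r :: "'a::euclidean_space \<Rightarrow> real"
  assumes c: "continuous_on UNIV p" "continuous_on UNIV q" "continuous_on UNIV r"
  shows "((\<lambda>s. ball_integral (\<lambda>\<xi>. p \<xi> * cos (s * q \<xi> + r \<xi>))) has_real_derivative
     - ball_integral (\<lambda>\<xi>. p \<xi> * q \<xi> * sin (s * q \<xi> + r \<xi>))) (at s)"
    and "((\<lambda>s. ball_integral (\<lambda>\<xi>. p \<xi> * sin (s * q \<xi> + r \<xi>))) has_real_derivative
     ball_integral (\<lambda>\<xi>. p \<xi> * q \<xi> * cos (s * q \<xi> + r \<xi>))) (at s)"
proof -
  have "compact (q ` cball 0 1)"
    by (intro compact_continuous_image) (use c in \<open>auto intro: continuous_on_subset\<close>)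
  then obtain K where K: "\<And>\<xi>. \<xi> \<in> cball 0 1 \<Longrightarrow> \<bar>q \<xi>\<bar> \<le> K"
    using compact_imp_bounded bounded_iff by (metis image_eqI real_norm_def)
  have [measurable]: "q \<in> borel_measurable borel" "r \<in> borel_measurable borel"
    using c by (auto intro: borel_measurable_continuous_onI)
  have i: "integrable lborel (\<lambda>\<xi>. indicator (cball 0 1) \<xi> * p \<xi>)"
    by (rule integrable_on_cball[OF c(1)])
  have 1: "((\<lambda>s. LINT \<xi>|lborel. (indicator (cball 0 1) \<xi> * p \<xi>) * cos (s * q \<xi> + r \<xi>)) has_real_derivative
     - (LINT \<xi>|lborel. (indicator (cball 0 1) \<xi> * p \<xi>) * q \<xi> * sin (s * q \<xi> + r \<xi>))) (at s)"
    by (rule DERIV_cos_integral[OF i, where K=K]) (use K in \<open>auto simp: indicator_def split: if_splits\<close>)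
  have 2: "((\<lambda>s. LINT \<xi>|lborel. (indicator (cball 0 1) \<xi> * p \<xi>) * sin (s * q \<xi> + r \<xi>)) has_real_derivative
     (LINT \<xi>|lborel. (indicator (cball 0 1) \<xi> * p \<xi>) * q \<xi> * cos (s * q \<xi> + r \<xi>))) (at s)"
    by (rule DERIV_sin_integral[OF i, where K=K]) (use K in \<open>auto simp: indicator_def split: if_splits\<close>)
  show "((\<lambda>s. ball_integral (\<lambda>\<xi>. p \<xi> * cos (s * q \<xi> + r \<xi>))) has_real_derivative
     - ball_integral (\<lambda>\<xi>. p \<xi> * q \<xi> * sin (s * q \<xi> + r \<xi>))) (at s)"
    using 1 by (simp add: ball_integral_def mult.assoc)
  show "((\<lambda>s. ball_integral (\<lambda>\<xi>. p \<xi> * sin (s * q \<xi> + r \<xi>))) has_real_derivative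
     ball_integral (\<lambda>\<xi>. p \<xi> * q \<xi> * cos (s * q \<xi> + r \<xi>))) (at s)"
    using 2 by (simp add: ball_integral_def mult.assoc)
qed

lemma ball_integral_cos_inner:
  fixes x y :: "'a::euclidean_space"
  assumes xy: "norm x = norm y"
  shows "ball_integral (\<lambda>\<xi>. cos (\<xi> \<bullet> x)) = ball_integral (\<lambda>\<xi>. cos (\<xi> \<bullet> y))"
proof -
  obtain T where T: "orthogonal_transformation T" "T x = y"
    using orthogonal_transformation_exists[OF xy] by blast
  define h where "h \<xi> = complex_of_real (indicator (cball 0 1) \<xi> * cos (\<xi> \<bullet> y))" for \<xi>
  have [measurable]: "h \<in> borel_measurable borel" unfolding h_def by measurable
  have "h (T \<xi>) = complex_of_real (indicator (cball 0 1) \<xi> * cos (\<xi> \<bullet> x))" for \<xi>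
    using T(1) unfolding h_def T(2)[symmetric]
    by (simp add: orthogonal_transformation_norm[OF T(1)] indicator_def orthogonal_transformation_def)
  then have "(LINT \<xi>|lborel. complex_of_real (indicator (cball 0 1) \<xi> * cos (\<xi> \<bullet> x))) = (LINT \<xi>|lborel. h \<xi>)"
    using lborel_integral_orthogonal_transformation[OF T(1), of h] by simp
  then show ?thesis
    unfolding h_def ball_integral_def integral_complex_of_real of_real_eq_iff .
qed

lemma cball_integral_scale:
  fixes g :: "'a::euclidean_space \<Rightarrow> real"
  assumes [measurable]: "g \<in> borel_measurable borel" and R: "0 < R"
  shows "(LINT \<xi>|lborel. indicator (cball 0 R) \<xi> * g \<xi>) = R ^ DIM('a) * ball_integral (\<lambda>\<xi>. g (R *\<^sub>R \<xi>))"
proof -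
  have "(LINT \<xi>|lborel. indicator (cball 0 R) \<xi> * g \<xi>)
     = (LINT \<xi>|density (distr lborel borel (\<lambda>x. 0 + R *\<^sub>R x)) (\<lambda>_. ennreal (\<bar>R\<bar> ^ DIM('a))). indicator (cball 0 R) \<xi> * g \<xi>)"
    using R by (subst lborel_affine[of R 0]) auto
  also have "\<dots> = R ^ DIM('a) * (LINT \<xi>|lborel. indicator (cball 0 R) (R *\<^sub>R \<xi>) * g (R *\<^sub>R \<xi>))"
    using R by (subst integral_density) (auto simp: integral_distr)
  also have "(\<lambda>\<xi>. indicator (cball 0 R) (R *\<^sub>R \<xi>) * g (R *\<^sub>R \<xi>)) = (\<lambda>\<xi>::'a. indicator (cball 0 1) \<xi> * g (R *\<^sub>R \<xi>))"
    using R by (auto simp: indicator_def mult_le_cancel_left1 mult_le_cancel_left2 fun_eq_iff)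
  finally show ?thesis by (simp add: ball_integral_def)
qed


section \<open>Trigonometric moments of the unit ball and the spherical kernel\<close>

definition ball_cos :: "'a::euclidean_space \<Rightarrow> nat \<Rightarrow> real \<Rightarrow> real" where
  "ball_cos e n s = ball_integral (\<lambda>\<xi>. (\<xi> \<bullet> e) ^ n * cos (s * (\<xi> \<bullet> e)))"

definition ball_sin :: "'a::euclidean_space \<Rightarrow> nat \<Rightarrow> real \<Rightarrow> real" where
  "ball_sin e n s = ball_integral (\<lambda>\<xi>. (\<xi> \<bullet> e) ^ n * sin (s * (\<xi> \<bullet> e)))"

lemma DERIV_ball_cos: "(ball_cos e n has_real_derivative - ball_sin e (Suc n) s) (at s)"
  using DERIV_ball_integral_cos(1)[of "\<lambda>\<xi>. (\<xi> \<bullet> e) ^ n" "\<lambda>\<xi>. \<xi> \<bullet> e" "\<lambda>_. 0" s]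
  unfolding ball_cos_def[abs_def] ball_sin_def by (simp add: continuous_intros mult.commute mult.left_commute)

lemma DERIV_ball_sin: "(ball_sin e n has_real_derivative ball_cos e (Suc n) s) (at s)"
  using DERIV_ball_integral_cos(2)[of "\<lambda>\<xi>. (\<xi> \<bullet> e) ^ n" "\<lambda>\<xi>. \<xi> \<bullet> e" "\<lambda>_. 0" s]
  unfolding ball_sin_def[abs_def] ball_cos_def by (simp add: continuous_intros mult.commute mult.left_commute)

text \<open>For a unit vector \<open>e\<close> and \<open>r > 0\<close>, \<open>r ^ (DIM('a) - 1) * radial_kernel e (r * s)\<close> is the integral of
  \<open>cos (s * (\<xi> \<bullet> e))\<close> over the sphere \<open>norm \<xi> = r\<close>, computed as the derivative in \<open>r\<close> of the integral
  over the ball.\<close>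

definition radial_kernel :: "'a::euclidean_space \<Rightarrow> real \<Rightarrow> real" where
  "radial_kernel e s = real DIM('a) * ball_cos e 0 s - s * ball_sin e 1 s"

definition radial_kernel' :: "'a::euclidean_space \<Rightarrow> real \<Rightarrow> real" where
  "radial_kernel' e s = - (real DIM('a) + 1) * ball_sin e 1 s - s * ball_cos e 2 s"

lemma DERIV_radial_kernel: "(radial_kernel e has_real_derivative radial_kernel' e s) (at s)"
  unfolding radial_kernel_def[abs_def] radial_kernel'_def
  by (rule derivative_eq_intros DERIV_ball_cos DERIV_ball_sin refl | simp add: numeral_2_eq_2 algebra_simps)+

lemma DERIV_radial_kernel':
  fixes e :: "'a::euclidean_space"
  shows "(radial_kernel' e has_real_derivative s * ball_sin e 3 s - (real DIM('a) + 2) * ball_cos e 2 s) (at s)"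
  unfolding radial_kernel'_def[abs_def]
  by (rule derivative_eq_intros DERIV_ball_cos DERIV_ball_sin refl | simp add: numeral_2_eq_2 numeral_3_eq_3 algebra_simps)+

lemma continuous_radial_kernel: "continuous_on S (radial_kernel e)" "continuous_on S (radial_kernel' e)"
  by (meson DERIV_isCont DERIV_radial_kernel DERIV_radial_kernel' continuous_at_imp_continuous_on)+

lemma measurable_radial_kernel [measurable]:
  "radial_kernel e \<in> borel_measurable borel" "radial_kernel' e \<in> borel_measurable borel"
  by (intro borel_measurable_continuous_onI continuous_radial_kernel)+

section \<open>Polar coordinates for plane waves\<close>

definition sphere_mass :: "'a::euclidean_space \<Rightarrow> real" where
  "sphere_mass e = real DIM('a) * ball_integral (\<lambda>_::'a. 1)"

lemma radial_kernel_0: "radial_kernel e 0 = sphere_mass e"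
  by (simp add: radial_kernel_def sphere_mass_def ball_cos_def)

lemma ball_integral_one: "ball_integral (\<lambda>_::'a::euclidean_space. 1) = unit_ball_vol (real DIM('a))"
  by (simp add: ball_integral_def content_cball)

lemma sphere_mass_pos: "0 < sphere_mass e"
  by (simp add: sphere_mass_def ball_integral_one)

text \<open>The summand 1 makes the integrand nonnegative, so that 1 + cos can serve as the density
  of a measure; a signed density would not allow the comparison of measures by their values on
  half-lines. Scaling and rotation invariance reduce the radius and the direction of x to one
  argument.\<close>

lemma cball_integral_one_plus_cos:
  fixes x e :: "'a::euclidean_space"
  assumes e: "norm e = 1" and R: "0 < R"
  shows "(LINT \<xi>|lborel. indicator (cball 0 R) \<xi> * (1 + cos (x \<bullet> \<xi>)))
      = R ^ DIM('a) * (ball_integral (\<lambda>_::'a. 1) + ball_cos e 0 (norm x * R))"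
proof -
  have i: "integrable lborel (\<lambda>\<xi>::'a. indicator (cball 0 1) \<xi> * cos (\<xi> \<bullet> (R *\<^sub>R x)))"
    by (rule integrable_on_cball) (intro continuous_intros)
  have i1: "integrable lborel (\<lambda>\<xi>::'a. indicator (cball 0 1) \<xi> * (1::real))"
    by (rule integrable_on_cball) (intro continuous_intros)
  have "(LINT \<xi>|lborel. indicator (cball 0 R) \<xi> * (1 + cos (x \<bullet> \<xi>)))
     = R ^ DIM('a) * ball_integral (\<lambda>\<xi>. 1 + cos (x \<bullet> (R *\<^sub>R \<xi>)))"
    by (rule cball_integral_scale[OF _ R]) measurable
  also have "ball_integral (\<lambda>\<xi>. 1 + cos (x \<bullet> (R *\<^sub>R \<xi>))) = ball_integral (\<lambda>\<xi>. 1 + cos (\<xi> \<bullet> (R *\<^sub>R x)))"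
    by (simp add: inner_commute)
  also have "\<dots> = ball_integral (\<lambda>_::'a. 1) + ball_integral (\<lambda>\<xi>. cos (\<xi> \<bullet> (R *\<^sub>R x)))"
    using i i1 by (simp add: ball_integral_def distrib_left)
  also have "ball_integral (\<lambda>\<xi>. cos (\<xi> \<bullet> (R *\<^sub>R x))) = ball_integral (\<lambda>\<xi>. cos (\<xi> \<bullet> ((norm x * R) *\<^sub>R e)))"
    by (rule ball_integral_cos_inner) (use e R in simp)
  also have "\<dots> = ball_cos e 0 (norm x * R)"
    by (simp add: ball_cos_def)
  finally show ?thesis .
qed

lemma DERIV_cball_integral_one_plus_cos:
  fixes e :: "'a::euclidean_space"
  shows "((\<lambda>R. R ^ DIM('a) * (ball_integral (\<lambda>_::'a. 1) + ball_cos e 0 (c * R))) has_real_derivative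
     R ^ (DIM('a) - 1) * (sphere_mass e + radial_kernel e (c * R))) (at R)"
proof -
  have "((\<lambda>R. ball_cos e 0 (c * R)) has_real_derivative - ball_sin e 1 (c * R) * c) (at R)"
    using DERIV_chain2[OF DERIV_ball_cos[of e 0 "c * R"] DERIV_cmult_Id[of c R]] by simp
  from DERIV_mult[OF DERIV_pow[of "DIM('a)" R] DERIV_add[OF DERIV_const[of "ball_integral (\<lambda>_::'a. 1)"] this]]
  have "((\<lambda>R. R ^ DIM('a) * (ball_integral (\<lambda>_::'a. 1) + ball_cos e 0 (c * R))) has_real_derivative
     (real DIM('a) * R ^ (DIM('a) - 1)) * (ball_integral (\<lambda>_::'a. 1) + ball_cos e 0 (c * R))
       + - ball_sin e 1 (c * R) * c * R ^ DIM('a)) (at R)"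
    by simp
  moreover have "R ^ DIM('a) = R ^ (DIM('a) - 1) * R"
    using DIM_positive[where 'a='a] by (metis power_minus_mult)
  ultimately show ?thesis
    by (rule_tac DERIV_cong) (auto simp: sphere_mass_def radial_kernel_def algebra_simps)
qed

text \<open>The mass of a ball with density 1 + cos grows with the radius, so its derivative is
  nonnegative. This replaces the bound of the kernel by the area of the sphere, which would be
  immediate with a surface measure.\<close>

lemma sphere_mass_plus_radial_kernel_nonneg:
  fixes e :: "'a::euclidean_space"
  assumes e: "norm e = 1" and s: "0 \<le> s"
  shows "0 \<le> sphere_mass e + radial_kernel e s"
proof (cases "s = 0")
  case True
  then show ?thesis using sphere_mass_pos[of e] by (simp add: radial_kernel_0)
next
  case False
  define M where "M R = R ^ DIM('a) * (ball_integral (\<lambda>_::'a. 1) + ball_cos e 0 (1 * R))" for R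
  have M: "M R = (LINT \<xi>|lborel. indicator (cball 0 R) \<xi> * (1 + cos (e \<bullet> \<xi>)))" if "0 < R" for R
    using cball_integral_one_plus_cos[OF e that, of e] e by (simp add: M_def)
  have i: "integrable lborel (\<lambda>\<xi>. indicator (cball 0 R) \<xi> * (1 + cos (e \<bullet> \<xi>)))" for R
    by (rule integrable_on_cball) (intro continuous_intros)
  have mono: "mono_on {0<..} M"
  proof (rule mono_onI)
    fix R S :: real assume RS: "R \<in> {0<..}" "S \<in> {0<..}" "R \<le> S"
    have "(LINT \<xi>|lborel. indicator (cball 0 R) \<xi> * (1 + cos (e \<bullet> \<xi>))) \<le> (LINT \<xi>|lborel. indicator (cball 0 S) \<xi> * (1 + cos (e \<bullet> \<xi>)))"
    proof (rule integral_mono[OF i i])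
      fix \<xi>
      have "0 \<le> 1 + cos (e \<bullet> \<xi>)" using cos_ge_minus_one[of "e \<bullet> \<xi>"] by linarith
      then show "indicator (cball 0 R) \<xi> * (1 + cos (e \<bullet> \<xi>)) \<le> indicator (cball 0 S) \<xi> * (1 + cos (e \<bullet> \<xi>))"
        using RS by (intro mult_right_mono) (auto simp: indicator_def)
    qed
    then show "M R \<le> M S" using M RS by simp
  qed
  have "(M has_real_derivative s ^ (DIM('a) - 1) * (sphere_mass e + radial_kernel e (1 * s))) (at s)"
    unfolding M_def[abs_def] by (rule DERIV_cball_integral_one_plus_cos)
  from mono_on_imp_deriv_nonneg[OF mono this]
  have "0 \<le> s ^ (DIM('a) - 1) * (sphere_mass e + radial_kernel e s)"
    using False s by (simp add: interior_open)
  moreover have "0 < s ^ (DIM('a) - 1)" using False s by simp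
  ultimately show ?thesis by (auto simp: zero_le_mult_iff)
qed

text \<open>Two measures on the line agree as soon as they agree on half-lines. For the image
  measure a half-line means a ball, whose mass has been computed; for the density the fundamental
  theorem of calculus gives the same number, since the density is the radial derivative of that
  mass.\<close>

lemma distr_norm_one_plus_cos:
  fixes x e :: "'a::euclidean_space"
  assumes e: "norm e = 1"
  shows "distr (density lborel (\<lambda>\<xi>. ennreal (1 + cos (x \<bullet> \<xi>)))) borel norm
    = density lborel (\<lambda>r. ennreal (indicator {0..} r * r ^ (DIM('a) - 1) * (sphere_mass e + radial_kernel e (norm x * r))))"
    (is "?M = ?N")
proof -
  define M where "M R = R ^ DIM('a) * (ball_integral (\<lambda>_::'a. 1) + ball_cos e 0 (norm x * R))" for R
  define w where "w r = r ^ (DIM('a) - 1) * (sphere_mass e + radial_kernel e (norm x * r))" for r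
  have [measurable]: "w \<in> borel_measurable borel" unfolding w_def by measurable
  have c0: "0 \<le> 1 + cos (x \<bullet> \<xi>)" for \<xi> using cos_ge_minus_one[of "x \<bullet> \<xi>"] by linarith
  have i: "integrable lborel (\<lambda>\<xi>. indicator (cball 0 R) \<xi> * (1 + cos (x \<bullet> \<xi>)))" for R
    by (rule integrable_on_cball) (intro continuous_intros)
  have L: "emeasure ?M {..R} = (if 0 < R then ennreal (M R) else 0)" for R
  proof -
    have "emeasure ?M {..R} = (\<integral>\<^sup>+\<xi>. ennreal (indicator (cball 0 R) \<xi> * (1 + cos (x \<bullet> \<xi>))) \<partial>lborel)"
    proof -
      have v: "norm -` {..R} = cball (0::'a) R" by auto
      have "emeasure ?M {..R} = emeasure (density lborel (\<lambda>\<xi>. ennreal (1 + cos (x \<bullet> \<xi>)))) (cball 0 R)"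
        by (simp add: emeasure_distr v)
      also have "\<dots> = (\<integral>\<^sup>+\<xi>. ennreal (1 + cos (x \<bullet> \<xi>)) * indicator (cball 0 R) \<xi> \<partial>lborel)"
        by (rule emeasure_density) auto
      also have "\<dots> = (\<integral>\<^sup>+\<xi>. ennreal (indicator (cball 0 R) \<xi> * (1 + cos (x \<bullet> \<xi>))) \<partial>lborel)"
        by (intro nn_integral_cong) (auto simp: indicator_def)
      finally show ?thesis .
    qed
    also have "\<dots> = ennreal (LINT \<xi>|lborel. indicator (cball 0 R) \<xi> * (1 + cos (x \<bullet> \<xi>)))"
      by (rule nn_integral_eq_integral[OF i]) (use c0 in auto)
    also have "\<dots> = (if 0 < R then ennreal (M R) else 0)"
    proof (cases "0 < R")
      case True
      then show ?thesis by (simp add: cball_integral_one_plus_cos[OF e] M_def)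
    next
      case False
      \<comment> \<open>For R \<le> 0 the closed ball is empty or a single point, hence
        null.\<close>
      have "(LINT \<xi>|lborel. indicator (cball 0 R) \<xi> * (1 + cos (x \<bullet> \<xi>))) = (LINT \<xi>|(lborel :: 'a measure). (0::real))"
      proof (rule integral_cong_AE)
        have "AE \<xi> in lborel. \<xi> \<noteq> (0::'a)" by (rule AE_lborel_singleton)
        then show "AE \<xi> in lborel. indicator (cball 0 R) \<xi> * (1 + cos (x \<bullet> \<xi>)) = 0"
          by eventually_elim (use False in \<open>auto simp: indicator_def not_less dest: order.trans\<close>)
      qed measurable
      then show ?thesis using False by simp
    qed
    finally show ?thesis .
  qed
  have Rr: "emeasure ?N {..R} = (if 0 < R then ennreal (M R) else 0)" for R
  proof -
    have "emeasure ?N {..R} = (\<integral>\<^sup>+r. ennreal (w r) * indicator {0..R} r \<partial>lborel)"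
      by (auto simp: emeasure_density w_def intro!: nn_integral_cong simp: indicator_def)
    also have "\<dots> = (if 0 < R then ennreal (M R) else 0)"
    proof (cases "0 < R")
      case True
      have "(\<integral>\<^sup>+r. ennreal (w r) * indicator {0..R} r \<partial>lborel) = ennreal (M R - M 0)"
      proof (rule nn_integral_FTC_Icc)
        show "(M has_real_derivative w r) (at r)" for r
          unfolding M_def[abs_def] w_def by (rule DERIV_cball_integral_one_plus_cos)
        show "0 \<le> w r" if "r \<in> {0..R}" for r
          using sphere_mass_plus_radial_kernel_nonneg[OF e] that by (simp add: w_def)
      qed (use True in auto)
      then show ?thesis using True by (simp add: M_def zero_power[OF DIM_positive])
    next
      case False
      have "(\<integral>\<^sup>+r. ennreal (w r) * indicator {0..R} r \<partial>lborel) = (\<integral>\<^sup>+r. 0 \<partial>(lborel :: real measure))"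
      proof (rule nn_integral_cong_AE)
        have "AE r in lborel. r \<noteq> (0::real)" by (rule AE_lborel_singleton)
        then show "AE r in lborel. ennreal (w r) * indicator {0..R} r = 0"
          by eventually_elim (use False in \<open>auto simp: indicator_def\<close>)
      qed
      then show ?thesis using False by simp
    qed
    finally show ?thesis .
  qed
  show ?thesis
  proof (rule measure_eqI_generator_eq[where E="range (\<lambda>a::real. {..a})" and \<Omega>=UNIV and A="\<lambda>n. {..real n}"])
    show "Int_stable (range (\<lambda>a::real. {..a}))"
      by (auto simp: Int_stable_def)
    show "sets ?M = sigma_sets UNIV (range (\<lambda>a::real. {..a}))" "sets ?N = sigma_sets UNIV (range (\<lambda>a::real. {..a}))"
      by (simp_all add: borel_eq_atMost)
    show "(\<Union>i. {..real i}) = UNIV"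
      using real_arch_simple by auto
    show "emeasure ?M X = emeasure ?N X" if "X \<in> range (\<lambda>a::real. {..a})" for X
      using that L Rr by auto
    show "emeasure ?M {..real i} \<noteq> \<infinity>" for i using L[of "real i"] by auto
  qed auto
qed


text \<open>The case x = 0 of the preceding identity: both densities are doubled, and the factor 2
  cancels.\<close>

lemma nn_integral_norm:
  fixes e :: "'a::euclidean_space"
  assumes e: "norm e = 1" and [measurable]: "h \<in> borel_measurable borel"
  shows "(\<integral>\<^sup>+\<xi>. h (norm (\<xi>::'a)) \<partial>lborel)
    = (\<integral>\<^sup>+r. ennreal (indicator {0..} r * r ^ (DIM('a) - 1) * sphere_mass e) * h r \<partial>lborel)"
proof -
  have "2 * (\<integral>\<^sup>+\<xi>. h (norm (\<xi>::'a)) \<partial>lborel)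
      = (\<integral>\<^sup>+r. h r \<partial>distr (density lborel (\<lambda>\<xi>. ennreal (1 + cos ((0::'a) \<bullet> \<xi>)))) borel norm)"
    by (simp add: nn_integral_distr nn_integral_density nn_integral_cmult)
  also have "\<dots> = (\<integral>\<^sup>+r. h r \<partial>density lborel (\<lambda>r. ennreal (indicator {0..} r * r ^ (DIM('a) - 1) * (sphere_mass e + radial_kernel e (norm (0::'a) * r)))))"
    by (simp only: distr_norm_one_plus_cos[OF e])
  also have "\<dots> = (\<integral>\<^sup>+r. 2 * (ennreal (indicator {0..} r * r ^ (DIM('a) - 1) * sphere_mass e) * h r) \<partial>lborel)"
    using sphere_mass_pos[of e]
    by (subst nn_integral_density)
      (auto simp: radial_kernel_0 mult_2[symmetric] ennreal_mult indicator_def mult_ac intro!: nn_integral_cong)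
  also have "\<dots> = 2 * (\<integral>\<^sup>+r. ennreal (indicator {0..} r * r ^ (DIM('a) - 1) * sphere_mass e) * h r \<partial>lborel)"
    by (rule nn_integral_cmult) measurable
  finally show ?thesis
    by (simp add: ennreal_mult_cancel_left)
qed

text \<open>The cosine part is recovered from the positive weights by subtracting half of the weight
  at x = 0; the sine part vanishes by oddness.\<close>

lemma integral_cis_norm:
  fixes x e :: "'a::euclidean_space" and H :: "real \<Rightarrow> complex"
  assumes e: "norm e = 1" and [measurable]: "H \<in> borel_measurable borel"
    and H: "integrable lborel (\<lambda>\<xi>::'a. H (norm \<xi>))"
  shows "(LINT \<xi>|lborel. cis (x \<bullet> \<xi>) * H (norm \<xi>))
    = (LINT r|lborel. complex_of_real (indicator {0..} r * r ^ (DIM('a) - 1) * radial_kernel e (norm x * r)) * H r)"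
proof -
  define w where "w y r = indicator {0..} r * r ^ (DIM('a) - 1) * (sphere_mass e + radial_kernel e (norm y * r))" for y :: 'a and r :: real
  have [measurable]: "w y \<in> borel_measurable borel" for y unfolding w_def by measurable
  have w0: "0 \<le> w y r" for y r
    using sphere_mass_plus_radial_kernel_nonneg[OF e, of "norm y * r"]
    by (auto simp: w_def indicator_def)
  have c0: "0 \<le> 1 + cos (y \<bullet> \<xi>)" for y \<xi> :: 'a using cos_ge_minus_one[of "y \<bullet> \<xi>"] by linarith
  have dn: "distr (density lborel (\<lambda>\<xi>. ennreal (1 + cos (y \<bullet> \<xi>)))) borel norm = density lborel (\<lambda>r. ennreal (w y r))" for y :: 'a
    unfolding w_def by (rule distr_norm_one_plus_cos[OF e])
  have ci: "integrable lborel (\<lambda>\<xi>::'a. cos (y \<bullet> \<xi>) *\<^sub>R H (norm \<xi>))" for y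
    by (rule Bochner_Integration.integrable_bound[OF H]) (auto simp: mult_left_le_one_le)
  have li: "integrable lborel (\<lambda>\<xi>::'a. (1 + cos (y \<bullet> \<xi>)) *\<^sub>R H (norm \<xi>))" for y
    using ci[of y] H by (simp add: scaleR_add_left)
  have ri: "integrable lborel (\<lambda>r. w y r *\<^sub>R H r)" for y
  proof -
    have "integrable (distr (density lborel (\<lambda>\<xi>. ennreal (1 + cos (y \<bullet> \<xi>)))) borel norm) H"
      using li[of y] by (subst integrable_distr_eq) (auto simp: integrable_density c0)
    then show ?thesis unfolding dn by (subst (asm) integrable_density) (auto simp: w0)
  qed
  have eq: "(LINT \<xi>|lborel. (1 + cos (y \<bullet> \<xi>)) *\<^sub>R H (norm \<xi>)) = (LINT r|lborel. w y r *\<^sub>R H r)" for y :: 'a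
  proof -
    have "(LINT \<xi>|lborel. (1 + cos (y \<bullet> \<xi>)) *\<^sub>R H (norm \<xi>)) = integral\<^sup>L (distr (density lborel (\<lambda>\<xi>. ennreal (1 + cos (y \<bullet> \<xi>)))) borel norm) H"
      by (subst integral_distr) (auto simp: integral_density c0)
    also have "\<dots> = (LINT r|lborel. w y r *\<^sub>R H r)"
      unfolding dn by (rule integral_density) (auto simp: w0)
    finally show ?thesis .
  qed
  have cos_eq: "(LINT \<xi>|lborel. cos (x \<bullet> \<xi>) *\<^sub>R H (norm \<xi>))
      = (LINT r|lborel. complex_of_real (indicator {0..} r * r ^ (DIM('a) - 1) * radial_kernel e (norm x * r)) * H r)"
  proof -
    \<comment> \<open>At x = 0 the weight equals 2, so one half of it is the constant 1 to be
      removed.\<close>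
    have "(LINT \<xi>|lborel. cos (x \<bullet> \<xi>) *\<^sub>R H (norm \<xi>))
       = (LINT \<xi>|lborel. (1 + cos (x \<bullet> \<xi>)) *\<^sub>R H (norm \<xi>) - (1/2) *\<^sub>R ((1 + cos (0 \<bullet> \<xi>)) *\<^sub>R H (norm \<xi>)))"
      by (intro Bochner_Integration.integral_cong refl) (simp add: algebra_simps)
    also have "\<dots> = (LINT \<xi>|lborel. (1 + cos (x \<bullet> \<xi>)) *\<^sub>R H (norm \<xi>)) - (1/2) *\<^sub>R (LINT \<xi>::'a|lborel. (1 + cos (0 \<bullet> \<xi>)) *\<^sub>R H (norm \<xi>))"
      using li[of x] li[of 0] by (subst Bochner_Integration.integral_diff) (auto simp only: integrable_scaleR_right integral_scaleR_right)
    also have "\<dots> = (LINT r|lborel. w x r *\<^sub>R H r) - (1/2) *\<^sub>R (LINT r|lborel. w 0 r *\<^sub>R H r)"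
      by (simp only: eq)
    also have "\<dots> = (LINT r|lborel. w x r *\<^sub>R H r - (1/2) *\<^sub>R (w 0 r *\<^sub>R H r))"
      using ri[of x] ri[of 0] by (subst Bochner_Integration.integral_diff) (auto simp only: integrable_scaleR_right integral_scaleR_right)
    also have "\<dots> = (LINT r|lborel. complex_of_real (indicator {0..} r * r ^ (DIM('a) - 1) * radial_kernel e (norm x * r)) * H r)"
      by (intro Bochner_Integration.integral_cong refl)
        (simp add: w_def radial_kernel_0 scaleR_conv_of_real algebra_simps)
    finally show ?thesis .
  qed
  have T: "orthogonal_transformation (uminus :: 'a \<Rightarrow> 'a)"
    by (simp add: orthogonal_transformation_neg)
  have "(LINT \<xi>|lborel. sin (x \<bullet> \<xi>) *\<^sub>R H (norm \<xi>)) = (LINT \<xi>|lborel. sin (x \<bullet> - \<xi>) *\<^sub>R H (norm (- \<xi>)))"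
    by (rule lborel_integral_orthogonal_transformation[OF T, symmetric]) measurable
  also have "\<dots> = - (LINT \<xi>|lborel. sin (x \<bullet> \<xi>) *\<^sub>R H (norm \<xi>))"
    by (simp add: inner_minus_right)
  finally have sin_eq: "(LINT \<xi>|lborel. sin (x \<bullet> \<xi>) *\<^sub>R H (norm \<xi>)) = 0"
    by simp
  have si: "integrable lborel (\<lambda>\<xi>::'a. sin (x \<bullet> \<xi>) *\<^sub>R H (norm \<xi>))"
    by (rule Bochner_Integration.integrable_bound[OF H]) (auto simp: mult_left_le_one_le)
  have "cis (x \<bullet> \<xi>) * H (norm \<xi>) = cos (x \<bullet> \<xi>) *\<^sub>R H (norm \<xi>) + \<i> * (sin (x \<bullet> \<xi>) *\<^sub>R H (norm \<xi>))" for \<xi>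
    by (simp add: cis_conv_exp exp_Euler scaleR_conv_of_real algebra_simps cos_of_real sin_of_real)
  then have "(LINT \<xi>|lborel. cis (x \<bullet> \<xi>) * H (norm \<xi>))
     = (LINT \<xi>|lborel. cos (x \<bullet> \<xi>) *\<^sub>R H (norm \<xi>) + \<i> * (sin (x \<bullet> \<xi>) *\<^sub>R H (norm \<xi>)))"
    by simp
  also have "\<dots> = (LINT \<xi>|lborel. cos (x \<bullet> \<xi>) *\<^sub>R H (norm \<xi>)) + \<i> * (LINT \<xi>|lborel. sin (x \<bullet> \<xi>) *\<^sub>R H (norm \<xi>))"
    using ci[of x] si by (simp only: Bochner_Integration.integral_add integrable_mult_right integral_mult_right_zero)
  finally show ?thesis by (simp add: sin_eq cos_eq)
qed


text \<open>The transform of the ball at s e + t b is a function phi of \<open>\<rho>\<close>, the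
  length of that vector. Its second derivative in t at 0 is phi'(s) / s on the one hand, and minus
  the integral with the factor \<open>(\<xi> \<bullet> b)\<^sup>2\<close> on the other. This is the
  tangential part of the Laplacian of a radial function.\<close>

lemma ball_integral_orthogonal_square:
  fixes e b :: "'a::euclidean_space"
  assumes e: "norm e = 1" and b: "norm b = 1" and eb: "e \<bullet> b = 0" and s: "0 < s"
  shows "ball_integral (\<lambda>\<xi>. (\<xi> \<bullet> b)\<^sup>2 * cos (s * (\<xi> \<bullet> e))) = ball_sin e 1 s / s"
proof -
  define \<rho> where "\<rho> t = sqrt (s\<^sup>2 + t\<^sup>2)" for t
  define \<psi> where "\<psi> t = ball_integral (\<lambda>\<xi>. (\<xi> \<bullet> b) * sin (t * (\<xi> \<bullet> b) + s * (\<xi> \<bullet> e)))" for t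
  have pos: "0 < s\<^sup>2 + t\<^sup>2" for t using s by (simp add: add_pos_nonneg)
  have \<rho>0: "0 < \<rho> t" for t using pos[of t] by (simp add: \<rho>_def)
  have D\<rho>: "(\<rho> has_real_derivative t / \<rho> t) (at t)" for t
    unfolding \<rho>_def[abs_def] using pos[of t] by (auto intro!: derivative_eq_intros simp: field_simps)
  have rot: "ball_integral (\<lambda>\<xi>. cos (t * (\<xi> \<bullet> b) + s * (\<xi> \<bullet> e))) = ball_cos e 0 (\<rho> t)" for t
  proof -
    have "(norm (t *\<^sub>R b + s *\<^sub>R e))\<^sup>2 = s\<^sup>2 + t\<^sup>2"
    proof -
      have "e \<bullet> e = 1" "b \<bullet> b = 1" using e b by (simp_all add: norm_eq_1)
      then show ?thesis unfolding power2_norm_eq_inner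
        using eb by (simp add: inner_add_left inner_add_right inner_commute[of b e] power2_eq_square)
    qed
    then have n: "norm (t *\<^sub>R b + s *\<^sub>R e) = \<rho> t"
      by (simp add: \<rho>_def real_sqrt_unique[symmetric])
    have "ball_integral (\<lambda>\<xi>. cos (\<xi> \<bullet> (t *\<^sub>R b + s *\<^sub>R e))) = ball_integral (\<lambda>\<xi>. cos (\<xi> \<bullet> (\<rho> t *\<^sub>R e)))"
      by (rule ball_integral_cos_inner) (use n e \<rho>0[of t] in simp)
    then show ?thesis by (simp add: ball_cos_def inner_add_right)
  qed
  have D1: "((\<lambda>t. ball_cos e 0 (\<rho> t)) has_real_derivative - \<psi> t) (at t)" for t
    using DERIV_ball_integral_cos(1)[of "\<lambda>_. 1" "\<lambda>\<xi>. \<xi> \<bullet> b" "\<lambda>\<xi>. s * (\<xi> \<bullet> e)" t]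
    by (simp add: continuous_intros rot \<psi>_def)
  have D2: "((\<lambda>t. ball_cos e 0 (\<rho> t)) has_real_derivative - ball_sin e 1 (\<rho> t) * (t / \<rho> t)) (at t)" for t
    using DERIV_chain2[OF DERIV_ball_cos[of e 0 "\<rho> t"] D\<rho>[of t]] by simp
  \<comment> \<open>After one differentiation the factor t splits off, so the derivative at 0 is
    just the value of the other factor there.\<close>
  have \<psi>: "\<psi> = (\<lambda>t. t * (ball_sin e 1 (\<rho> t) / \<rho> t))"
    using DERIV_unique[OF D1 D2] by (auto simp: fun_eq_iff mult.commute)
  have D3: "(\<psi> has_real_derivative ball_integral (\<lambda>\<xi>. (\<xi> \<bullet> b)\<^sup>2 * cos (s * (\<xi> \<bullet> e)))) (at 0)"
    using DERIV_ball_integral_cos(2)[of "\<lambda>\<xi>. \<xi> \<bullet> b" "\<lambda>\<xi>. \<xi> \<bullet> b" "\<lambda>\<xi>. s * (\<xi> \<bullet> e)" 0]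
    by (simp add: continuous_intros \<psi>_def[abs_def] power2_eq_square)
  have Dm: "((\<lambda>t. ball_sin e 1 (\<rho> t) / \<rho> t) has_real_derivative
      ((ball_cos e 2 (\<rho> t) * (t / \<rho> t)) * \<rho> t - ball_sin e 1 (\<rho> t) * (t / \<rho> t)) / (\<rho> t * \<rho> t)) (at t)" for t
    using DERIV_divide[OF DERIV_chain2[OF DERIV_ball_sin[of e 1 "\<rho> t"] D\<rho>[of t]] D\<rho>[of t]] \<rho>0[of t]
    by (simp add: numeral_2_eq_2)
  have \<rho>s: "\<rho> 0 = s" using s by (simp add: \<rho>_def)
  have "(\<psi> has_real_derivative ball_sin e 1 s / s) (at 0)"
    unfolding \<psi> using DERIV_mult[OF DERIV_ident Dm[of 0]] by (simp add: \<rho>s)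
  from DERIV_unique[OF D3 this] show ?thesis .
qed

text \<open>Expanding the squared norm over \<open>Basis\<close>, one direction is \<open>e\<close>
  itself and all others are orthogonal to it; this is why \<open>e\<close> is taken from the
  basis.\<close>

lemma ball_integral_norm_square_cos:
  fixes e :: "'a::euclidean_space"
  assumes e: "e \<in> Basis" and s: "0 < s"
  shows "ball_integral (\<lambda>\<xi>. (norm \<xi>)\<^sup>2 * cos (s * (\<xi> \<bullet> e)))
    = ball_cos e 2 s + (real DIM('a) - 1) * (ball_sin e 1 s / s)"
proof -
  have i: "integrable lborel (\<lambda>\<xi>::'a. indicator (cball 0 1) \<xi> * ((\<xi> \<bullet> b)\<^sup>2 * cos (s * (\<xi> \<bullet> e))))" for b
    by (rule integrable_on_cball) (intro continuous_intros)
  have "ball_integral (\<lambda>\<xi>. (norm \<xi>)\<^sup>2 * cos (s * (\<xi> \<bullet> e)))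
     = (LINT \<xi>|lborel. (\<Sum>b\<in>Basis. indicator (cball 0 1) \<xi> * ((\<xi> \<bullet> b)\<^sup>2 * cos (s * (\<xi> \<bullet> e)))))"
    unfolding ball_integral_def norm_square_eq_sum_Basis
    by (simp add: sum_distrib_left sum_distrib_right)
  also have "\<dots> = (\<Sum>b\<in>Basis. ball_integral (\<lambda>\<xi>. (\<xi> \<bullet> b)\<^sup>2 * cos (s * (\<xi> \<bullet> e))))"
    unfolding ball_integral_def by (rule Bochner_Integration.integral_sum) (rule i)
  also have "\<dots> = ball_cos e 2 s + (\<Sum>b\<in>Basis - {e}. ball_integral (\<lambda>\<xi>. (\<xi> \<bullet> b)\<^sup>2 * cos (s * (\<xi> \<bullet> e))))"
    using e by (subst sum.remove[of _ e]) (auto simp: ball_cos_def)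
  also have "(\<Sum>b\<in>Basis - {e}. ball_integral (\<lambda>\<xi>. (\<xi> \<bullet> b)\<^sup>2 * cos (s * (\<xi> \<bullet> e)))) = (\<Sum>b\<in>Basis - {e}. ball_sin e 1 s / s)"
    by (intro sum.cong refl ball_integral_orthogonal_square) (use e s in \<open>auto simp: inner_Basis\<close>)
  also have "\<dots> = (real DIM('a) - 1) * (ball_sin e 1 s / s)"
    using e DIM_positive[where 'a='a] by (simp add: card_Diff_singleton of_nat_diff)
  finally show ?thesis .
qed

lemma cball_integral_norm_square_cos:
  fixes e :: "'a::euclidean_space"
  assumes e: "e \<in> Basis" and s: "0 < s"
  shows "(LINT \<xi>|lborel. indicator (cball 0 s) \<xi> * ((norm \<xi>)\<^sup>2 * cos (\<xi> \<bullet> e)))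
     = s ^ (DIM('a) + 2) * ball_cos e 2 s + (real DIM('a) - 1) * s ^ (DIM('a) + 1) * ball_sin e 1 s"
proof -
  have "(LINT \<xi>|lborel. indicator (cball 0 s) \<xi> * ((norm \<xi>)\<^sup>2 * cos (\<xi> \<bullet> e)))
    = s ^ DIM('a) * ball_integral (\<lambda>\<xi>. (norm (s *\<^sub>R \<xi>))\<^sup>2 * cos ((s *\<^sub>R \<xi>) \<bullet> e))"
    by (rule cball_integral_scale[OF _ s]) measurable
  also have "ball_integral (\<lambda>\<xi>. (norm (s *\<^sub>R \<xi>))\<^sup>2 * cos ((s *\<^sub>R \<xi>) \<bullet> e))
     = s\<^sup>2 * ball_integral (\<lambda>\<xi>. (norm \<xi>)\<^sup>2 * cos (s * (\<xi> \<bullet> e)))"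
  proof -
    have "ball_integral (\<lambda>\<xi>. (norm (s *\<^sub>R \<xi>))\<^sup>2 * cos ((s *\<^sub>R \<xi>) \<bullet> e))
      = (LINT \<xi>|lborel. s\<^sup>2 * (indicator (cball 0 1) \<xi> * ((norm \<xi>)\<^sup>2 * cos (s * (\<xi> \<bullet> e)))))"
      unfolding ball_integral_def by (intro Bochner_Integration.integral_cong refl) (simp add: power_mult_distrib mult_ac)
    then show ?thesis unfolding ball_integral_def by (simp only: integral_mult_right_zero)
  qed
  finally have "(LINT \<xi>|lborel. indicator (cball 0 s) \<xi> * ((norm \<xi>)\<^sup>2 * cos (\<xi> \<bullet> e)))
     = s ^ DIM('a) * (s\<^sup>2 * (ball_cos e 2 s + (real DIM('a) - 1) * (ball_sin e 1 s / s)))"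
    unfolding ball_integral_norm_square_cos[OF e s] .
  also have "\<dots> = s ^ (DIM('a) + 2) * ball_cos e 2 s + (real DIM('a) - 1) * s ^ (DIM('a) + 1) * ball_sin e 1 s"
    using s by (simp add: field_simps power_add power2_eq_square)
  finally show ?thesis .
qed

lemma cball_integral_norm_square_cos_radial:
  fixes e :: "'a::euclidean_space"
  assumes e: "norm e = 1" and s: "0 < s"
  shows "(LINT \<xi>|lborel. indicator (cball 0 s) \<xi> * ((norm \<xi>)\<^sup>2 * cos (\<xi> \<bullet> e)))
     = integral {0..s} (\<lambda>r. r ^ (DIM('a) + 1) * radial_kernel e r)"
proof -
  define H where "H r = complex_of_real (indicator {..s} r * r\<^sup>2)" for r :: real
  have [measurable]: "H \<in> borel_measurable borel" unfolding H_def by measurable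
  have Hn: "H (norm \<xi>) = complex_of_real (indicator (cball 0 s) \<xi> * (norm \<xi>)\<^sup>2)" for \<xi> :: 'a
    by (simp add: H_def indicator_def)
  have "integrable lborel (\<lambda>\<xi>::'a. indicator (cball 0 s) \<xi> * (norm \<xi>)\<^sup>2)"
    by (rule integrable_on_cball) (intro continuous_intros)
  then have Hi: "integrable lborel (\<lambda>\<xi>::'a. H (norm \<xi>))"
    unfolding Hn by (rule integrable_of_real)
  have eq: "(LINT \<xi>|lborel. cis (e \<bullet> \<xi>) * H (norm \<xi>))
    = (LINT r|lborel. complex_of_real (indicator {0..} r * r ^ (DIM('a) - 1) * radial_kernel e (norm e * r)) * H r)"
    by (rule integral_cis_norm[OF e _ Hi]) measurable
  have "Re (LINT \<xi>|lborel. cis (e \<bullet> \<xi>) * H (norm \<xi>)) = (LINT \<xi>|lborel. Re (cis (e \<bullet> \<xi>) * H (norm \<xi>)))"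
    by (rule integral_Re[symmetric]) (rule integrable_cis_times(1)[OF Hi])
  also have "\<dots> = (LINT \<xi>|lborel. indicator (cball 0 s) \<xi> * ((norm \<xi>)\<^sup>2 * cos (\<xi> \<bullet> e)))"
    by (simp add: Hn inner_commute mult_ac)
  finally have L: "Re (LINT \<xi>|lborel. cis (e \<bullet> \<xi>) * H (norm \<xi>)) = (LINT \<xi>|lborel. indicator (cball 0 s) \<xi> * ((norm \<xi>)\<^sup>2 * cos (\<xi> \<bullet> e)))" .
  have pow: "r ^ (DIM('a) - 1) * r\<^sup>2 = r ^ (DIM('a) + 1)" for r :: real
    using DIM_positive[where 'a='a] by (simp add: power_add[symmetric])
  have "indicator {0..} r * r ^ (DIM('a) - 1) * radial_kernel e (norm e * r) * (indicator {..s} r * r\<^sup>2)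
     = indicator {0..s} r *\<^sub>R (r ^ (DIM('a) + 1) * radial_kernel e r)" for r
    unfolding pow[symmetric] e by (auto simp: indicator_def)
  then have pw: "complex_of_real (indicator {0..} r * r ^ (DIM('a) - 1) * radial_kernel e (norm e * r)) * H r
     = complex_of_real (indicator {0..s} r *\<^sub>R (r ^ (DIM('a) + 1) * radial_kernel e r))" for r
    unfolding H_def of_real_mult[symmetric] by (simp only:)
  have c: "continuous_on {0..s} (\<lambda>r. r ^ (DIM('a) + 1) * radial_kernel e r)"
    by (intro continuous_intros continuous_radial_kernel)
  have "Re (LINT \<xi>|lborel. cis (e \<bullet> \<xi>) * H (norm \<xi>)) = (LINT r:{0..s}|lborel. r ^ (DIM('a) + 1) * radial_kernel e r)"
    unfolding eq pw integral_complex_of_real set_lebesgue_integral_def by simp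
  also have "\<dots> = integral {0..s} (\<lambda>r. r ^ (DIM('a) + 1) * radial_kernel e r)"
    by (rule set_borel_integral_eq_integral)
      (use borel_integrable_compact[OF compact_Icc c] in \<open>simp add: set_integrable_def\<close>)
  finally show ?thesis unfolding L .
qed

text \<open>Bessel's equation for the kernel, from the two expressions for the integral of
  \<open>(norm \<xi>)\<^sup>2 * cos (\<xi> \<bullet> e)\<close> over balls: one comes from polar coordinates, the other from the Laplacian
  of a radial function.\<close>

lemma radial_kernel_ode:
  fixes e :: "'a::euclidean_space"
  assumes e: "e \<in> Basis" and s: "0 < s"
  shows "s * (s * ball_sin e 3 s - (real DIM('a) + 2) * ball_cos e 2 s)
     + (real DIM('a) - 1) * radial_kernel' e s + s * radial_kernel e s = 0"
proof -
  let ?d = "DIM('a)"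
  define J where "J s = s ^ (?d + 2) * ball_cos e 2 s + (real ?d - 1) * s ^ (?d + 1) * ball_sin e 1 s" for s
  have ne: "norm e = 1" using e by simp
  have J: "J t = integral {0..t} (\<lambda>r. r ^ (?d + 1) * radial_kernel e r)" if "0 < t" for t
    unfolding J_def cball_integral_norm_square_cos[OF e that, symmetric]
    by (rule cball_integral_norm_square_cos_radial[OF ne that])
  have "((\<lambda>t. integral {0..t} (\<lambda>r. r ^ (?d + 1) * radial_kernel e r)) has_real_derivative
      s ^ (?d + 1) * radial_kernel e s) (at s within {0..s+1})"
    by (rule integral_has_real_derivative) (use s in \<open>auto intro!: continuous_intros continuous_radial_kernel\<close>)
  then have "((\<lambda>t. integral {0..t} (\<lambda>r. r ^ (?d + 1) * radial_kernel e r)) has_real_derivative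
      s ^ (?d + 1) * radial_kernel e s) (at s)"
    using s by (subst (asm) at_within_interior) auto
  \<comment> \<open>\<open>J\<close> is identified with the integral for positive arguments only, so
    the derivative is transferred on the open half-line; comparison with the product rule then
    yields the equation.\<close>
  then have D1: "(J has_real_derivative s ^ (?d + 1) * radial_kernel e s) (at s)"
    by (rule has_field_derivative_transform_within_open[where S="{0<..}"]) (use s J in auto)
  have D2: "(J has_real_derivative
     (real (?d + 2) * s ^ (?d + 1) * ball_cos e 2 s - s ^ (?d + 2) * ball_sin e 3 s)
     + (real ?d - 1) * (real (?d + 1) * s ^ ?d * ball_sin e 1 s + s ^ (?d + 1) * ball_cos e 2 s)) (at s)"
    unfolding J_def[abs_def] mult.assoc
    by (rule derivative_eq_intros DERIV_ball_cos DERIV_ball_sin refl | simp add: numeral_2_eq_2 numeral_3_eq_3 algebra_simps)+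
  have "s ^ (?d + 1) * radial_kernel e s =
     (real (?d + 2) * s ^ (?d + 1) * ball_cos e 2 s - s ^ (?d + 2) * ball_sin e 3 s)
     + (real ?d - 1) * (real (?d + 1) * s ^ ?d * ball_sin e 1 s + s ^ (?d + 1) * ball_cos e 2 s)"
    by (rule DERIV_unique[OF D1 D2])
  also have "\<dots> = s ^ ?d * (real (?d + 2) * s * ball_cos e 2 s - s * s * ball_sin e 3 s
     + (real ?d - 1) * (real (?d + 1) * ball_sin e 1 s + s * ball_cos e 2 s))"
    by (simp add: algebra_simps)
  finally have "s ^ ?d * (s * radial_kernel e s) = s ^ ?d * (real (?d + 2) * s * ball_cos e 2 s - s * s * ball_sin e 3 s
     + (real ?d - 1) * (real (?d + 1) * ball_sin e 1 s + s * ball_cos e 2 s))"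
    by (simp add: mult_ac)
  then have "s * radial_kernel e s = real (?d + 2) * s * ball_cos e 2 s - s * s * ball_sin e 3 s
     + (real ?d - 1) * (real (?d + 1) * ball_sin e 1 s + s * ball_cos e 2 s)"
    using s by simp
  then show ?thesis
    by (simp add: radial_kernel'_def algebra_simps)
qed

text \<open>The energy \<open>E = s powr n * (k\<^sup>2 + w\<^sup>2)\<close> with \<open>w = k' + n * k / (2 * s)\<close> is that of
  \<open>s powr (n/2) * k\<close>, which solves an oscillator equation up to a term with coefficient \<open>O(1 / s\<^sup>2)\<close>.\<close>

lemma bessel_type_decay:
  fixes k k' k'' :: "real \<Rightarrow> real" and n :: real
  assumes Dk: "\<And>s. (k has_real_derivative k' s) (at s)" and Dk': "\<And>s. (k' has_real_derivative k'' s) (at s)"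
    and ode: "\<And>s. 0 < s \<Longrightarrow> s * k'' s + n * k' s + s * k s = 0" and n: "0 \<le> n"
  shows "\<exists>C>0. \<forall>s\<ge>1. \<bar>k s\<bar> \<le> C * s powr (- n / 2) \<and> \<bar>k' s\<bar> \<le> C * s powr (- n / 2)"
proof -
  define w where "w s = k' s + n * k s / (2 * s)" for s
  define E where "E s = s powr n * ((k s)\<^sup>2 + (w s)\<^sup>2)" for s
  define c where "c = \<bar>n\<^sup>2 / 4 - n / 2\<bar>"
  have Dw: "(w has_real_derivative k'' s + (n * k' s / (2 * s) - n * k s / (2 * s\<^sup>2))) (at s)" if "0 < s" for s
    unfolding w_def[abs_def] using that
    by (auto intro!: derivative_eq_intros Dk Dk' simp: field_simps power2_eq_square)
  have DE: "(E has_real_derivative 2 * (n\<^sup>2 / 4 - n / 2) * s powr n * (k s * w s) / s\<^sup>2) (at s)" if s: "0 < s" for s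
  proof -
    \<comment> \<open>Writing 1/s as a separate quantity turns the verification into a polynomial
      identity.\<close>
    define a where "a = 1 / s"
    have sa: "s * a = 1" using s by (simp add: a_def)
    have k1: "k' s = w s - n * a * k s / 2" by (simp add: w_def a_def)
    have "s * (k'' s + n * a * k' s + k s) = s * k'' s + n * k' s * (s * a) + s * k s"
      by (simp add: algebra_simps)
    then have "s * (k'' s + n * a * k' s + k s) = 0"
      using ode[OF s] sa by simp
    then have k2: "k'' s = - (n * a * k' s) - k s" using s by simp
    have pw: "s powr (n - 1) = s powr n * a" using s by (simp add: powr_diff a_def)
    have "(E has_real_derivative n * s powr (n - 1) * ((k s)\<^sup>2 + (w s)\<^sup>2)
       + s powr n * (2 * k s * k' s + 2 * w s * (k'' s + (n * k' s / (2 * s) - n * k s / (2 * s\<^sup>2))))) (at s)"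
      unfolding E_def[abs_def] using s
      by (auto intro!: derivative_eq_intros Dk Dw simp: algebra_simps)
    also have "n * k' s / (2 * s) - n * k s / (2 * s\<^sup>2) = n * a * k' s / 2 - n * a * a * k s / 2"
      by (simp add: a_def power2_eq_square)
    also have "n * s powr (n - 1) * ((k s)\<^sup>2 + (w s)\<^sup>2)
       + s powr n * (2 * k s * k' s + 2 * w s * (k'' s + (n * a * k' s / 2 - n * a * a * k s / 2)))
      = 2 * (n\<^sup>2 / 4 - n / 2) * s powr n * (k s * w s) * (a * a)"
      unfolding pw k2 unfolding k1 by (simp add: field_simps power2_eq_square)
    finally show ?thesis by (simp add: a_def power2_eq_square)
  qed
  \<comment> \<open>The derivative of \<open>E\<close> is at most c E / s^2 in absolute value,
    because 2 |k w| \<le> k^2 + w^2. The factor exp (c / s) compensates this growth exactly; it is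
    at least 1 and stays bounded for s \<ge> 1.\<close>
  have mono: "E s * exp (c / s) \<le> E 1 * exp (c / 1)" if "1 \<le> s" for s
  proof (rule DERIV_nonpos_imp_nonincreasing[OF that])
    fix x :: real assume x: "1 \<le> x" "x \<le> s"
    have "((\<lambda>s. E s * exp (c / s)) has_real_derivative
       2 * (n\<^sup>2 / 4 - n / 2) * x powr n * (k x * w x) / x\<^sup>2 * exp (c / x) + E x * (exp (c / x) * (- (c / x\<^sup>2)))) (at x)"
      using x by (auto intro!: derivative_eq_intros DE simp: power2_eq_square)
    moreover have "2 * (n\<^sup>2 / 4 - n / 2) * x powr n * (k x * w x) / x\<^sup>2 * exp (c / x) + E x * (exp (c / x) * (- (c / x\<^sup>2)))
      = (exp (c / x) * x powr n / x\<^sup>2) * ((n\<^sup>2 / 4 - n / 2) * (2 * k x * w x) - c * ((k x)\<^sup>2 + (w x)\<^sup>2))"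
      using x by (simp add: E_def field_simps)
    moreover have "(n\<^sup>2 / 4 - n / 2) * (2 * k x * w x) \<le> c * ((k x)\<^sup>2 + (w x)\<^sup>2)"
    proof -
      have "(n\<^sup>2 / 4 - n / 2) * (2 * k x * w x) \<le> \<bar>n\<^sup>2 / 4 - n / 2\<bar> * \<bar>2 * k x * w x\<bar>"
        by (metis abs_ge_self abs_mult)
      also have "\<dots> \<le> c * ((k x)\<^sup>2 + (w x)\<^sup>2)"
        unfolding c_def using sum_squares_bound[of "\<bar>k x\<bar>" "\<bar>w x\<bar>"]
        by (intro mult_left_mono) (auto simp: abs_mult)
      finally show ?thesis .
    qed
    then have "(exp (c / x) * x powr n / x\<^sup>2) * ((n\<^sup>2 / 4 - n / 2) * (2 * k x * w x) - c * ((k x)\<^sup>2 + (w x)\<^sup>2)) \<le> 0"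
      by (intro mult_nonneg_nonpos) auto
    ultimately show "\<exists>y. ((\<lambda>s. E s * exp (c / s)) has_real_derivative y) (at x) \<and> y \<le> 0"
      by auto
  qed
  define B where "B = sqrt (E 1 * exp c)"
  have kw: "\<bar>k s\<bar> \<le> B * s powr (- n / 2) \<and> \<bar>w s\<bar> \<le> B * s powr (- n / 2)" if s: "1 \<le> s" for s
  proof -
    have E0: "0 \<le> E s" for s by (simp add: E_def)
    have "E s \<le> E s * exp (c / s)"
      using s mult_left_mono[OF _ E0, of 1 "exp (c / s)" s] by (simp add: c_def)
    also have "\<dots> \<le> E 1 * exp c" using mono[OF s] by simp
    finally have Es: "(k s)\<^sup>2 + (w s)\<^sup>2 \<le> E 1 * exp c * s powr (- n)"
      using s by (simp add: E_def powr_minus field_simps)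
    have "sqrt (E 1 * exp c * s powr (- n)) = B * s powr (- n / 2)"
      by (simp add: B_def real_sqrt_mult powr_half_sqrt[symmetric] powr_powr)
    moreover have "\<bar>k s\<bar> \<le> sqrt ((k s)\<^sup>2 + (w s)\<^sup>2)" "\<bar>w s\<bar> \<le> sqrt ((k s)\<^sup>2 + (w s)\<^sup>2)"
      by (auto intro: real_le_rsqrt)
    ultimately show ?thesis
      using real_sqrt_le_mono[OF Es] by linarith
  qed
  have B0: "0 \<le> B" by (simp add: B_def E_def)
  \<comment> \<open>The derivative is recovered from \<open>w\<close> at the cost of n / (2 s) times
    |k|, and s \<ge> 1. The summand 1 keeps the constant positive even if the energy
    vanishes.\<close>
  have "\<bar>k s\<bar> \<le> (B * (1 + n / 2) + 1) * s powr (- n / 2) \<and> \<bar>k' s\<bar> \<le> (B * (1 + n / 2) + 1) * s powr (- n / 2)" if s: "1 \<le> s" for s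
  proof -
    let ?p = "s powr (- n / 2)"
    have "\<bar>k' s\<bar> \<le> \<bar>w s\<bar> + n / (2 * s) * \<bar>k s\<bar>"
    proof -
      have "k' s = w s - n / (2 * s) * k s" by (simp add: w_def)
      then have "\<bar>k' s\<bar> \<le> \<bar>w s\<bar> + \<bar>n / (2 * s) * k s\<bar>" by linarith
      then show ?thesis using n s by (simp add: abs_mult)
    qed
    also have "n / (2 * s) * \<bar>k s\<bar> \<le> (n / 2) * (B * ?p)"
    proof (rule mult_mono)
      show "n / (2 * s) \<le> n / 2" using s n by (simp add: field_simps mult_le_cancel_left1)
    qed (use kw[OF s] n in auto)
    finally have "\<bar>k' s\<bar> \<le> B * ?p + (n / 2) * (B * ?p)" using kw[OF s] by linarith
    moreover have "\<bar>k s\<bar> \<le> B * ?p + (n / 2) * (B * ?p)"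
      using kw[OF s] B0 n by (auto intro: order_trans)
    moreover have "(B * (1 + n / 2) + 1) * ?p = ?p + (B * ?p + (n / 2) * (B * ?p))"
      by (simp add: algebra_simps)
    ultimately show ?thesis
      using powr_ge_zero[of s "- n / 2"] by linarith
  qed
  moreover have "0 < B * (1 + n / 2) + 1" using B0 n by (simp add: add_nonneg_pos)
  ultimately show ?thesis by blast
qed

text \<open>Bessel's equation gives decay for s \<ge> 1, compactness gives a bound on [0, 1]. In
  both ranges \<open>2 powr (n / 2)\<close> pays for the weight in 1 + s: it converts powers of s in
  the first, and bounds the weight from below in the second.\<close>

lemma radial_kernel_decay:
  fixes e :: "'a::euclidean_space"
  assumes e: "e \<in> Basis"
  shows "\<exists>C>0. \<forall>s\<ge>0. \<bar>radial_kernel e s\<bar> \<le> C * (1 + s) powr (- (real DIM('a) - 1) / 2) \<and>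
    \<bar>radial_kernel' e s\<bar> \<le> C * (1 + s) powr (- (real DIM('a) - 1) / 2)"
proof -
  define n where "n = real DIM('a) - 1"
  have n: "0 \<le> n" using DIM_positive[where 'a='a] by (simp add: n_def)
  obtain C where C: "0 < C" "\<And>s. 1 \<le> s \<Longrightarrow> \<bar>radial_kernel e s\<bar> \<le> C * s powr (- n / 2) \<and> \<bar>radial_kernel' e s\<bar> \<le> C * s powr (- n / 2)"
    using bessel_type_decay[OF DERIV_radial_kernel[of e] DERIV_radial_kernel'[of e] _ n] radial_kernel_ode[OF e]
    unfolding n_def by blast
  have bdd: "\<exists>B. \<forall>s\<in>{0..1}. \<bar>g s\<bar> \<le> B" if "continuous_on {0..1} g" for g :: "real \<Rightarrow> real"
    using compact_imp_bounded[OF compact_continuous_image[OF that compact_Icc]] by (auto simp: bounded_iff)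
  obtain B where B: "\<And>s. 0 \<le> s \<Longrightarrow> s \<le> 1 \<Longrightarrow> \<bar>radial_kernel e s\<bar> \<le> B"
    using bdd[OF continuous_radial_kernel(1)[where e=e]] by (meson atLeastAtMost_iff)
  obtain B' where B': "\<And>s. 0 \<le> s \<Longrightarrow> s \<le> 1 \<Longrightarrow> \<bar>radial_kernel' e s\<bar> \<le> B'"
    using bdd[OF continuous_radial_kernel(2)[where e=e]] by (meson atLeastAtMost_iff)
  define K where "K = (C + \<bar>B\<bar> + \<bar>B'\<bar>) * 2 powr (n / 2)"
  have "0 < K" using C(1) by (simp add: K_def add_pos_nonneg)
  moreover have "\<bar>radial_kernel e s\<bar> \<le> K * (1 + s) powr (- n / 2) \<and> \<bar>radial_kernel' e s\<bar> \<le> K * (1 + s) powr (- n / 2)"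
    if s: "0 \<le> s" for s
  proof (cases "1 \<le> s")
    case True
    have "s powr (- n / 2) \<le> ((1 + s) / 2) powr (- n / 2)"
      using True n by (intro powr_mono2') auto
    also have "\<dots> = 2 powr (n / 2) * (1 + s) powr (- n / 2)"
      using True by (simp add: powr_divide powr_minus_divide)
    finally have "C * s powr (- n / 2) \<le> C * (2 powr (n / 2) * (1 + s) powr (- n / 2))"
      using C(1) by simp
    also have "\<dots> \<le> K * (1 + s) powr (- n / 2)"
      unfolding K_def mult.assoc by (intro mult_right_mono) auto
    finally show ?thesis using C(2)[OF True] by linarith
  next
    case False
    have "1 \<le> 2 powr (n / 2) * (1 + s) powr (- n / 2)"
    proof -
      have "(1 + s) powr (n / 2) \<le> 2 powr (n / 2)" using s n False by (intro powr_mono2) auto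
      then show ?thesis using s by (simp add: powr_minus field_simps)
    qed
    then have "(C + \<bar>B\<bar> + \<bar>B'\<bar>) * 1 \<le> (C + \<bar>B\<bar> + \<bar>B'\<bar>) * (2 powr (n / 2) * (1 + s) powr (- n / 2))"
      using C(1) by (intro mult_left_mono) auto
    then have "C + \<bar>B\<bar> + \<bar>B'\<bar> \<le> K * (1 + s) powr (- n / 2)" by (simp add: K_def mult.assoc)
    then show ?thesis using B[OF s] B'[OF s] False C(1) by auto
  qed
  ultimately show ?thesis unfolding n_def by auto
qed


section \<open>Bounds for the radial profile of the wave\<close>

definition profile_integral :: "(real \<Rightarrow> real) \<Rightarrow> (real \<Rightarrow> complex) \<Rightarrow> real \<Rightarrow> complex" where
  "profile_integral m G t = (LINT r|lborel. cis (t * r) * (complex_of_real (m r) * G r))"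

lemma in_L2_bounded_multiplier:
  fixes G :: "real \<Rightarrow> complex"
  assumes G: "in_L2 G" and supp: "\<And>r. r \<notin> {1/2..2} \<Longrightarrow> G r = 0"
    and [measurable]: "m \<in> borel_measurable borel" and m: "\<And>r. r \<in> {1/2..2} \<Longrightarrow> \<bar>m r\<bar> \<le> B"
  shows "in_L2 (\<lambda>r. complex_of_real (m r) * G r)"
    and "integrable lborel (\<lambda>r. complex_of_real (m r) * G r)"
    and "sqint (\<lambda>r. complex_of_real (m r) * G r) \<le> ennreal (B\<^sup>2) * sqint G"
proof -
  have [measurable]: "G \<in> borel_measurable borel" using G by (simp add: in_L2_iff)
  have "sqint (\<lambda>r. complex_of_real (m r) * G r) \<le> (\<integral>\<^sup>+r. ennreal (B\<^sup>2) * ennreal ((cmod (G r))\<^sup>2) \<partial>lborel)"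
    unfolding sqint_def
  proof (rule nn_integral_mono)
    fix r
    show "ennreal ((cmod (complex_of_real (m r) * G r))\<^sup>2) \<le> ennreal (B\<^sup>2) * ennreal ((cmod (G r))\<^sup>2)"
    proof (cases "r \<in> {1/2..2}")
      case True
      then have "(m r)\<^sup>2 \<le> B\<^sup>2" using power_mono[OF m abs_ge_zero, of r 2] by simp
      then show ?thesis
        by (simp add: norm_mult power_mult_distrib ennreal_mult[symmetric] mult_right_mono ennreal_leI)
    qed (simp add: supp)
  qed
  also have "\<dots> = ennreal (B\<^sup>2) * sqint G"
    unfolding sqint_def by (rule nn_integral_cmult) measurable
  finally show le: "sqint (\<lambda>r. complex_of_real (m r) * G r) \<le> ennreal (B\<^sup>2) * sqint G" .
  also have "\<dots> < \<infinity>" using G by (auto simp: in_L2_iff ennreal_mult_less_top)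
  finally show L2: "in_L2 (\<lambda>r. complex_of_real (m r) * G r)" by (simp add: in_L2_iff)
  show "integrable lborel (\<lambda>r. complex_of_real (m r) * G r)"
  proof (rule in_L2_bounded_support_integrable[OF L2, where R=2])
    fix r :: real assume "2 < norm r"
    then have "r \<notin> {1/2..2}" by auto
    then have "G r = 0" by (rule supp)
    then show "complex_of_real (m r) * G r = 0" by simp
  qed
qed

text \<open>As a function of t the profile integral is, up to reflection and the factor sqrt (2 pi),
  the Fourier transform of the function of r, so Plancherel's inequality on the line
  applies.\<close>

lemma profile_integral_square_integral:
  fixes G :: "real \<Rightarrow> complex"
  assumes G: "in_L2 G" and supp: "\<And>r. r \<notin> {1/2..2} \<Longrightarrow> G r = 0"
    and m[measurable]: "m \<in> borel_measurable borel" and mB: "\<And>r. r \<in> {1/2..2} \<Longrightarrow> \<bar>m r\<bar> \<le> B"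
  shows "(\<integral>\<^sup>+t. ennreal ((cmod (profile_integral m G t))\<^sup>2) \<partial>lborel) \<le> ennreal (2 * pi * B\<^sup>2) * sqint G"
proof -
  define h where "h r = complex_of_real (m r) * G r" for r
  note hh = in_L2_bounded_multiplier[OF G supp m mB, folded h_def]
  have hm[measurable]: "h \<in> borel_measurable borel" using hh(1) by (simp add: in_L2_iff)
  note [measurable] = measurable_fourier_integral[OF hm]
  have eq: "ennreal ((cmod (profile_integral m G t))\<^sup>2) = ennreal (2 * pi) * ennreal ((cmod (fourier_integral h (- t)))\<^sup>2)" for t
  proof -
    have "fourier_integral h (- t) = complex_of_real ((2 * pi) powr (- 1 / 2)) * profile_integral m G t"
      by (simp add: fourier_integral_def profile_integral_def h_def mult.commute[of t])
    moreover have "((2 * pi) powr (- 1 / 2))\<^sup>2 = 1 / (2 * pi)"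
      by (simp add: power2_eq_square powr_add[symmetric] powr_minus_divide)
    ultimately have "(cmod (fourier_integral h (- t)))\<^sup>2 = (1 / (2 * pi)) * (cmod (profile_integral m G t))\<^sup>2"
      by (simp add: norm_mult power_mult_distrib)
    then have "(cmod (profile_integral m G t))\<^sup>2 = (2 * pi) * (cmod (fourier_integral h (- t)))\<^sup>2"
      by simp
    then show ?thesis by (simp only: ennreal_mult' pi_ge_zero mult_nonneg_nonneg zero_le_numeral)
  qed
  have T: "orthogonal_transformation (uminus :: real \<Rightarrow> real)"
    by (simp add: orthogonal_transformation_neg)
  have "(\<integral>\<^sup>+t. ennreal ((cmod (profile_integral m G t))\<^sup>2) \<partial>lborel)
    = ennreal (2 * pi) * (\<integral>\<^sup>+t. ennreal ((cmod (fourier_integral h (- t)))\<^sup>2) \<partial>lborel)"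
    unfolding eq by (rule nn_integral_cmult) measurable
  also have "(\<integral>\<^sup>+t. ennreal ((cmod (fourier_integral h (- t)))\<^sup>2) \<partial>lborel) = sqint (fourier_integral h)"
    unfolding sqint_def by (rule nn_integral_orthogonal_transformation[OF T]) measurable
  also have "ennreal (2 * pi) * sqint (fourier_integral h) \<le> ennreal (2 * pi) * (ennreal (B\<^sup>2) * sqint G)"
    by (intro mult_left_mono order_trans[OF sqint_fourier_integral_le[OF hh(2)] hh(3)]) auto
  finally show ?thesis by (simp add: mult.assoc[symmetric] ennreal_mult[symmetric])
qed

text \<open>Cauchy-Schwarz against the indicator of I. This is the single source of powers of
  \<delta>: all gains in the final estimate come from this bound.\<close>

lemma profile_integral_le:
  fixes G :: "real \<Rightarrow> complex"
  assumes [measurable]: "G \<in> borel_measurable borel" and G: "sqint G \<le> ennreal Q" and Q: "0 \<le> Q"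
    and [measurable]: "I \<in> sets borel" and I: "I \<subseteq> {1/2..2}" "measure lborel I \<le> \<delta>"
    and supp: "\<And>r. r \<notin> I \<Longrightarrow> G r = 0"
    and mB: "\<And>r. r \<in> {1/2..2} \<Longrightarrow> \<bar>m r\<bar> \<le> B"
  shows "cmod (profile_integral m G t) \<le> B * sqrt (\<delta> * Q)"
proof -
  have B: "0 \<le> B" using mB[of 1] by (simp add: order_trans[OF abs_ge_zero])
  have \<delta>: "0 \<le> \<delta>" using I(2) measure_nonneg[of lborel I] by linarith
  have fin: "emeasure lborel I \<noteq> \<infinity>"
  proof -
    have "emeasure lborel I \<le> emeasure lborel {1/2..2::real}"
      by (intro emeasure_mono I) simp
    then show ?thesis by (auto simp: top_unique)
  qed
  define T where "T = (\<integral>\<^sup>+r. ennreal (cmod (G r)) * indicator I r \<partial>lborel)"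
  have "T\<^sup>2 \<le> (\<integral>\<^sup>+r. (ennreal (cmod (G r)))\<^sup>2 \<partial>lborel) * (\<integral>\<^sup>+r. (indicator I r)\<^sup>2 \<partial>lborel)"
    unfolding T_def by (rule Cauchy_Schwarz_nn_integral) measurable
  also have "(\<integral>\<^sup>+r. (ennreal (cmod (G r)))\<^sup>2 \<partial>lborel) = sqint G"
    by (simp add: sqint_def ennreal_power)
  also have "(\<integral>\<^sup>+r. (indicator I r :: ennreal)\<^sup>2 \<partial>lborel) = (\<integral>\<^sup>+r. indicator I r \<partial>lborel)"
    by (intro nn_integral_cong) (simp add: indicator_def)
  also have "\<dots> = ennreal (measure lborel I)"
    using fin by (simp add: emeasure_eq_ennreal_measure)
  also have "sqint G * ennreal (measure lborel I) \<le> ennreal Q * ennreal \<delta>"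
    by (intro mult_mono G ennreal_leI I) auto
  also have "\<dots> = ennreal ((sqrt (\<delta> * Q))\<^sup>2)" using Q \<delta> by (simp add: ennreal_mult[symmetric] mult.commute)
  finally have T2: "T\<^sup>2 \<le> (ennreal (sqrt (\<delta> * Q)))\<^sup>2" using Q \<delta> by (simp add: ennreal_power)
  have T: "T \<le> ennreal (sqrt (\<delta> * Q))"
  proof (cases T)
    case (real \<tau>)
    then have "\<tau>\<^sup>2 \<le> (sqrt (\<delta> * Q))\<^sup>2"
      using T2 Q \<delta> by (simp add: ennreal_power ennreal_le_iff)
    then have "\<tau> \<le> sqrt (\<delta> * Q)" by (rule power2_le_imp_le) (use Q \<delta> in simp)
    then show ?thesis using real by (simp add: ennreal_leI)
  next
    case top
    then show ?thesis using T2 Q \<delta> by (simp add: ennreal_power top_unique)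
  qed
  have "ennreal (cmod (profile_integral m G t)) \<le> (\<integral>\<^sup>+r. ennreal (cmod (cis (t * r) * (complex_of_real (m r) * G r))) \<partial>lborel)"
    unfolding profile_integral_def by (rule norm_integral_le_nn_integral)
  also have "\<dots> \<le> (\<integral>\<^sup>+r. ennreal B * (ennreal (cmod (G r)) * indicator I r) \<partial>lborel)"
  proof (rule nn_integral_mono)
    fix r
    show "ennreal (cmod (cis (t * r) * (complex_of_real (m r) * G r))) \<le> ennreal B * (ennreal (cmod (G r)) * indicator I r)"
    proof (cases "r \<in> I")
      case True
      then have "\<bar>m r\<bar> * cmod (G r) \<le> B * cmod (G r)"
        using I mB[of r] by (intro mult_right_mono) auto
      then show ?thesis using True B by (simp add: norm_mult ennreal_mult[symmetric] ennreal_leI)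
    qed (simp add: supp)
  qed
  also have "\<dots> = ennreal B * T" unfolding T_def by (rule nn_integral_cmult) measurable
  also have "\<dots> \<le> ennreal B * ennreal (sqrt (\<delta> * Q))" by (intro mult_left_mono T) auto
  also have "\<dots> = ennreal (B * sqrt (\<delta> * Q))" using B Q \<delta> by (simp add: ennreal_mult[symmetric])
  finally show ?thesis using B Q \<delta> by (subst (asm) ennreal_le_iff) auto
qed

section \<open>The kernel at frequencies comparable to one\<close>

abbreviation kernel_mult :: "'a::euclidean_space \<Rightarrow> real \<Rightarrow> real \<Rightarrow> real" where
  "kernel_mult e s r \<equiv> r ^ (DIM('a) - 1) * radial_kernel e (s * r)"

text \<open>The derivative of \<open>kernel_mult\<close> in s; the chain rule supplies the
  additional power of r.\<close>

abbreviation kernel_mult' :: "'a::euclidean_space \<Rightarrow> real \<Rightarrow> real \<Rightarrow> real" where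
  "kernel_mult' e s r \<equiv> r ^ DIM('a) * radial_kernel' e (s * r)"

lemma kernel_mult_decay:
  fixes e :: "'a::euclidean_space"
  assumes e: "e \<in> Basis"
  shows "\<exists>B>0. \<forall>s\<ge>0. \<forall>r\<in>{1/2..2}. \<bar>kernel_mult e s r\<bar> \<le> B * (1 + s) powr (- (real DIM('a) - 1) / 2)
    \<and> \<bar>kernel_mult' e s r\<bar> \<le> B * (1 + s) powr (- (real DIM('a) - 1) / 2)"
proof -
  define a where "a = (real DIM('a) - 1) / 2"
  have a: "0 \<le> a" using DIM_positive[where 'a='a] by (simp add: a_def)
  obtain C where C: "0 < C" "\<And>s. 0 \<le> s \<Longrightarrow> \<bar>radial_kernel e s\<bar> \<le> C * (1 + s) powr (- a)"
      "\<And>s. 0 \<le> s \<Longrightarrow> \<bar>radial_kernel' e s\<bar> \<le> C * (1 + s) powr (- a)"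
    using radial_kernel_decay[OF e] unfolding a_def by (auto simp: minus_divide_left)
  define B where "B = 2 ^ DIM('a) * C * 2 powr a"
  have "\<bar>kernel_mult e s r\<bar> \<le> B * (1 + s) powr (- a) \<and> \<bar>kernel_mult' e s r\<bar> \<le> B * (1 + s) powr (- a)"
    if s: "0 \<le> s" and r: "r \<in> {1/2..2}" for s r
  proof -
    have sr: "0 \<le> s * r" using s r by simp
    \<comment> \<open>As r is at least 1/2, 1 + s r is at least half of 1 + s; this costs the factor
      \<open>2 powr a\<close> in \<open>B\<close>, while the powers of r cost at most
      \<open>2 ^ DIM('a)\<close>.\<close>
    have "s * (1/2) \<le> s * r" using s r by (intro mult_left_mono) auto
    then have "(1 + s * r) powr (- a) \<le> ((1 + s) / 2) powr (- a)"
      using s a by (intro powr_mono2') auto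
    also have "\<dots> = 2 powr a * (1 + s) powr (- a)"
      using s by (simp add: powr_divide powr_minus_divide)
    finally have k: "C * (1 + s * r) powr (- a) \<le> C * 2 powr a * (1 + s) powr (- a)"
      using C(1) by simp
    have p1: "r ^ (DIM('a) - 1) \<le> 2 ^ DIM('a)"
    proof -
      have "r ^ (DIM('a) - 1) \<le> 2 ^ (DIM('a) - 1)" using r by (intro power_mono) auto
      also have "\<dots> \<le> 2 ^ DIM('a)" by (intro power_increasing) auto
      finally show ?thesis .
    qed
    have p2: "r ^ DIM('a) \<le> 2 ^ DIM('a)" using r by (intro power_mono) auto
    have "\<bar>kernel_mult e s r\<bar> \<le> 2 ^ DIM('a) * (C * 2 powr a * (1 + s) powr (- a))"
      unfolding abs_mult using p1 r order_trans[OF C(2)[OF sr] k] C(1) by (intro mult_mono) auto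
    moreover have "\<bar>kernel_mult' e s r\<bar> \<le> 2 ^ DIM('a) * (C * 2 powr a * (1 + s) powr (- a))"
      unfolding abs_mult using p2 r order_trans[OF C(3)[OF sr] k] C(1) by (intro mult_mono) auto
    ultimately show ?thesis by (simp add: B_def mult_ac)
  qed
  moreover have "0 < B" using C(1) by (simp add: B_def)
  ultimately show ?thesis by (intro exI[of _ B]) (simp add: a_def minus_divide_left)
qed

lemma measurable_profile_integral_kernel [measurable]:
  assumes [measurable]: "G \<in> borel_measurable borel" "f \<in> borel_measurable M" "g \<in> borel_measurable M"
  shows "(\<lambda>z. profile_integral (kernel_mult e (g z)) G (f z)) \<in> borel_measurable M"
    "(\<lambda>z. profile_integral (kernel_mult' e (g z)) G (f z)) \<in> borel_measurable M"
  unfolding profile_integral_def by measurable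

text \<open>The fundamental theorem is applied to the kernel for each fixed r, and Fubini exchanges
  the integrals in r and \<tau>. So v is recovered from its s-derivative without differentiating
  under the integral.\<close>

lemma profile_integral_increment:
  fixes e :: "'a::euclidean_space" and G :: "real \<Rightarrow> complex"
  assumes e: "e \<in> Basis" and G: "in_L2 G" and supp: "\<And>r. r \<notin> {1/2..2} \<Longrightarrow> G r = 0"
    and s: "0 \<le> s" "s \<le> y"
  shows "profile_integral (kernel_mult e y) G t - profile_integral (kernel_mult e s) G t
    = (LINT \<tau>|lborel. indicator {s..y} \<tau> *\<^sub>R profile_integral (kernel_mult' e \<tau>) G t)"
proof -
  have [measurable]: "G \<in> borel_measurable borel" using G by (simp add: in_L2_iff)
  define a where "a = (real DIM('a) - 1) / 2"
  have a: "0 \<le> a" using DIM_positive[where 'a='a] by (simp add: a_def)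
  obtain B where B: "0 < B" "\<And>s r. 0 \<le> s \<Longrightarrow> r \<in> {1/2..2} \<Longrightarrow> \<bar>kernel_mult e s r\<bar> \<le> B * (1 + s) powr (- a)"
      "\<And>s r. 0 \<le> s \<Longrightarrow> r \<in> {1/2..2} \<Longrightarrow> \<bar>kernel_mult' e s r\<bar> \<le> B * (1 + s) powr (- a)"
    using kernel_mult_decay[OF e] unfolding a_def by (auto simp: minus_divide_left)
  have B': "\<bar>kernel_mult' e s r\<bar> \<le> B" if "0 \<le> s" "r \<in> {1/2..2}" for s r
  proof -
    have "(1 + s) powr (- a) \<le> (1 + s) powr 0" using that a by (intro powr_mono) auto
    then have "B * (1 + s) powr (- a) \<le> B * 1" using B(1) that by (intro mult_left_mono) auto
    then show ?thesis using B(3)[OF that] by linarith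
  qed
  have int: "integrable lborel (\<lambda>r. cis (t * r) * (complex_of_real (kernel_mult e z r) * G r))" if "0 \<le> z" for z
  proof -
    have "integrable lborel (\<lambda>r. complex_of_real (kernel_mult e z r) * G r)"
      by (rule in_L2_bounded_multiplier(2)[OF G supp _ B(2)[OF that]]) auto
    from integrable_cis_times(1)[OF this, where x=t] show ?thesis by simp
  qed
  have Gi: "integrable lborel G"
    using in_L2_bounded_multiplier(2)[OF G supp, of "\<lambda>_. 1" 1] by simp
  have Ii: "integrable lborel (\<lambda>\<tau>. complex_of_real (indicator {s..y} \<tau>))"
    by (intro integrable_of_real) (simp add: integrable_indicator_iff emeasure_lborel_Icc_eq)
  define h where "h z = indicator {s..y} (fst z) *\<^sub>R (cis (t * snd z) * (complex_of_real (kernel_mult' e (fst z) (snd z)) * G (snd z)))" for z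
  have hi: "integrable (lborel \<Otimes>\<^sub>M lborel) h"
  proof (rule integrable_lborel_pair[OF Ii Gi, where B=B])
    show "h \<in> borel_measurable (lborel \<Otimes>\<^sub>M lborel)" unfolding h_def by measurable
    fix \<tau> r :: real
    show "cmod (h (\<tau>, r)) \<le> B * cmod (complex_of_real (indicator {s..y} \<tau>)) * cmod (G r)"
    proof (cases "\<tau> \<in> {s..y} \<and> r \<in> {1/2..2}")
      case True
      then have "\<bar>kernel_mult' e \<tau> r\<bar> * cmod (G r) \<le> B * cmod (G r)"
        using B'[of \<tau> r] s by (intro mult_right_mono) auto
      then show ?thesis using True by (simp add: h_def norm_mult norm_power abs_mult power_abs)
    qed (auto simp: h_def supp)
  qed
  have FTC: "(LINT \<tau>|lborel. r * radial_kernel' e (\<tau> * r) * indicator {s..y} \<tau>) = radial_kernel e (y * r) - radial_kernel e (s * r)" for r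
  proof (rule integral_FTC_Icc_real[OF s(2)])
    fix x
    show "((\<lambda>\<tau>. radial_kernel e (\<tau> * r)) has_real_derivative r * radial_kernel' e (x * r)) (at x)"
    proof -
      have "((\<lambda>\<tau>. \<tau> * r) has_real_derivative r) (at x)" by (auto intro!: derivative_eq_intros)
      from DERIV_chain2[where f="radial_kernel e" and g="\<lambda>\<tau>. \<tau> * r", OF DERIV_radial_kernel this]
      show ?thesis by (simp add: mult.commute)
    qed
    have "continuous_on UNIV (\<lambda>\<tau>. r * radial_kernel' e (\<tau> * r))"
      by (intro continuous_on_mult_left continuous_on_compose2[OF continuous_radial_kernel(2)[of UNIV]] continuous_on_mult_right continuous_on_id) auto
    then show "isCont (\<lambda>\<tau>. r * radial_kernel' e (\<tau> * r)) x"
      by (simp add: continuous_on_eq_continuous_at)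
  qed
  have inner: "(LINT \<tau>|lborel. h (\<tau>, r)) = cis (t * r) * (complex_of_real (kernel_mult e y r) * G r) - cis (t * r) * (complex_of_real (kernel_mult e s r) * G r)" for r
  proof -
    have pw: "r ^ DIM('a) = r ^ (DIM('a) - 1) * r"
      using DIM_positive[where 'a='a] by (metis power_minus_mult)
    have "(LINT \<tau>|lborel. h (\<tau>, r)) = (LINT \<tau>|lborel. (cis (t * r) * complex_of_real (r ^ (DIM('a) - 1)) * G r) * complex_of_real (r * radial_kernel' e (\<tau> * r) * indicator {s..y} \<tau>))"
      by (intro Bochner_Integration.integral_cong refl) (simp add: h_def pw scaleR_conv_of_real mult_ac)
    also have "\<dots> = (cis (t * r) * complex_of_real (r ^ (DIM('a) - 1)) * G r) * complex_of_real (radial_kernel e (y * r) - radial_kernel e (s * r))"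
      by (simp only: integral_mult_right_zero integral_complex_of_real FTC)
    finally show ?thesis by (simp add: algebra_simps)
  qed
  have "(LINT \<tau>|lborel. indicator {s..y} \<tau> *\<^sub>R profile_integral (kernel_mult' e \<tau>) G t) = (LINT \<tau>|lborel. LINT r|lborel. h (\<tau>, r))"
    by (simp add: profile_integral_def h_def)
  also have "\<dots> = (LINT r|lborel. LINT \<tau>|lborel. h (\<tau>, r))"
    by (rule lborel_pair.Fubini_integral[symmetric]) (use hi in simp)
  also have "\<dots> = profile_integral (kernel_mult e y) G t - profile_integral (kernel_mult e s) G t"
    unfolding inner profile_integral_def
    by (rule Bochner_Integration.integral_diff) (use int s in auto)
  finally show ?thesis by simp
qed

text \<open>Weights in 1 + s vary by a bounded factor over windows of length one, whatever the sign
  of the exponent.\<close>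

lemma powr_shift_le:
  fixes s y w :: real
  assumes "0 \<le> s" "s \<le> y" "y \<le> s + 1"
  shows "(1 + s) powr w \<le> 2 powr \<bar>w\<bar> * (1 + y) powr w"
proof (cases "0 \<le> w")
  case True
  have "1 * (1 + s) powr w \<le> 2 powr \<bar>w\<bar> * (1 + y) powr w"
    using assms True ge_one_powr_ge_zero[of 2 "\<bar>w\<bar>"] by (intro mult_mono powr_mono2) auto
  then show ?thesis by simp
next
  case False
  have "(1 + s) powr w \<le> ((1 + y) / 2) powr w"
    using assms False by (intro powr_mono2') auto
  also have "\<dots> = 2 powr \<bar>w\<bar> * (1 + y) powr w"
    using assms False by (simp add: powr_divide powr_minus_divide)
  finally show ?thesis .
qed

text \<open>A local Sobolev inequality. The value at s differs from the value at y by the integral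
  of the derivative, which Cauchy-Schwarz bounds over a window of length one; then y is averaged
  over the window. The window lies to the right of s, so it stays inside the half-line.\<close>

lemma profile_integral_local_L2:
  fixes e :: "'a::euclidean_space" and G :: "real \<Rightarrow> complex"
  assumes e: "e \<in> Basis" and G: "in_L2 G" and supp: "\<And>r. r \<notin> {1/2..2} \<Longrightarrow> G r = 0"
    and s: "0 \<le> s"
  shows "ennreal ((cmod (profile_integral (kernel_mult e s) G t))\<^sup>2)
    \<le> 2 * (\<integral>\<^sup>+y. indicator {s..s+1} y * (ennreal ((cmod (profile_integral (kernel_mult e y) G t))\<^sup>2)
           + ennreal ((cmod (profile_integral (kernel_mult' e y) G t))\<^sup>2)) \<partial>lborel)"
proof -
  have [measurable]: "G \<in> borel_measurable borel" using G by (simp add: in_L2_iff)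
  define v where "v y = profile_integral (kernel_mult e y) G t" for y
  define w where "w y = profile_integral (kernel_mult' e y) G t" for y
  have [measurable]: "v \<in> borel_measurable borel" "w \<in> borel_measurable borel"
    unfolding v_def w_def by measurable
  define Wi where "Wi = (\<integral>\<^sup>+y. indicator {s..s+1} y * ennreal ((cmod (w y))\<^sup>2) \<partial>lborel)"
  have inc: "ennreal ((cmod (v y - v s))\<^sup>2) \<le> Wi" if y: "y \<in> {s..s+1}" for y
  proof -
    have "v y - v s = (LINT \<tau>|lborel. indicator {s..y} \<tau> *\<^sub>R w \<tau>)"
      unfolding v_def w_def using y by (intro profile_integral_increment[OF e G supp s]) auto
    then have "ennreal (cmod (v y - v s)) \<le> (\<integral>\<^sup>+\<tau>. ennreal (cmod (indicator {s..y} \<tau> *\<^sub>R w \<tau>)) \<partial>lborel)"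
      by (simp only: norm_integral_le_nn_integral)
    also have "\<dots> \<le> (\<integral>\<^sup>+\<tau>. (indicator {s..s+1} \<tau> * ennreal (cmod (w \<tau>))) * indicator {s..s+1} \<tau> \<partial>lborel)"
      by (intro nn_integral_mono) (use y in \<open>auto simp: indicator_def\<close>)
    finally have "(ennreal (cmod (v y - v s)))\<^sup>2 \<le> (\<integral>\<^sup>+\<tau>. (indicator {s..s+1} \<tau> * ennreal (cmod (w \<tau>))) * indicator {s..s+1} \<tau> \<partial>lborel)\<^sup>2"
      by (rule power_mono) simp
    also have "\<dots> \<le> (\<integral>\<^sup>+\<tau>. (indicator {s..s+1} \<tau> * ennreal (cmod (w \<tau>)))\<^sup>2 \<partial>lborel) * (\<integral>\<^sup>+\<tau>. (indicator {s..s+1} \<tau>)\<^sup>2 \<partial>lborel)"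
      by (rule Cauchy_Schwarz_nn_integral) measurable
    also have "(\<integral>\<^sup>+\<tau>. (indicator {s..s+1} \<tau> * ennreal (cmod (w \<tau>)))\<^sup>2 \<partial>lborel) = Wi"
      unfolding Wi_def by (intro nn_integral_cong) (auto simp: indicator_def ennreal_power)
    also have "(\<integral>\<^sup>+\<tau>. (indicator {s..s+1} \<tau> :: ennreal)\<^sup>2 \<partial>lborel) = (\<integral>\<^sup>+\<tau>. indicator {s..s+1} \<tau> \<partial>lborel)"
      by (intro nn_integral_cong) (auto simp: indicator_def)
    also have "\<dots> = 1" by simp
    finally show ?thesis by (simp add: ennreal_power)
  qed
  have pt: "ennreal ((cmod (v s))\<^sup>2) \<le> 2 * ennreal ((cmod (v y))\<^sup>2) + 2 * Wi" if y: "y \<in> {s..s+1}" for y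
  proof -
    have "(cmod (v s))\<^sup>2 \<le> 2 * (cmod (v y))\<^sup>2 + 2 * (cmod (v y - v s))\<^sup>2"
      using cmod_add_square_le[of "v y" "v s - v y"] by (simp add: norm_minus_commute)
    then have "ennreal ((cmod (v s))\<^sup>2) \<le> ennreal (2 * (cmod (v y))\<^sup>2 + 2 * (cmod (v y - v s))\<^sup>2)"
      by (rule ennreal_leI)
    also have "\<dots> = 2 * ennreal ((cmod (v y))\<^sup>2) + 2 * ennreal ((cmod (v y - v s))\<^sup>2)"
      by (simp add: ennreal_plus ennreal_mult)
    also have "\<dots> \<le> 2 * ennreal ((cmod (v y))\<^sup>2) + 2 * Wi"
      by (intro add_left_mono mult_left_mono inc y) simp
    finally show ?thesis .
  qed
  \<comment> \<open>The window has length one, so averaging a constant over it changes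
    nothing.\<close>
  have "ennreal ((cmod (v s))\<^sup>2) = (\<integral>\<^sup>+y. ennreal ((cmod (v s))\<^sup>2) * indicator {s..s+1} y \<partial>lborel)"
    by (subst nn_integral_cmult_indicator) auto
  also have "\<dots> \<le> (\<integral>\<^sup>+y. 2 * (indicator {s..s+1} y * ennreal ((cmod (v y))\<^sup>2)) + (2 * Wi) * indicator {s..s+1} y \<partial>lborel)"
    by (intro nn_integral_mono) (use pt in \<open>auto simp: indicator_def\<close>)
  also have "\<dots> = 2 * (\<integral>\<^sup>+y. indicator {s..s+1} y * ennreal ((cmod (v y))\<^sup>2) \<partial>lborel) + 2 * Wi"
    by (subst nn_integral_add) (auto simp: nn_integral_cmult nn_integral_cmult_indicator)
  also have "\<dots> = 2 * (\<integral>\<^sup>+y. indicator {s..s+1} y * (ennreal ((cmod (v y))\<^sup>2) + ennreal ((cmod (w y))\<^sup>2)) \<partial>lborel)"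
    unfolding Wi_def distrib_left[of "indicator _ _"]
    by (subst nn_integral_add) (auto simp: distrib_left)
  finally show ?thesis unfolding v_def w_def .
qed

lemma nn_integral_one_plus_powr:
  fixes b :: real
  assumes b: "b < - 1"
  shows "(\<integral>\<^sup>+y. ennreal ((1 + y) powr b) * indicator {0..} y \<partial>lborel) = ennreal (- 1 / (b + 1))"
proof -
  have "(\<integral>\<^sup>+y. ennreal ((1 + y) powr b) * indicator {0..} y \<partial>lborel) = ennreal (0 - (1 + 0) powr (b + 1) / (b + 1))"
  proof (rule nn_integral_FTC_atLeast)
    show "((\<lambda>y. (1 + y) powr (b + 1) / (b + 1)) has_real_derivative (1 + y) powr b) (at y)" if "0 \<le> y" for y
      using that b by (auto intro!: derivative_eq_intros)
    have "((\<lambda>y. (1 + y) powr (b + 1)) \<longlongrightarrow> 0) at_top"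
      by (rule tendsto_neg_powr) (use b in \<open>auto intro!: filterlim_tendsto_add_at_top filterlim_ident\<close>)
    then show "((\<lambda>y. (1 + y) powr (b + 1) / (b + 1)) \<longlongrightarrow> 0) at_top"
      by (rule tendsto_divide_zero)
  qed auto
  then show ?thesis by simp
qed


text \<open>The data of the theorem in polar form: \<open>G\<close> is the profile of the Fourier transform and \<open>M\<close>
  bounds its \<open>L\<^sup>2\<close> norm; the vector \<open>e\<close> only carries the type of the ambient space.\<close>

definition band_profile :: "'a::euclidean_space \<Rightarrow> real \<Rightarrow> real \<Rightarrow> (real \<Rightarrow> complex) \<Rightarrow> bool" where
  "band_profile e \<delta> M G \<longleftrightarrow> G \<in> borel_measurable borel \<and> 0 < \<delta> \<and> \<delta> \<le> 1 \<and> 0 < M \<and>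
     (\<exists>I. I \<in> sets borel \<and> I \<subseteq> {1/2..2} \<and> measure lborel I \<le> \<delta> \<and> (\<forall>r. r \<notin> I \<longrightarrow> G r = 0)) \<and>
     sqint (\<lambda>\<xi>::'a. G (norm \<xi>)) \<le> ennreal (M\<^sup>2)"

definition wave_profile :: "'a::euclidean_space \<Rightarrow> (real \<Rightarrow> complex) \<Rightarrow> real \<Rightarrow> real \<Rightarrow> complex" where
  "wave_profile e G t s = complex_of_real ((2 * pi) powr (- real DIM('a) / 2)) * profile_integral (kernel_mult e s) G t"

lemma band_profileD:
  fixes e :: "'a::euclidean_space"
  assumes "band_profile e \<delta> M G"
  shows "G \<in> borel_measurable borel" "0 < \<delta>" "\<delta> \<le> 1" "0 < M" "r \<notin> {1/2..2} \<Longrightarrow> G r = 0"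
    "sqint (\<lambda>\<xi>. G (norm (\<xi>::'a))) \<le> ennreal (M\<^sup>2)"
  using assms unfolding band_profile_def by auto

lemma measurable_wave_profile [measurable]:
  assumes [measurable]: "G \<in> borel_measurable borel" "f \<in> borel_measurable M" "g \<in> borel_measurable M"
  shows "(\<lambda>z. wave_profile e G (f z) (g z)) \<in> borel_measurable M"
  unfolding wave_profile_def by measurable

text \<open>On [1/2, 2] the radial density is bounded below, so the norm of the profile on the line
  is controlled by the norm in space.\<close>

lemma band_profile_sqint:
  fixes e :: "'a::euclidean_space"
  assumes e: "e \<in> Basis"
  shows "\<exists>C>0. \<forall>\<delta> M G. band_profile e \<delta> M G \<longrightarrow> sqint G \<le> ennreal (C * M\<^sup>2)"
proof -
  define c where "c = (1/2) ^ (DIM('a) - 1) * sphere_mass e"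
  have c: "0 < c" using sphere_mass_pos[of e] by (simp add: c_def)
  have "sqint G \<le> ennreal ((1 / c) * M\<^sup>2)" if b: "band_profile e \<delta> M G" for \<delta> M G
  proof -
    note band_profileD(1)[OF b, measurable]
    have "ennreal c * sqint G = (\<integral>\<^sup>+r. ennreal c * ennreal ((cmod (G r))\<^sup>2) \<partial>lborel)"
      unfolding sqint_def by (rule nn_integral_cmult[symmetric]) measurable
    also have "\<dots> \<le> (\<integral>\<^sup>+r. ennreal (indicator {0..} r * r ^ (DIM('a) - 1) * sphere_mass e) * ennreal ((cmod (G r))\<^sup>2) \<partial>lborel)"
    proof (rule nn_integral_mono)
      fix r
      show "ennreal c * ennreal ((cmod (G r))\<^sup>2) \<le> ennreal (indicator {0..} r * r ^ (DIM('a) - 1) * sphere_mass e) * ennreal ((cmod (G r))\<^sup>2)"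
      proof (cases "r \<in> {1/2..2}")
        case True
        have "c \<le> indicator {0..} r * r ^ (DIM('a) - 1) * sphere_mass e"
          using True sphere_mass_pos[of e] power_mono[of "1/2" r "DIM('a) - 1"]
          by (auto simp: c_def indicator_def intro!: mult_right_mono)
        then show ?thesis by (intro mult_right_mono ennreal_leI) auto
      next
        case False
        then show ?thesis by (simp add: band_profileD(5)[OF b])
      qed
    qed
    also have "\<dots> = sqint (\<lambda>\<xi>. G (norm (\<xi>::'a)))"
      unfolding sqint_def by (rule nn_integral_norm[symmetric, where h="\<lambda>r. ennreal ((cmod (G r))\<^sup>2)"]) (use e in auto)
    also have "\<dots> \<le> ennreal (M\<^sup>2)" by (rule band_profileD(6)[OF b])
    finally have "ennreal c * sqint G \<le> ennreal (M\<^sup>2)" .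
    then have "ennreal (1 / c) * (ennreal c * sqint G) \<le> ennreal (1 / c) * ennreal (M\<^sup>2)"
      by (rule mult_left_mono) simp
    then show ?thesis using c by (simp add: mult.assoc[symmetric] ennreal_mult[symmetric])
  qed
  then show ?thesis using c by (intro exI[of _ "1 / c"]) auto
qed

lemma band_profile_in_L2:
  fixes e :: "'a::euclidean_space"
  assumes e: "e \<in> Basis" and b: "band_profile e \<delta> M G"
  shows "in_L2 G"
proof -
  obtain C where "sqint G \<le> ennreal (C * M\<^sup>2)" using band_profile_sqint[OF e] b by blast
  also have "\<dots> < \<infinity>" by simp
  finally show ?thesis using band_profileD(1)[OF b] by (simp add: in_L2_iff)
qed

text \<open>The link between space and profile: evaluation at - x makes the transform an inverse
  one, and the plane wave formula reduces it to an integral over r. The band excludes negative r, so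
  the cut-off at 0 disappears.\<close>

lemma fourier_integral_band_profile:
  fixes e x :: "'a::euclidean_space"
  assumes e: "e \<in> Basis" and b: "band_profile e \<delta> M G"
  shows "fourier_integral (\<lambda>\<xi>. cis (t * norm \<xi>) * G (norm \<xi>)) (- x) = wave_profile e G t (norm x)"
    and "integrable lborel (\<lambda>\<xi>::'a. cis (t * norm \<xi>) * G (norm \<xi>))"
proof -
  note [measurable] = band_profileD(1)[OF b]
  have L2: "in_L2 (\<lambda>\<xi>::'a. cis (t * norm \<xi>) * G (norm \<xi>))"
  proof -
    have "sqint (\<lambda>\<xi>::'a. cis (t * norm \<xi>) * G (norm \<xi>)) = sqint (\<lambda>\<xi>::'a. G (norm \<xi>))"
      by (simp add: sqint_def norm_mult)
    also have "\<dots> \<le> ennreal (M\<^sup>2)" by (rule band_profileD(6)[OF b])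
    also have "\<dots> < \<infinity>" by simp
    finally show ?thesis by (simp add: in_L2_iff)
  qed
  show i: "integrable lborel (\<lambda>\<xi>::'a. cis (t * norm \<xi>) * G (norm \<xi>))"
  proof (rule in_L2_bounded_support_integrable[OF L2, where R=2])
    fix \<xi> :: 'a assume "2 < norm \<xi>"
    then have "G (norm \<xi>) = 0" by (intro band_profileD(5)[OF b]) auto
    then show "cis (t * norm \<xi>) * G (norm \<xi>) = 0" by simp
  qed
  have "(LINT \<xi>|lborel. cis (x \<bullet> \<xi>) * (cis (t * norm \<xi>) * G (norm \<xi>)))
    = (LINT r|lborel. complex_of_real (indicator {0..} r * r ^ (DIM('a) - 1) * radial_kernel e (norm x * r)) * (cis (t * r) * G r))"
    by (rule integral_cis_norm[where H="\<lambda>r. cis (t * r) * G r"]) (use e i in auto)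
  also have "\<dots> = profile_integral (kernel_mult e (norm x)) G t"
    unfolding profile_integral_def
  proof (rule Bochner_Integration.integral_cong[OF refl])
    fix r
    show "complex_of_real (indicator {0..} r * r ^ (DIM('a) - 1) * radial_kernel e (norm x * r)) * (cis (t * r) * G r)
      = cis (t * r) * (complex_of_real (kernel_mult e (norm x) r) * G r)"
    proof (cases "r \<in> {1/2..2}")
      case True
      then show ?thesis by (simp add: indicator_def mult_ac)
    qed (simp add: band_profileD(5)[OF b])
  qed
  finally show "fourier_integral (\<lambda>\<xi>. cis (t * norm \<xi>) * G (norm \<xi>)) (- x) = wave_profile e G t (norm x)"
    by (simp add: fourier_integral_def wave_profile_def inner_commute)
qed

text \<open>Plancherel in space; the phase has modulus 1, so the bound is uniform in t.\<close>

lemma wave_profile_energy: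
  fixes e :: "'a::euclidean_space"
  assumes e: "e \<in> Basis" and b: "band_profile e \<delta> M G"
  shows "(\<integral>\<^sup>+x. ennreal ((cmod (wave_profile e G t (norm (x::'a))))\<^sup>2) \<partial>lborel) \<le> ennreal (M\<^sup>2)"
proof -
  note [measurable] = band_profileD(1)[OF b]
  define h where "h \<xi> = cis (t * norm \<xi>) * G (norm \<xi>)" for \<xi> :: 'a
  have hm[measurable]: "h \<in> borel_measurable borel" unfolding h_def by measurable
  note [measurable] = measurable_fourier_integral[OF hm]
  have T: "orthogonal_transformation (uminus :: 'a \<Rightarrow> 'a)"
    by (simp add: orthogonal_transformation_neg)
  have "(\<integral>\<^sup>+x. ennreal ((cmod (wave_profile e G t (norm (x::'a))))\<^sup>2) \<partial>lborel) = (\<integral>\<^sup>+x. ennreal ((cmod (fourier_integral h (- x)))\<^sup>2) \<partial>lborel)"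
    unfolding h_def fourier_integral_band_profile(1)[OF e b] ..
  also have "\<dots> = sqint (fourier_integral h)"
    unfolding sqint_def by (rule nn_integral_orthogonal_transformation[OF T]) measurable
  also have "\<dots> \<le> sqint h"
    using fourier_integral_band_profile(2)[OF e b] unfolding h_def by (rule sqint_fourier_integral_le)
  also have "\<dots> = sqint (\<lambda>\<xi>::'a. G (norm \<xi>))"
    by (simp add: h_def sqint_def norm_mult)
  also have "\<dots> \<le> ennreal (M\<^sup>2)" by (rule band_profileD(6)[OF b])
  finally show ?thesis .
qed

lemma wave_profile_le:
  fixes e :: "'a::euclidean_space"
  assumes e: "e \<in> Basis"
  shows "\<exists>C>0. \<forall>\<delta> M G. band_profile e \<delta> M G \<longrightarrow>
    (\<forall>t. \<forall>s\<ge>0. cmod (wave_profile e G t s) \<le> C * sqrt \<delta> * M * (1 + s) powr (- (real DIM('a) - 1) / 2))"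
proof -
  obtain B where B: "0 < B" "\<And>s r. 0 \<le> s \<Longrightarrow> r \<in> {1/2..2} \<Longrightarrow> \<bar>kernel_mult e s r\<bar> \<le> B * (1 + s) powr (- (real DIM('a) - 1) / 2)"
    using kernel_mult_decay[OF e] by blast
  obtain K where K: "0 < K" "\<And>\<delta> M G. band_profile e \<delta> M G \<Longrightarrow> sqint G \<le> ennreal (K * M\<^sup>2)"
    using band_profile_sqint[OF e] by blast
  define c where "c = (2 * pi) powr (- real DIM('a) / 2)"
  have c: "0 < c" by (simp add: c_def)
  have "cmod (wave_profile e G t s) \<le> (c * B * sqrt K) * sqrt \<delta> * M * (1 + s) powr (- (real DIM('a) - 1) / 2)"
    if b: "band_profile e \<delta> M G" and s: "0 \<le> s" for \<delta> M G t s
  proof -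
    obtain I where I: "I \<in> sets borel" "I \<subseteq> {1/2..2}" "measure lborel I \<le> \<delta>" "\<And>r. r \<notin> I \<Longrightarrow> G r = 0"
      using b unfolding band_profile_def by auto
    have "cmod (profile_integral (kernel_mult e s) G t) \<le> B * (1 + s) powr (- (real DIM('a) - 1) / 2) * sqrt (\<delta> * (K * M\<^sup>2))"
      by (rule profile_integral_le[OF band_profileD(1)[OF b] K(2)[OF b] _ I(1-4) B(2)[OF s]]) (use K(1) in auto)
    also have "sqrt (\<delta> * (K * M\<^sup>2)) = sqrt \<delta> * sqrt K * M"
      using band_profileD(4)[OF b] by (simp add: real_sqrt_mult)
    finally have "c * cmod (profile_integral (kernel_mult e s) G t) \<le> c * (B * (1 + s) powr (- (real DIM('a) - 1) / 2) * (sqrt \<delta> * sqrt K * M))"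
      using c by (intro mult_left_mono) auto
    then show ?thesis by (simp add: wave_profile_def norm_mult c_def mult_ac)
  qed
  moreover have "0 < c * B * sqrt K" using c B(1) K(1) by simp
  ultimately show ?thesis by blast
qed

text \<open>Kernel and derivative obey the same decay, so one argument for a general multiplier
  serves both; the decay rate enters squared, which gives the exponent 1 - d.\<close>

lemma kernel_profile_square_integral:
  fixes e :: "'a::euclidean_space"
  assumes e: "e \<in> Basis"
  shows "\<exists>C>0. \<forall>\<delta> M G. band_profile e \<delta> M G \<longrightarrow> (\<forall>s\<ge>0.
    (\<integral>\<^sup>+t. ennreal ((cmod (profile_integral (kernel_mult e s) G t))\<^sup>2) \<partial>lborel) \<le> ennreal (C * M\<^sup>2 * (1 + s) powr (1 - real DIM('a))) \<and>
    (\<integral>\<^sup>+t. ennreal ((cmod (profile_integral (kernel_mult' e s) G t))\<^sup>2) \<partial>lborel) \<le> ennreal (C * M\<^sup>2 * (1 + s) powr (1 - real DIM('a))))"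
proof -
  define a where "a = (real DIM('a) - 1) / 2"
  obtain B where B: "0 < B" "\<And>s r. 0 \<le> s \<Longrightarrow> r \<in> {1/2..2} \<Longrightarrow> \<bar>kernel_mult e s r\<bar> \<le> B * (1 + s) powr (- a)"
    "\<And>s r. 0 \<le> s \<Longrightarrow> r \<in> {1/2..2} \<Longrightarrow> \<bar>kernel_mult' e s r\<bar> \<le> B * (1 + s) powr (- a)"
    using kernel_mult_decay[OF e] unfolding a_def by (auto simp: minus_divide_left)
  obtain K where K: "0 < K" "\<And>\<delta> M G. band_profile e \<delta> M G \<Longrightarrow> sqint G \<le> ennreal (K * M\<^sup>2)"
    using band_profile_sqint[OF e] by blast
  have "(\<integral>\<^sup>+t. ennreal ((cmod (profile_integral m G t))\<^sup>2) \<partial>lborel) \<le> ennreal (2 * pi * B\<^sup>2 * K * M\<^sup>2 * (1 + s) powr (1 - real DIM('a)))"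
    if b: "band_profile e \<delta> M G" and s: "0 \<le> s" and m: "m \<in> borel_measurable borel"
      "\<And>r. r \<in> {1/2..2} \<Longrightarrow> \<bar>m r\<bar> \<le> B * (1 + s) powr (- a)" for \<delta> M G s m
  proof -
    have "(\<integral>\<^sup>+t. ennreal ((cmod (profile_integral m G t))\<^sup>2) \<partial>lborel) \<le> ennreal (2 * pi * (B * (1 + s) powr (- a))\<^sup>2) * sqint G"
      by (rule profile_integral_square_integral[OF band_profile_in_L2[OF e b] band_profileD(5)[OF b] m])
    also have "\<dots> \<le> ennreal (2 * pi * (B * (1 + s) powr (- a))\<^sup>2) * ennreal (K * M\<^sup>2)"
      by (intro mult_left_mono K(2)[OF b]) auto
    also have "((1 + s) powr (- a))\<^sup>2 = (1 + s) powr (1 - real DIM('a))"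
      by (simp add: power2_eq_square powr_add[symmetric] a_def)
    then have "ennreal (2 * pi * (B * (1 + s) powr (- a))\<^sup>2) * ennreal (K * M\<^sup>2) = ennreal (2 * pi * B\<^sup>2 * K * M\<^sup>2 * (1 + s) powr (1 - real DIM('a)))"
      using K(1) by (subst ennreal_mult[symmetric]) (auto simp: power_mult_distrib mult_ac)
    finally show ?thesis .
  qed
  then have "band_profile e \<delta> M G \<Longrightarrow> 0 \<le> s \<Longrightarrow>
    (\<integral>\<^sup>+t. ennreal ((cmod (profile_integral (kernel_mult e s) G t))\<^sup>2) \<partial>lborel) \<le> ennreal (2 * pi * B\<^sup>2 * K * M\<^sup>2 * (1 + s) powr (1 - real DIM('a))) \<and>
    (\<integral>\<^sup>+t. ennreal ((cmod (profile_integral (kernel_mult' e s) G t))\<^sup>2) \<partial>lborel) \<le> ennreal (2 * pi * B\<^sup>2 * K * M\<^sup>2 * (1 + s) powr (1 - real DIM('a)))" for \<delta> M G s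
    using B(2,3)[of s] by simp
  moreover have "0 < 2 * pi * B\<^sup>2 * K" using B(1) K(1) by simp
  ultimately show ?thesis by blast
qed

text \<open>A measurable majorant \<open>Z\<close> stands in for the supremum over s, which avoids
  the measurability of an uncountable supremum. It is a weighted integral over all of s, obtained by
  enlarging the Sobolev window to the half-line.\<close>

lemma wave_profile_maximal:
  fixes e :: "'a::euclidean_space" and w :: real
  assumes e: "e \<in> Basis" and w: "w < real DIM('a) - 2"
  shows "\<exists>C>0. \<forall>\<delta> M G. band_profile e \<delta> M G \<longrightarrow> (\<exists>Z. Z \<in> borel_measurable borel \<and>
    (\<forall>t. \<forall>s\<ge>0. ennreal ((1 + s) powr w * (cmod (wave_profile e G t s))\<^sup>2) \<le> Z t) \<and>
    (\<integral>\<^sup>+t. Z t \<partial>lborel) \<le> ennreal (C * M\<^sup>2))"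
proof -
  obtain K where K: "0 < K" "\<And>\<delta> M G s. band_profile e \<delta> M G \<Longrightarrow> 0 \<le> s \<Longrightarrow>
    (\<integral>\<^sup>+t. ennreal ((cmod (profile_integral (kernel_mult e s) G t))\<^sup>2) \<partial>lborel) \<le> ennreal (K * M\<^sup>2 * (1 + s) powr (1 - real DIM('a))) \<and>
    (\<integral>\<^sup>+t. ennreal ((cmod (profile_integral (kernel_mult' e s) G t))\<^sup>2) \<partial>lborel) \<le> ennreal (K * M\<^sup>2 * (1 + s) powr (1 - real DIM('a)))"
    using kernel_profile_square_integral[OF e] by blast
  \<comment> \<open>The weight combined with the decay of Plancherel in t; the hypothesis on w says
    precisely that this power is integrable at infinity.\<close>
  define b where "b = w + (1 - real DIM('a))"
  have b: "b < - 1" using w by (simp add: b_def)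
  \<comment> \<open>The squared normalisation of the transform, the cost of moving the weight from s
    to y within a window, and the 2 of the local Sobolev inequality.\<close>
  define c where "c = ((2 * pi) powr (- real DIM('a) / 2))\<^sup>2 * 2 powr \<bar>w\<bar> * 2"
  have c: "0 < c" by (simp add: c_def)
  have "\<exists>Z. Z \<in> borel_measurable borel \<and>
    (\<forall>t. \<forall>s\<ge>0. ennreal ((1 + s) powr w * (cmod (wave_profile e G t s))\<^sup>2) \<le> Z t) \<and>
    (\<integral>\<^sup>+t. Z t \<partial>lborel) \<le> ennreal (c * (2 * K * (- 1 / (b + 1))) * M\<^sup>2)"
    if bp: "band_profile e \<delta> M G" for \<delta> M G
  proof -
    note [measurable] = band_profileD(1)[OF bp]
    define v1 where "v1 y t = ennreal ((cmod (profile_integral (kernel_mult e y) G t))\<^sup>2)" for y t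
    define v2 where "v2 y t = ennreal ((cmod (profile_integral (kernel_mult' e y) G t))\<^sup>2)" for y t
    have [measurable]: "(\<lambda>z. v1 (f z) (g z)) \<in> borel_measurable N" "(\<lambda>z. v2 (f z) (g z)) \<in> borel_measurable N"
      if [measurable]: "f \<in> borel_measurable N" "g \<in> borel_measurable N" for f g and N :: "'z measure"
      unfolding v1_def v2_def by measurable
    define Z where "Z t = ennreal c * (\<integral>\<^sup>+y. indicator {0..} y * ennreal ((1 + y) powr w) * (v1 y t + v2 y t) \<partial>lborel)" for t
    have [measurable]: "(\<lambda>z. v1 (fst z) (snd z)) \<in> borel_measurable (borel \<Otimes>\<^sub>M borel)" "(\<lambda>z. v2 (fst z) (snd z)) \<in> borel_measurable (borel \<Otimes>\<^sub>M borel)"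
      "(\<lambda>z. v1 (snd z) (fst z)) \<in> borel_measurable (borel \<Otimes>\<^sub>M borel)" "(\<lambda>z. v2 (snd z) (fst z)) \<in> borel_measurable (borel \<Otimes>\<^sub>M borel)"
      "\<And>y. v1 y \<in> borel_measurable borel" "\<And>y. v2 y \<in> borel_measurable borel"
      "\<And>t. (\<lambda>y. v1 y t) \<in> borel_measurable borel" "\<And>t. (\<lambda>y. v2 y t) \<in> borel_measurable borel"
      unfolding v1_def v2_def by measurable
    have Zm: "Z \<in> borel_measurable borel" unfolding Z_def by measurable
    have pw: "ennreal ((1 + s) powr w * (cmod (wave_profile e G t s))\<^sup>2) \<le> Z t" if s: "0 \<le> s" for s t
    proof -
      have "ennreal ((1 + s) powr w * (cmod (wave_profile e G t s))\<^sup>2)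
        = ennreal (((2 * pi) powr (- real DIM('a) / 2))\<^sup>2) * (ennreal ((1 + s) powr w) * v1 s t)"
        by (simp add: wave_profile_def v1_def norm_mult power_mult_distrib ennreal_mult[symmetric] mult_ac)
      also have "ennreal ((1 + s) powr w) * v1 s t \<le> ennreal ((1 + s) powr w) * (2 * (\<integral>\<^sup>+y. indicator {s..s+1} y * (v1 y t + v2 y t) \<partial>lborel))"
        unfolding v1_def v2_def
        by (intro mult_left_mono profile_integral_local_L2[OF e band_profile_in_L2[OF e bp] band_profileD(5)[OF bp] s]) auto
      also have "\<dots> = 2 * (\<integral>\<^sup>+y. ennreal ((1 + s) powr w) * (indicator {s..s+1} y * (v1 y t + v2 y t)) \<partial>lborel)"
        by (simp add: nn_integral_cmult mult.left_commute)
      also have "\<dots> \<le> 2 * (\<integral>\<^sup>+y. ennreal (2 powr \<bar>w\<bar>) * (indicator {0..} y * ennreal ((1 + y) powr w) * (v1 y t + v2 y t)) \<partial>lborel)"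
      proof (intro mult_left_mono nn_integral_mono)
        fix y
        show "ennreal ((1 + s) powr w) * (indicator {s..s+1} y * (v1 y t + v2 y t))
          \<le> ennreal (2 powr \<bar>w\<bar>) * (indicator {0..} y * ennreal ((1 + y) powr w) * (v1 y t + v2 y t))"
        proof (cases "y \<in> {s..s+1}")
          case True
          have "ennreal ((1 + s) powr w) \<le> ennreal (2 powr \<bar>w\<bar> * (1 + y) powr w)"
            using True s by (intro ennreal_leI powr_shift_le) auto
          then have "ennreal ((1 + s) powr w) * (v1 y t + v2 y t) \<le> ennreal (2 powr \<bar>w\<bar> * (1 + y) powr w) * (v1 y t + v2 y t)"
            by (rule mult_right_mono) simp
          then show ?thesis using True s by (simp add: ennreal_mult mult_ac)
        qed simp
      qed simp
      also have "\<dots> = 2 * (ennreal (2 powr \<bar>w\<bar>) * (\<integral>\<^sup>+y. indicator {0..} y * ennreal ((1 + y) powr w) * (v1 y t + v2 y t) \<partial>lborel))"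
        by (subst nn_integral_cmult) auto
      finally have "ennreal ((1 + s) powr w * (cmod (wave_profile e G t s))\<^sup>2)
        \<le> ennreal (((2 * pi) powr (- real DIM('a) / 2))\<^sup>2) * (2 * (ennreal (2 powr \<bar>w\<bar>) * (\<integral>\<^sup>+y. indicator {0..} y * ennreal ((1 + y) powr w) * (v1 y t + v2 y t) \<partial>lborel)))"
        by (simp add: mult_left_mono)
      then show ?thesis by (simp add: Z_def c_def ennreal_mult mult_ac)
    qed
    have Z_int: "(\<integral>\<^sup>+t. Z t \<partial>lborel) = ennreal c * (\<integral>\<^sup>+t. \<integral>\<^sup>+y. indicator {0..} y * ennreal ((1 + y) powr w) * (v1 y t + v2 y t) \<partial>lborel \<partial>lborel)"
      unfolding Z_def by (rule nn_integral_cmult) measurable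
    have "(\<integral>\<^sup>+t. \<integral>\<^sup>+y. indicator {0..} y * ennreal ((1 + y) powr w) * (v1 y t + v2 y t) \<partial>lborel \<partial>lborel)
       = (\<integral>\<^sup>+y. \<integral>\<^sup>+t. indicator {0..} y * ennreal ((1 + y) powr w) * (v1 y t + v2 y t) \<partial>lborel \<partial>lborel)"
      by (rule lborel_pair.Fubini') measurable
    also have "\<dots> \<le> (\<integral>\<^sup>+y. ennreal (2 * K * M\<^sup>2) * (ennreal ((1 + y) powr b) * indicator {0..} y) \<partial>lborel)"
    proof (rule nn_integral_mono)
      fix y
      show "(\<integral>\<^sup>+t. indicator {0..} y * ennreal ((1 + y) powr w) * (v1 y t + v2 y t) \<partial>lborel) \<le> ennreal (2 * K * M\<^sup>2) * (ennreal ((1 + y) powr b) * indicator {0..} y)"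
      proof (cases "0 \<le> y")
        case True
        have "(\<integral>\<^sup>+t. indicator {0..} y * ennreal ((1 + y) powr w) * (v1 y t + v2 y t) \<partial>lborel)
          = ennreal ((1 + y) powr w) * ((\<integral>\<^sup>+t. v1 y t \<partial>lborel) + (\<integral>\<^sup>+t. v2 y t \<partial>lborel))"
          using True by (simp add: nn_integral_cmult nn_integral_add)
        also have "\<dots> \<le> ennreal ((1 + y) powr w) * (ennreal (K * M\<^sup>2 * (1 + y) powr (1 - real DIM('a))) + ennreal (K * M\<^sup>2 * (1 + y) powr (1 - real DIM('a))))"
          using K(2)[OF bp True] unfolding v1_def v2_def by (intro mult_left_mono add_mono) auto
        also have "\<dots> = ennreal ((2 * K * M\<^sup>2) * (1 + y) powr b)"
          using K(1) True by (simp add: ennreal_plus[symmetric] ennreal_mult[symmetric] b_def powr_add mult_ac del: ennreal_plus)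
        finally show ?thesis using True K(1) by (simp add: ennreal_mult)
      qed simp
    qed
    also have "\<dots> = ennreal (2 * K * M\<^sup>2) * ennreal (- 1 / (b + 1))"
      by (subst nn_integral_cmult) (auto simp: nn_integral_one_plus_powr[OF b])
    finally have "(\<integral>\<^sup>+t. Z t \<partial>lborel) \<le> ennreal c * (ennreal (2 * K * M\<^sup>2) * ennreal (- 1 / (b + 1)))"
      unfolding Z_int by (rule mult_left_mono) simp
    also have "\<dots> = ennreal (c * (2 * K * (- 1 / (b + 1))) * M\<^sup>2)"
    proof -
      have "0 \<le> - 1 / (b + 1)" using b by (intro divide_nonpos_neg) auto
      then show ?thesis using c K(1) by (simp only: ennreal_mult[symmetric] mult_nonneg_nonneg less_imp_le zero_le_power2 zero_le_numeral) (simp add: mult_ac)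
    qed
    finally have "(\<integral>\<^sup>+t. Z t \<partial>lborel) \<le> ennreal (c * (2 * K * (- 1 / (b + 1))) * M\<^sup>2)" .
    then show ?thesis using Zm pw by blast
  qed
  moreover have "0 < c * (2 * K * (- 1 / (b + 1)))"
    using c K(1) b by (intro mult_pos_pos divide_neg_neg) auto
  ultimately show ?thesis by blast
qed

text \<open>After exchanging t and x, Plancherel in t leaves the decay
  \<open>(1 + r) powr (1 - d)\<close>, with d the dimension, which cancels the growth of spheres.
  What remains is the integral of the weight over a half-line, hence the threshold -1 in every
  dimension.\<close>

lemma wave_profile_weighted:
  fixes e :: "'a::euclidean_space" and w :: real
  assumes e: "e \<in> Basis" and w: "w < - 1"
  shows "\<exists>C>0. \<forall>\<delta> M G. band_profile e \<delta> M G \<longrightarrow>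
    (\<integral>\<^sup>+t. \<integral>\<^sup>+x. ennreal ((1 + norm (x::'a)) powr w * (cmod (wave_profile e G t (norm x)))\<^sup>2) \<partial>lborel \<partial>lborel) \<le> ennreal (C * M\<^sup>2)"
proof -
  obtain K where K: "0 < K" "\<And>\<delta> M G s. band_profile e \<delta> M G \<Longrightarrow> 0 \<le> s \<Longrightarrow>
    (\<integral>\<^sup>+t. ennreal ((cmod (profile_integral (kernel_mult e s) G t))\<^sup>2) \<partial>lborel) \<le> ennreal (K * M\<^sup>2 * (1 + s) powr (1 - real DIM('a)))"
    using kernel_profile_square_integral[OF e] by blast
  define c where "c = ((2 * pi) powr (- real DIM('a) / 2))\<^sup>2"
  have c: "0 < c" by (simp add: c_def)
  have "(\<integral>\<^sup>+t. \<integral>\<^sup>+x. ennreal ((1 + norm (x::'a)) powr w * (cmod (wave_profile e G t (norm x)))\<^sup>2) \<partial>lborel \<partial>lborel)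
     \<le> ennreal (c * K * sphere_mass e * (- 1 / (w + 1)) * M\<^sup>2)" if bp: "band_profile e \<delta> M G" for \<delta> M G
  proof -
    note [measurable] = band_profileD(1)[OF bp]
    define h where "h y = ennreal (c * K * M\<^sup>2) * ennreal ((1 + y) powr (w + (1 - real DIM('a))))" for y
    have [measurable]: "h \<in> borel_measurable borel" unfolding h_def by measurable
    have "(\<integral>\<^sup>+t. \<integral>\<^sup>+x. ennreal ((1 + norm (x::'a)) powr w * (cmod (wave_profile e G t (norm x)))\<^sup>2) \<partial>lborel \<partial>lborel)
      = (\<integral>\<^sup>+x. \<integral>\<^sup>+t. ennreal ((1 + norm (x::'a)) powr w * (cmod (wave_profile e G t (norm x)))\<^sup>2) \<partial>lborel \<partial>lborel)"
      by (rule lborel_pair.Fubini') measurable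
    also have "\<dots> \<le> (\<integral>\<^sup>+x. h (norm (x::'a)) \<partial>lborel)"
    proof (rule nn_integral_mono)
      fix x :: 'a
      have "(\<integral>\<^sup>+t. ennreal ((1 + norm x) powr w * (cmod (wave_profile e G t (norm x)))\<^sup>2) \<partial>lborel)
        = ennreal (c * (1 + norm x) powr w) * (\<integral>\<^sup>+t. ennreal ((cmod (profile_integral (kernel_mult e (norm x)) G t))\<^sup>2) \<partial>lborel)"
      proof -
        have "(\<integral>\<^sup>+t. ennreal ((1 + norm x) powr w * (cmod (wave_profile e G t (norm x)))\<^sup>2) \<partial>lborel)
          = (\<integral>\<^sup>+t. ennreal (c * (1 + norm x) powr w) * ennreal ((cmod (profile_integral (kernel_mult e (norm x)) G t))\<^sup>2) \<partial>lborel)"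
          by (intro nn_integral_cong)
            (simp add: wave_profile_def c_def norm_mult power_mult_distrib ennreal_mult[symmetric] mult_ac)
        also have "\<dots> = ennreal (c * (1 + norm x) powr w) * (\<integral>\<^sup>+t. ennreal ((cmod (profile_integral (kernel_mult e (norm x)) G t))\<^sup>2) \<partial>lborel)"
          by (rule nn_integral_cmult) measurable
        finally show ?thesis .
      qed
      also have "\<dots> \<le> ennreal (c * (1 + norm x) powr w) * ennreal (K * M\<^sup>2 * (1 + norm x) powr (1 - real DIM('a)))"
        by (intro mult_left_mono K(2)[OF bp]) auto
      also have "\<dots> = h (norm x)"
        using c K(1) by (simp add: h_def ennreal_mult[symmetric] powr_add mult_ac)
      finally show "(\<integral>\<^sup>+t. ennreal ((1 + norm x) powr w * (cmod (wave_profile e G t (norm x)))\<^sup>2) \<partial>lborel) \<le> h (norm x)" .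
    qed
    also have "\<dots> = (\<integral>\<^sup>+r. ennreal (indicator {0..} r * r ^ (DIM('a) - 1) * sphere_mass e) * h r \<partial>lborel)"
      by (rule nn_integral_norm) (use e in auto)
    also have "\<dots> \<le> (\<integral>\<^sup>+r. ennreal (c * K * M\<^sup>2 * sphere_mass e) * (ennreal ((1 + r) powr w) * indicator {0..} r) \<partial>lborel)"
    proof (rule nn_integral_mono)
      fix r :: real
      show "ennreal (indicator {0..} r * r ^ (DIM('a) - 1) * sphere_mass e) * h r \<le> ennreal (c * K * M\<^sup>2 * sphere_mass e) * (ennreal ((1 + r) powr w) * indicator {0..} r)"
      proof (cases "0 \<le> r")
        case True
        have "r ^ (DIM('a) - 1) \<le> (1 + r) ^ (DIM('a) - 1)" using True by (intro power_mono) auto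
        also have "\<dots> = (1 + r) powr (real DIM('a) - 1)"
          using True DIM_positive[where 'a='a] by (simp add: powr_realpow[symmetric] of_nat_diff)
        finally have "r ^ (DIM('a) - 1) * (1 + r) powr (w + (1 - real DIM('a))) \<le> (1 + r) powr (real DIM('a) - 1) * (1 + r) powr (w + (1 - real DIM('a)))"
          by (rule mult_right_mono) simp
        also have "\<dots> = (1 + r) powr w" using True by (simp add: powr_add[symmetric])
        finally have "(c * K * M\<^sup>2 * sphere_mass e) * (r ^ (DIM('a) - 1) * (1 + r) powr (w + (1 - real DIM('a)))) \<le> (c * K * M\<^sup>2 * sphere_mass e) * (1 + r) powr w"
          using c K(1) sphere_mass_pos[of e] by (intro mult_left_mono) auto
        then have "ennreal ((c * K * M\<^sup>2 * sphere_mass e) * (r ^ (DIM('a) - 1) * (1 + r) powr (w + (1 - real DIM('a))))) \<le> ennreal ((c * K * M\<^sup>2 * sphere_mass e) * (1 + r) powr w)"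
          by (rule ennreal_leI)
        moreover have "ennreal ((c * K * M\<^sup>2 * sphere_mass e) * (r ^ (DIM('a) - 1) * (1 + r) powr (w + (1 - real DIM('a)))))
          = ennreal (indicator {0..} r * r ^ (DIM('a) - 1) * sphere_mass e) * h r"
          using True c K(1) sphere_mass_pos[of e] by (simp add: h_def ennreal_mult[symmetric] mult_ac)
        moreover have "ennreal ((c * K * M\<^sup>2 * sphere_mass e) * (1 + r) powr w) = ennreal (c * K * M\<^sup>2 * sphere_mass e) * (ennreal ((1 + r) powr w) * indicator {0..} r)"
          using True c K(1) sphere_mass_pos[of e] by (simp add: ennreal_mult)
        ultimately show ?thesis by simp
      qed simp
    qed
    also have "\<dots> = ennreal (c * K * M\<^sup>2 * sphere_mass e) * ennreal (- 1 / (w + 1))"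
      by (subst nn_integral_cmult) (auto simp: nn_integral_one_plus_powr[OF w])
    also have "\<dots> = ennreal (c * K * sphere_mass e * (- 1 / (w + 1)) * M\<^sup>2)"
    proof -
      have "0 \<le> - 1 / (w + 1)" using w by (intro divide_nonpos_neg) auto
      moreover have "0 \<le> c * K * M\<^sup>2 * sphere_mass e" using c K(1) sphere_mass_pos[of e] by simp
      ultimately show ?thesis by (simp only: ennreal_mult[symmetric]) (simp add: mult_ac)
    qed
    finally show ?thesis .
  qed
  moreover have "0 < c * K * sphere_mass e * (- 1 / (w + 1))"
    using c K(1) w sphere_mass_pos[of e] by (intro mult_pos_pos divide_neg_neg) auto
  ultimately show ?thesis by blast
qed


section \<open>Interpolation\<close>

text \<open>The sum is at most twice the larger term, which gives the factor \<open>2 powr r\<close>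
  for every r \<ge> 0, convex or not.\<close>

lemma ennpowr_add_le:
  assumes r: "0 \<le> r"
  shows "ennpowr (A + B) r \<le> ennreal (2 powr r) * ennpowr A r + ennreal (2 powr r) * ennpowr B r"
proof -
  have *: "ennpowr (A + B) r \<le> ennreal (2 powr r) * ennpowr B r" if AB: "A \<le> B" for A B
  proof (cases B)
    case (real b)
    then obtain a where a: "A = ennreal a" "0 \<le> a" "a \<le> b"
      using AB by (cases A) (auto simp: ennreal_le_iff top_unique)
    have "(a + b) powr r \<le> (2 * b) powr r" using a r by (intro powr_mono2) auto
    also have "\<dots> = 2 powr r * b powr r" using a by (simp add: powr_mult)
    finally have "ennreal ((a + b) powr r) \<le> ennreal (2 powr r * b powr r)" by (rule ennreal_leI)
    then show ?thesis using a real
      by (simp add: ennreal_plus[symmetric] ennpowr_ennreal ennreal_mult del: ennreal_plus)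
  qed (simp add: ennpowr_def ennreal_mult_top)
  show ?thesis
  proof (cases "A \<le> B")
    case True
    then show ?thesis using *[OF True] by (simp add: add_increasing)
  next
    case False
    then have "ennpowr (B + A) r \<le> ennreal (2 powr r) * ennpowr A r" by (intro *) simp
    then show ?thesis by (simp add: add.commute[of A] add_increasing2)
  qed
qed

lemma ennpowr_cmult:
  assumes "0 < c"
  shows "ennpowr (ennreal c * A) r = ennreal (c powr r) * ennpowr A r"
proof (cases A)
  case (real b)
  then show ?thesis using assms by (simp add: ennreal_mult[symmetric] ennpowr_ennreal powr_mult)
next
  case top
  then show ?thesis using assms by (simp add: ennpowr_def ennreal_mult_top)
qed

lemma ennpowr_ennpowr: "ennpowr (ennpowr A r) s = ennpowr A (r * s)"
  by (auto simp: ennpowr_def powr_powr)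

text \<open>A geometric mean is at most the larger of its two entries, hence at most their
  sum.\<close>

lemma powr_interpolate_le:
  fixes x y \<theta> :: real
  assumes "0 \<le> x" "0 \<le> y" "0 < \<theta>" "\<theta> < 1"
  shows "x powr (1 - \<theta>) * y powr \<theta> \<le> x + y"
proof -
  define z where "z = max x y"
  have z: "0 \<le> z" "x \<le> z" "y \<le> z" "z \<le> x + y" using assms by (auto simp: z_def)
  have "x powr (1 - \<theta>) * y powr \<theta> \<le> z powr (1 - \<theta>) * z powr \<theta>"
    using assms z by (intro mult_mono powr_mono2) auto
  also have "\<dots> = z" using z by (cases "z = 0") (auto simp: powr_add[symmetric])
  finally show ?thesis using z by linarith
qed

text \<open>Jensen's inequality for the measure with density v and mass at most E, up to the factor
  \<open>2 powr m\<close>. It is proved by splitting at a level l: either y is at most l, or y is at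
  most \<open>l powr (1 - m) * y powr m\<close>.\<close>

lemma nn_integral_jensen_powr:
  fixes y v :: "'b \<Rightarrow> real"
  assumes [measurable]: "y \<in> borel_measurable M" "v \<in> borel_measurable M"
    and y: "\<And>x. 0 < y x" and v: "\<And>x. 0 \<le> v x" and E: "(\<integral>\<^sup>+x. ennreal (v x) \<partial>M) \<le> ennreal E" "0 < E" and m: "1 \<le> m"
  shows "ennpowr (\<integral>\<^sup>+x. ennreal (y x * v x) \<partial>M) m
    \<le> ennreal (2 powr m * E powr (m - 1)) * (\<integral>\<^sup>+x. ennreal (y x powr m * v x) \<partial>M)"
proof -
  define B where "B = (\<integral>\<^sup>+x. ennreal (y x * v x) \<partial>M)"
  define J where "J = (\<integral>\<^sup>+x. ennreal (y x powr m * v x) \<partial>M)"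
  have le: "B \<le> ennreal (l * E) + ennreal (l powr (1 - m)) * J" if l: "0 < l" for l
  proof -
    have "B \<le> (\<integral>\<^sup>+x. ennreal l * ennreal (v x) + ennreal (l powr (1 - m)) * ennreal (y x powr m * v x) \<partial>M)"
      unfolding B_def
    proof (rule nn_integral_mono)
      fix x
      have "y x \<le> l + l powr (1 - m) * y x powr m"
      proof (cases "y x \<le> l")
        case False
        have "y x = y x powr (1 - m) * y x powr m" using y[of x] by (simp add: powr_add[symmetric])
        also have "\<dots> \<le> l powr (1 - m) * y x powr m"
          using False m l by (intro mult_right_mono powr_mono2') auto
        finally show ?thesis using l by simp
      qed (simp add: add_increasing2)
      then have "y x * v x \<le> (l + l powr (1 - m) * y x powr m) * v x" using v by (rule mult_right_mono)
      also have "\<dots> = l * v x + l powr (1 - m) * (y x powr m * v x)" by (simp add: algebra_simps)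
      finally have "ennreal (y x * v x) \<le> ennreal (l * v x + l powr (1 - m) * (y x powr m * v x))" by (rule ennreal_leI)
      also have "\<dots> = ennreal l * ennreal (v x) + ennreal (l powr (1 - m)) * ennreal (y x powr m * v x)"
        using l v[of x] by (simp add: ennreal_plus ennreal_mult)
      finally show "ennreal (y x * v x) \<le> ennreal l * ennreal (v x) + ennreal (l powr (1 - m)) * ennreal (y x powr m * v x)" .
    qed
    also have "\<dots> = ennreal l * (\<integral>\<^sup>+x. ennreal (v x) \<partial>M) + ennreal (l powr (1 - m)) * J"
      unfolding J_def by (simp add: nn_integral_add nn_integral_cmult)
    also have "\<dots> \<le> ennreal l * ennreal E + ennreal (l powr (1 - m)) * J"
      by (intro add_right_mono mult_left_mono E) simp
    finally show ?thesis using l E(2) by (simp add: ennreal_mult)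
  qed
  have c: "0 < 2 powr m * E powr (m - 1)" using E(2) by simp
  show ?thesis
  proof (cases J)
    case (real j)
    show ?thesis
    proof (cases "j = 0")
      case True
      have "B \<le> 0"
      \<comment> \<open>With \<open>J\<close> equal to 0 only the term l E survives, and l can be
        taken as small as desired.\<close>
      proof (rule ennreal_le_epsilon)
        fix \<epsilon> :: real assume "0 < \<epsilon>"
        then show "B \<le> 0 + ennreal \<epsilon>" using le[of "\<epsilon> / E"] real True E(2) by simp
      qed
      then show ?thesis by (simp add: B_def[symmetric] ennpowr_def)
    next
      case False
      then have j: "0 < j" using real by simp
      \<comment> \<open>The level at which the two terms of the split are equal; their sum is then 2
        l E.\<close>
      define l where "l = (j / E) powr (1 / m)"
      have l: "0 < l" using j E(2) by (simp add: l_def)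
      have m': "1 / m * (1 - m) = 1 / m - 1" using m by (simp add: field_simps)
      have "l powr (1 - m) * j = (j / E) powr (1 / m) * ((j / E) powr (- 1) * j)"
        unfolding l_def powr_powr m' using powr_add[of "j / E" "1 / m" "- 1"] by simp
      also have "(j / E) powr (- 1) * j = E" using j E(2) by (simp add: powr_minus_divide)
      finally have l2: "l powr (1 - m) * j = l * E" by (simp add: l_def)
      have "B \<le> ennreal (2 * (l * E))"
        using le[OF l] real l E(2) l2
        by (simp add: ennreal_mult[symmetric] ennreal_plus[symmetric] mult.commute[of E] del: ennreal_plus)
      then have "ennpowr B m \<le> ennreal ((2 * (l * E)) powr m)"
        using ennpowr_mono[of B "ennreal (2 * (l * E))" m] m l E(2) by (simp add: ennpowr_ennreal)
      also have "(2 * (l * E)) powr m = 2 powr m * (l powr m * E powr m)"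
        using l E(2) by (simp add: powr_mult)
      also have "l powr m = j / E" using j E(2) m by (simp add: l_def powr_powr)
      also have "E powr m = E powr (m - 1) * E" using E(2) powr_add[of E "m - 1" 1] by simp
      also have "2 powr m * (j / E * (E powr (m - 1) * E)) = 2 powr m * E powr (m - 1) * j"
        using E(2) by simp
      finally show ?thesis using real c j
        by (simp add: B_def[symmetric] J_def[symmetric] ennreal_mult)
    qed
  next
    case top
    then show ?thesis using E(2) by (simp add: J_def[symmetric] ennreal_mult_top)
  qed
qed

lemma nn_integral_norm_powr_cball:
  fixes \<beta> :: real
  assumes \<beta>: "- real DIM('a) < \<beta>"
  shows "\<exists>C>0. (\<integral>\<^sup>+x. ennreal (norm (x::'a::euclidean_space) powr \<beta>) * indicator {..1} (norm x) \<partial>lborel) = ennreal C"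
proof -
  obtain e :: 'a where e: "norm e = 1" using nonempty_Basis norm_Basis by blast
  define b where "b = \<beta> + real DIM('a) - 1"
  have b: "- 1 < b" using \<beta> by (simp add: b_def)
  have "(\<integral>\<^sup>+x. ennreal (norm (x::'a) powr \<beta>) * indicator {..1} (norm x) \<partial>lborel)
     = (\<integral>\<^sup>+r. ennreal (indicator {0..} r * r ^ (DIM('a) - 1) * sphere_mass e) * (ennreal (r powr \<beta>) * indicator {..1} r) \<partial>lborel)"
    by (rule nn_integral_norm[OF e, where h="\<lambda>r. ennreal (r powr \<beta>) * indicator {..1} r"]) measurable
  also have "\<dots> = (\<integral>\<^sup>+r. ennreal (sphere_mass e) * (ennreal (r powr b) * indicator {0..1} r) \<partial>lborel)"
  proof (rule nn_integral_cong)
    fix r :: real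
    show "ennreal (indicator {0..} r * r ^ (DIM('a) - 1) * sphere_mass e) * (ennreal (r powr \<beta>) * indicator {..1} r)
      = ennreal (sphere_mass e) * (ennreal (r powr b) * indicator {0..1} r)"
    proof (cases "0 \<le> r \<and> r \<le> 1")
      case True
      have "r ^ (DIM('a) - 1) * r powr \<beta> = r powr b"
      proof (cases "r = 0")
        case False
        then have "r ^ (DIM('a) - 1) = r powr (real DIM('a) - 1)"
          using True DIM_positive[where 'a='a] by (simp add: powr_realpow[symmetric] of_nat_diff)
        then show ?thesis by (simp add: powr_add[symmetric] b_def algebra_simps)
      qed simp
      then show ?thesis using True sphere_mass_pos[of e]
        by (simp add: ennreal_mult[symmetric] mult_ac)
    qed (auto simp: indicator_def)
  qed
  also have "\<dots> = ennreal (sphere_mass e) * ennreal (1 / (b + 1))"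
  proof -
    have "((\<lambda>x. x powr b) has_integral (1 powr (b + 1) / (b + 1))) {0..1::real}"
      by (rule has_integral_powr_from_0[OF b]) simp
    then have "(\<integral>\<^sup>+r. ennreal (r powr b) * indicator {0..1} r \<partial>lborel) = ennreal (1 / (b + 1))"
      by (intro nn_integral_has_integral_lebesgue') auto
    then show ?thesis by (simp add: nn_integral_cmult)
  qed
  also have "\<dots> = ennreal (sphere_mass e * (1 / (b + 1)))"
    using b sphere_mass_pos[of e] by (subst ennreal_mult) auto
  finally show ?thesis using b sphere_mass_pos[of e]
    by (intro exI[of _ "sphere_mass e * (1 / (b + 1))"]) auto
qed

text \<open>The homogeneous weight differs from the weight in 1 + norm x only near the origin, up to
  constants. There g is replaced by its bound U and the weight is integrated by itself, which is
  what the lower bound on \<alpha> is for.\<close>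

lemma weighted_integral_near_far:
  fixes \<alpha> p :: real
  assumes p: "0 < p" and \<alpha>: "- real DIM('a::euclidean_space) < \<alpha> * p"
  shows "\<exists>C>0. \<forall>g U. g \<in> borel_measurable borel \<longrightarrow> (\<forall>s. 0 \<le> g s) \<longrightarrow> (\<forall>s\<in>{0..1}. g s \<le> U) \<longrightarrow>
    (\<integral>\<^sup>+x. ennreal ((norm (x::'a) powr \<alpha> * g (norm x)) powr p) \<partial>lborel)
    \<le> ennreal C * ennreal (U powr p) + ennreal C * (\<integral>\<^sup>+x. ennreal (((1 + norm (x::'a)) powr \<alpha> * g (norm x)) powr p) \<partial>lborel)"
proof -
  obtain c where c: "0 < c" "(\<integral>\<^sup>+x. ennreal (norm (x::'a) powr (\<alpha> * p)) * indicator {..1} (norm x) \<partial>lborel) = ennreal c"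
    using nn_integral_norm_powr_cball[OF \<alpha>] by blast
  define k where "k = (2 powr \<bar>\<alpha>\<bar>) powr p"
  have k: "0 < k" by (simp add: k_def)
  have "(\<integral>\<^sup>+x. ennreal ((norm (x::'a) powr \<alpha> * g (norm x)) powr p) \<partial>lborel)
    \<le> ennreal (c + k) * ennreal (U powr p) + ennreal (c + k) * (\<integral>\<^sup>+x. ennreal (((1 + norm (x::'a)) powr \<alpha> * g (norm x)) powr p) \<partial>lborel)"
    if [measurable]: "g \<in> borel_measurable borel" and g: "\<And>s. 0 \<le> g s" and U: "\<And>s. s \<in> {0..1} \<Longrightarrow> g s \<le> U" for g U
  proof -
    have U0: "0 \<le> U" using g[of 0] U[of 0] by simp
    have "(\<integral>\<^sup>+x. ennreal ((norm (x::'a) powr \<alpha> * g (norm x)) powr p) \<partial>lborel)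
      \<le> (\<integral>\<^sup>+x. ennreal (U powr p) * (ennreal (norm (x::'a) powr (\<alpha> * p)) * indicator {..1} (norm x))
          + ennreal k * ennreal (((1 + norm (x::'a)) powr \<alpha> * g (norm x)) powr p) \<partial>lborel)"
    proof (rule nn_integral_mono)
      fix x :: 'a
      show "ennreal ((norm x powr \<alpha> * g (norm x)) powr p) \<le> ennreal (U powr p) * (ennreal (norm x powr (\<alpha> * p)) * indicator {..1} (norm x))
          + ennreal k * ennreal (((1 + norm x) powr \<alpha> * g (norm x)) powr p)"
      proof (cases "norm x \<le> 1")
        case True
        have "(norm x powr \<alpha> * g (norm x)) powr p = norm x powr (\<alpha> * p) * g (norm x) powr p"
          using g by (simp add: powr_mult powr_powr)
        also have "\<dots> \<le> norm x powr (\<alpha> * p) * U powr p"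
          using g U True p by (intro mult_left_mono powr_mono2) auto
        finally have "ennreal ((norm x powr \<alpha> * g (norm x)) powr p) \<le> ennreal (U powr p) * (ennreal (norm x powr (\<alpha> * p)) * indicator {..1} (norm x))"
          using True by (simp add: ennreal_mult[symmetric] mult.commute ennreal_leI)
        then show ?thesis by (simp add: add_increasing2)
      next
        case False
        have "norm x powr \<alpha> \<le> 2 powr \<bar>\<alpha>\<bar> * (1 + norm x) powr \<alpha>"
          using powr_shift_le[of "norm x - 1" "norm x" \<alpha>] False by simp
        then have "(norm x powr \<alpha> * g (norm x)) powr p \<le> (2 powr \<bar>\<alpha>\<bar> * (1 + norm x) powr \<alpha> * g (norm x)) powr p"
          using g p by (intro powr_mono2 mult_right_mono) auto
        also have "\<dots> = k * ((1 + norm x) powr \<alpha> * g (norm x)) powr p"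
          using g by (simp add: k_def powr_mult mult.assoc)
        finally have "ennreal ((norm x powr \<alpha> * g (norm x)) powr p) \<le> ennreal k * ennreal (((1 + norm x) powr \<alpha> * g (norm x)) powr p)"
          using k by (simp add: ennreal_mult[symmetric] ennreal_leI)
        then show ?thesis by (simp add: add_increasing)
      qed
    qed
    also have "\<dots> = ennreal c * ennreal (U powr p) + ennreal k * (\<integral>\<^sup>+x. ennreal (((1 + norm (x::'a)) powr \<alpha> * g (norm x)) powr p) \<partial>lborel)"
      by (subst nn_integral_add) (auto simp: nn_integral_cmult c(2) mult.commute[of "ennreal c"])
    also have "\<dots> \<le> ennreal (c + k) * ennreal (U powr p) + ennreal (c + k) * (\<integral>\<^sup>+x. ennreal (((1 + norm (x::'a)) powr \<alpha> * g (norm x)) powr p) \<partial>lborel)"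
      using c(1) k by (intro add_mono mult_right_mono ennreal_leI) auto
    finally show ?thesis .
  qed
  then show ?thesis using c(1) k by (intro exI[of _ "c + k"]) auto
qed

text \<open>The basic interpolation step: p - 2 powers are spent on the pointwise decay, and a
  square remains for Plancherel. The spent powers improve the weight by a (p - 2).\<close>

lemma powr_le_powr_square:
  fixes u D s a p :: real
  assumes u: "0 \<le> u" "u \<le> D * (1 + s) powr (- a)" and D: "0 < D" and s: "0 \<le> s" and p: "2 \<le> p"
  shows "((1 + s) powr \<alpha> * u) powr p \<le> D powr (p - 2) * ((1 + s) powr (\<alpha> * p - a * (p - 2)) * u\<^sup>2)"
proof (cases "u = 0")
  case False
  then have u0: "0 < u" using u by simp
  have "((1 + s) powr \<alpha> * u) powr p = (1 + s) powr (\<alpha> * p) * (u powr (p - 2) * u powr 2)"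
    using u0 s powr_add[of u "p - 2" 2] by (simp add: powr_mult powr_powr)
  also have "\<dots> \<le> (1 + s) powr (\<alpha> * p) * ((D * (1 + s) powr (- a)) powr (p - 2) * u powr 2)"
    using u p by (intro mult_left_mono mult_right_mono powr_mono2) auto
  also have "\<dots> = D powr (p - 2) * ((1 + s) powr (\<alpha> * p) * (1 + s) powr (- a * (p - 2)) * u\<^sup>2)"
    using u0 D s by (simp add: powr_mult powr_powr)
  also have "(1 + s) powr (\<alpha> * p) * (1 + s) powr (- a * (p - 2)) = (1 + s) powr (\<alpha> * p - a * (p - 2))"
    by (simp add: powr_add[symmetric])
  finally show ?thesis .
qed (use p in simp)

text \<open>The essential supremum is at most y exactly when the superlevel set above y is null, and
  the measure of a section is measurable in t.\<close>

lemma measurable_esssup_Pair: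
  fixes h :: "real \<Rightarrow> 'a::euclidean_space \<Rightarrow> ennreal"
  assumes [measurable]: "(\<lambda>z. h (fst z) (snd z)) \<in> borel_measurable (borel \<Otimes>\<^sub>M borel)"
  shows "(\<lambda>t. esssup lborel (h t)) \<in> borel_measurable borel"
proof (rule borel_measurableI_le)
  fix y
  have hm: "h t \<in> borel_measurable lborel" for t
    using measurable_compose[OF measurable_Pair1'[of t borel borel] assms] by simp
  define A where "A = {z \<in> space (borel \<Otimes>\<^sub>M lborel). y < h (fst z) (snd z)}"
  have A: "A \<in> sets (borel \<Otimes>\<^sub>M lborel)"
    unfolding A_def by measurable
  have vA: "Pair t -` A = {x. y < h t x}" for t by (auto simp: A_def space_pair_measure)
  have m: "(\<lambda>t. emeasure lborel {x. y < h t x}) \<in> borel_measurable borel"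
    using lborel.measurable_emeasure_Pair[OF A] unfolding vA .
  have "esssup lborel (h t) \<le> y \<longleftrightarrow> emeasure lborel {x. y < h t x} = 0" for t
  proof
    assume le: "esssup lborel (h t) \<le> y"
    have s: "{x \<in> space lborel. esssup lborel (h t) < h t x} \<in> sets lborel"
      using hm[of t] by measurable
    have "emeasure lborel {x. y < h t x} \<le> emeasure lborel {x \<in> space lborel. esssup lborel (h t) < h t x}"
      by (rule emeasure_mono[OF _ s]) (use le in auto)
    then show "emeasure lborel {x. y < h t x} = 0" using esssup_zero_measure[of lborel "h t"] by simp
  next
    assume 0: "emeasure lborel {x. y < h t x} = 0"
    have "AE x in lborel. h t x \<le> y"
      by (rule AE_I[OF _ 0]) (use hm[of t] in auto)
    then show "esssup lborel (h t) \<le> y" using hm by (intro esssup_I)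
  qed
  then have "{t \<in> space borel. esssup lborel (h t) \<le> y} = {t \<in> space borel. emeasure lborel {x. y < h t x} = 0}" by simp
  also have "\<dots> \<in> sets borel" using m by measurable
  finally show "{t \<in> space borel. esssup lborel (h t) \<le> y} \<in> sets borel" .
qed


text \<open>Of the q powers q - 2 are bounded pointwise and the square by the maximal majorant. The
  exponent \<open>w\<close> of the weight left over is below d - 2 exactly by the upper bound on
  \<alpha>.\<close>

lemma wave_profile_maximal_powr:
  fixes e :: "'a::euclidean_space" and \<alpha> q :: real
  assumes e: "e \<in> Basis" and q: "2 \<le> q" and \<alpha>: "\<alpha> < (real DIM('a) - 1) / 2 - 1 / q"
  shows "\<exists>C>0. \<forall>\<delta> M G. band_profile e \<delta> M G \<longrightarrow> (\<exists>\<zeta>. \<zeta> \<in> borel_measurable borel \<and>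
    (\<forall>t. \<forall>s\<ge>0. ennreal (((1 + s) powr \<alpha> * cmod (wave_profile e G t s)) powr q) \<le> \<zeta> t) \<and>
    (\<integral>\<^sup>+t. \<zeta> t \<partial>lborel) \<le> ennreal (C * (sqrt \<delta> powr (q - 2) * M powr q)))"
proof -
  define a where "a = (real DIM('a) - 1) / 2"
  define w where "w = \<alpha> * q - a * (q - 2)"
  have "\<alpha> * q < (a - 1 / q) * q" using \<alpha> q unfolding a_def by (intro mult_strict_right_mono) auto
  also have "\<dots> = a * q - 1" using q by (simp add: field_simps)
  finally have "w < 2 * a - 1" by (simp add: w_def algebra_simps)
  then have w: "w < real DIM('a) - 2" by (simp add: a_def field_simps)
  obtain K where K: "0 < K" "\<And>\<delta> M G t s. band_profile e \<delta> M G \<Longrightarrow> 0 \<le> s \<Longrightarrow> cmod (wave_profile e G t s) \<le> K * sqrt \<delta> * M * (1 + s) powr (- a)"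
    using wave_profile_le[OF e] unfolding a_def by (auto simp: minus_divide_left)
  obtain C where C: "0 < C" "\<And>\<delta> M G. band_profile e \<delta> M G \<Longrightarrow> (\<exists>Z. Z \<in> borel_measurable borel \<and>
    (\<forall>t. \<forall>s\<ge>0. ennreal ((1 + s) powr w * (cmod (wave_profile e G t s))\<^sup>2) \<le> Z t) \<and>
    (\<integral>\<^sup>+t. Z t \<partial>lborel) \<le> ennreal (C * M\<^sup>2))"
    using wave_profile_maximal[OF e w] by blast
  have "\<exists>\<zeta>. \<zeta> \<in> borel_measurable borel \<and>
    (\<forall>t. \<forall>s\<ge>0. ennreal (((1 + s) powr \<alpha> * cmod (wave_profile e G t s)) powr q) \<le> \<zeta> t) \<and>
    (\<integral>\<^sup>+t. \<zeta> t \<partial>lborel) \<le> ennreal ((K powr (q - 2) * C) * (sqrt \<delta> powr (q - 2) * M powr q))"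
    if b: "band_profile e \<delta> M G" for \<delta> M G
  proof -
    define D where "D = K * sqrt \<delta> * M"
    have D: "0 < D" using K(1) band_profileD(2,4)[OF b] by (simp add: D_def)
    obtain Z where Z[measurable]: "Z \<in> borel_measurable borel" and
      Zs: "\<And>t s. 0 \<le> s \<Longrightarrow> ennreal ((1 + s) powr w * (cmod (wave_profile e G t s))\<^sup>2) \<le> Z t" and
      Zi: "(\<integral>\<^sup>+t. Z t \<partial>lborel) \<le> ennreal (C * M\<^sup>2)"
      using C(2)[OF b] by blast
    define \<zeta> where "\<zeta> t = ennreal (D powr (q - 2)) * Z t" for t
    have "ennreal (((1 + s) powr \<alpha> * cmod (wave_profile e G t s)) powr q) \<le> \<zeta> t" if s: "0 \<le> s" for s t
    proof -
      have "((1 + s) powr \<alpha> * cmod (wave_profile e G t s)) powr q \<le> D powr (q - 2) * ((1 + s) powr w * (cmod (wave_profile e G t s))\<^sup>2)"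
        unfolding w_def by (rule powr_le_powr_square[OF norm_ge_zero _ D s q]) (use K(2)[OF b s] in \<open>simp add: D_def\<close>)
      then have "ennreal (((1 + s) powr \<alpha> * cmod (wave_profile e G t s)) powr q) \<le> ennreal (D powr (q - 2)) * ennreal ((1 + s) powr w * (cmod (wave_profile e G t s))\<^sup>2)"
        by (simp add: ennreal_mult[symmetric] ennreal_leI)
      also have "\<dots> \<le> \<zeta> t" unfolding \<zeta>_def by (intro mult_left_mono Zs s) simp
      finally show ?thesis .
    qed
    moreover have "(\<integral>\<^sup>+t. \<zeta> t \<partial>lborel) \<le> ennreal ((K powr (q - 2) * C) * (sqrt \<delta> powr (q - 2) * M powr q))"
    proof -
      have "(\<integral>\<^sup>+t. \<zeta> t \<partial>lborel) = ennreal (D powr (q - 2)) * (\<integral>\<^sup>+t. Z t \<partial>lborel)"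
        unfolding \<zeta>_def by (rule nn_integral_cmult) measurable
      also have "\<dots> \<le> ennreal (D powr (q - 2)) * ennreal (C * M\<^sup>2)"
        by (intro mult_left_mono Zi) simp
      also have "\<dots> = ennreal (D powr (q - 2) * (C * M\<^sup>2))" using C(1) by (simp add: ennreal_mult)
      also have "D powr (q - 2) * (C * M\<^sup>2) = (K powr (q - 2) * C) * (sqrt \<delta> powr (q - 2) * (M powr (q - 2) * M\<^sup>2))"
        using K(1) band_profileD(2,4)[OF b] by (simp add: D_def powr_mult)
      also have "M powr (q - 2) * M\<^sup>2 = M powr q"
        using band_profileD(4)[OF b] powr_add[of M "q - 2" 2] by simp
      finally show ?thesis .
    qed
    moreover have "\<zeta> \<in> borel_measurable borel" unfolding \<zeta>_def by measurable
    ultimately show ?thesis by blast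
  qed
  moreover have "0 < K powr (q - 2) * C" using K(1) C(1) by simp
  ultimately show ?thesis by blast
qed

section \<open>Finite space exponents\<close>

definition spatial_integral :: "'a::euclidean_space \<Rightarrow> real \<Rightarrow> real \<Rightarrow> (real \<Rightarrow> complex) \<Rightarrow> real \<Rightarrow> ennreal" where
  "spatial_integral e \<alpha> p G t = (\<integral>\<^sup>+x. ennreal ((norm (x::'a) powr \<alpha> * cmod (wave_profile e G t (norm x))) powr p) \<partial>lborel)"

definition shifted_integral :: "'a::euclidean_space \<Rightarrow> real \<Rightarrow> real \<Rightarrow> (real \<Rightarrow> complex) \<Rightarrow> real \<Rightarrow> ennreal" where
  "shifted_integral e \<alpha> p G t = (\<integral>\<^sup>+x. ennreal (((1 + norm (x::'a)) powr \<alpha> * cmod (wave_profile e G t (norm x))) powr p) \<partial>lborel)"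

lemma measurable_spatial_integral:
  fixes e :: "'a::euclidean_space"
  assumes [measurable]: "G \<in> borel_measurable borel"
  shows "spatial_integral e \<alpha> p G \<in> borel_measurable borel" "shifted_integral e \<alpha> p G \<in> borel_measurable borel"
  unfolding spatial_integral_def shifted_integral_def by measurable

text \<open>Infinite time exponent: p - 2 powers pointwise, the square by the energy at each time.
  The remaining weight only has to be bounded, so equality in the upper condition is
  allowed.\<close>

lemma spatial_integral_bounded:
  fixes e :: "'a::euclidean_space"
  assumes e: "e \<in> Basis" and p: "2 \<le> p" and \<alpha>: "- real DIM('a) < \<alpha> * p" "\<alpha> * p \<le> (real DIM('a) - 1) / 2 * (p - 2)"
  shows "\<exists>C>0. \<forall>\<delta> M G. band_profile e \<delta> M G \<longrightarrow> (\<forall>t. spatial_integral e \<alpha> p G t \<le> ennreal (C * (sqrt \<delta> powr (p - 2) * M powr p)))"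
proof -
  define a where "a = (real DIM('a) - 1) / 2"
  have p0: "0 < p" using p by simp
  obtain K where K: "0 < K" "\<And>\<delta> M G t s. band_profile e \<delta> M G \<Longrightarrow> 0 \<le> s \<Longrightarrow> cmod (wave_profile e G t s) \<le> K * sqrt \<delta> * M * (1 + s) powr (- a)"
    using wave_profile_le[OF e] unfolding a_def by (auto simp: minus_divide_left)
  obtain c where c: "0 < c" "\<And>g U. g \<in> borel_measurable borel \<Longrightarrow> (\<And>s. 0 \<le> g s) \<Longrightarrow> (\<And>s. s \<in> {0..1} \<Longrightarrow> g s \<le> U) \<Longrightarrow>
    (\<integral>\<^sup>+x. ennreal ((norm (x::'a) powr \<alpha> * g (norm x)) powr p) \<partial>lborel)
    \<le> ennreal c * ennreal (U powr p) + ennreal c * (\<integral>\<^sup>+x. ennreal (((1 + norm (x::'a)) powr \<alpha> * g (norm x)) powr p) \<partial>lborel)"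
    using weighted_integral_near_far[OF p0 \<alpha>(1)] by blast
  have a0: "0 \<le> a" using DIM_positive[where 'a='a] by (simp add: a_def)
  have "spatial_integral e \<alpha> p G t \<le> ennreal (c * (K powr p + K powr (p - 2)) * (sqrt \<delta> powr (p - 2) * M powr p))"
    if b: "band_profile e \<delta> M G" for \<delta> M G t
  proof -
    note [measurable] = band_profileD(1)[OF b]
    note \<delta>M = band_profileD(2,3,4)[OF b]
    define D where "D = K * sqrt \<delta> * M"
    have D: "0 < D" using K(1) \<delta>M by (simp add: D_def)
    have uD: "cmod (wave_profile e G t s) \<le> D" if s: "0 \<le> s" for s
    proof -
      have "(1 + s) powr (- a) \<le> (1 + s) powr 0" using s a0 by (intro powr_mono) auto
      then have "D * (1 + s) powr (- a) \<le> D * 1" using D s by (intro mult_left_mono) auto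
      then show ?thesis using K(2)[OF b s, of t] by (simp add: D_def)
    qed
    have "(\<integral>\<^sup>+x. ennreal (((1 + norm (x::'a)) powr \<alpha> * cmod (wave_profile e G t (norm x))) powr p) \<partial>lborel)
      \<le> (\<integral>\<^sup>+x. ennreal (D powr (p - 2)) * ennreal ((cmod (wave_profile e G t (norm (x::'a))))\<^sup>2) \<partial>lborel)"
    proof (rule nn_integral_mono)
      fix x :: 'a
      have "((1 + norm x) powr \<alpha> * cmod (wave_profile e G t (norm x))) powr p
        \<le> D powr (p - 2) * ((1 + norm x) powr (\<alpha> * p - a * (p - 2)) * (cmod (wave_profile e G t (norm x)))\<^sup>2)"
        by (rule powr_le_powr_square[OF norm_ge_zero _ D norm_ge_zero p]) (use K(2)[OF b norm_ge_zero[of x], of t] in \<open>simp add: D_def\<close>)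
      also have "\<dots> \<le> D powr (p - 2) * (1 * (cmod (wave_profile e G t (norm x)))\<^sup>2)"
      proof (intro mult_left_mono mult_right_mono)
        have "(1 + norm x) powr (\<alpha> * p - a * (p - 2)) \<le> (1 + norm x) powr 0"
          using \<alpha>(2) by (intro powr_mono) (auto simp: a_def)
        then show "(1 + norm x) powr (\<alpha> * p - a * (p - 2)) \<le> 1" by (simp split: if_splits)
      qed auto
      finally show "ennreal (((1 + norm x) powr \<alpha> * cmod (wave_profile e G t (norm x))) powr p) \<le> ennreal (D powr (p - 2)) * ennreal ((cmod (wave_profile e G t (norm x)))\<^sup>2)"
        by (simp add: ennreal_mult[symmetric] ennreal_leI)
    qed
    also have "\<dots> = ennreal (D powr (p - 2)) * (\<integral>\<^sup>+x. ennreal ((cmod (wave_profile e G t (norm (x::'a))))\<^sup>2) \<partial>lborel)"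
      by (rule nn_integral_cmult) measurable
    also have "\<dots> \<le> ennreal (D powr (p - 2)) * ennreal (M\<^sup>2)"
      by (intro mult_left_mono wave_profile_energy[OF e b]) simp
    finally have far: "(\<integral>\<^sup>+x. ennreal (((1 + norm (x::'a)) powr \<alpha> * cmod (wave_profile e G t (norm x))) powr p) \<partial>lborel) \<le> ennreal (D powr (p - 2) * M\<^sup>2)"
      by (simp add: ennreal_mult)
    have "spatial_integral e \<alpha> p G t \<le> ennreal c * ennreal (D powr p) + ennreal c * (\<integral>\<^sup>+x. ennreal (((1 + norm (x::'a)) powr \<alpha> * cmod (wave_profile e G t (norm x))) powr p) \<partial>lborel)"
      unfolding spatial_integral_def by (rule c(2)) (use uD in auto)
    also have "\<dots> \<le> ennreal c * ennreal (D powr p) + ennreal c * ennreal (D powr (p - 2) * M\<^sup>2)"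
      by (intro add_left_mono mult_left_mono far) simp
    also have "\<dots> = ennreal (c * (D powr p + D powr (p - 2) * M\<^sup>2))"
      using c(1) by (simp add: ennreal_mult[symmetric] ennreal_plus[symmetric] distrib_left del: ennreal_plus)
    also have "\<dots> \<le> ennreal (c * (K powr p + K powr (p - 2)) * (sqrt \<delta> powr (p - 2) * M powr p))"
    proof (rule ennreal_leI)
      have M: "M powr p = M powr (p - 2) * M\<^sup>2"
        using \<delta>M powr_add[of M "p - 2" 2] by simp
      \<comment> \<open>Near the origin all p powers are bounded pointwise, which gains two factors
        too many; they are given away because \<delta> \<le> 1.\<close>
      have "sqrt \<delta> powr p \<le> sqrt \<delta> powr (p - 2)" using \<delta>M by (intro powr_mono') auto
      then have "K powr p * M powr p * sqrt \<delta> powr p \<le> K powr p * M powr p * sqrt \<delta> powr (p - 2)"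
        by (intro mult_left_mono) auto
      then have 1: "D powr p \<le> K powr p * (sqrt \<delta> powr (p - 2) * M powr p)"
        using K(1) \<delta>M by (simp add: D_def powr_mult mult_ac)
      have 2: "D powr (p - 2) * M\<^sup>2 = K powr (p - 2) * (sqrt \<delta> powr (p - 2) * M powr p)"
        using K(1) \<delta>M unfolding M by (simp add: D_def powr_mult mult_ac)
      have "D powr p + D powr (p - 2) * M\<^sup>2 \<le> (K powr p + K powr (p - 2)) * (sqrt \<delta> powr (p - 2) * M powr p)"
        unfolding 2 distrib_right using 1 by simp
      then show "c * (D powr p + D powr (p - 2) * M\<^sup>2) \<le> c * (K powr p + K powr (p - 2)) * (sqrt \<delta> powr (p - 2) * M powr p)"
        unfolding mult.assoc using c(1) by (intro mult_left_mono) auto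
    qed
    finally show ?thesis .
  qed
  moreover have "0 < c * (K powr p + K powr (p - 2))" using c(1) K(1) by (simp add: add_pos_pos)
  ultimately show ?thesis by blast
qed

text \<open>The part of the spatial integral near the origin is controlled by the maximal function.\<close>

lemma spatial_integral_powr_le:
  fixes e :: "'a::euclidean_space"
  assumes p: "0 < p" and q: "0 < q" and \<alpha>: "- real DIM('a) < \<alpha> * p"
  shows "\<exists>C>0. \<forall>G t \<zeta>. G \<in> borel_measurable borel \<longrightarrow>
    (\<forall>s\<ge>0. ennreal (((1 + s) powr \<beta> * cmod (wave_profile e G t s)) powr q) \<le> \<zeta>) \<longrightarrow>
    ennpowr (spatial_integral e \<alpha> p G t) (q / p) \<le> ennreal C * \<zeta> + ennreal C * ennpowr (shifted_integral e \<alpha> p G t) (q / p)"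
proof -
  define \<theta> where "\<theta> = q / p"
  have \<theta>: "0 < \<theta>" using p q by (simp add: \<theta>_def)
  obtain c where c: "0 < c" "\<And>g U. g \<in> borel_measurable borel \<Longrightarrow> (\<And>s. 0 \<le> g s) \<Longrightarrow> (\<And>s. s \<in> {0..1} \<Longrightarrow> g s \<le> U) \<Longrightarrow>
    (\<integral>\<^sup>+x. ennreal ((norm (x::'a) powr \<alpha> * g (norm x)) powr p) \<partial>lborel)
    \<le> ennreal c * ennreal (U powr p) + ennreal c * (\<integral>\<^sup>+x. ennreal (((1 + norm (x::'a)) powr \<alpha> * g (norm x)) powr p) \<partial>lborel)"
    using weighted_integral_near_far[OF p \<alpha>] by blast
  define k where "k = 2 powr \<bar>\<beta>\<bar>"
  have k: "1 \<le> k" by (simp add: k_def ge_one_powr_ge_zero)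
  define C where "C = 2 powr \<theta> * c powr \<theta> * k powr q"
  have kq: "1 \<le> k powr q" using k q by (simp add: ge_one_powr_ge_zero)
  have C: "0 < C" using c(1) k by (simp add: C_def)
  have "ennpowr (spatial_integral e \<alpha> p G t) \<theta> \<le> ennreal C * \<zeta> + ennreal C * ennpowr (shifted_integral e \<alpha> p G t) \<theta>"
    if [measurable]: "G \<in> borel_measurable borel"
      and \<zeta>: "\<And>s. 0 \<le> s \<Longrightarrow> ennreal (((1 + s) powr \<beta> * cmod (wave_profile e G t s)) powr q) \<le> \<zeta>" for G t \<zeta>
  proof (cases \<zeta>)
    case top
    then show ?thesis using C by (simp add: ennreal_mult_top)
  next
    case (real z)
    \<comment> \<open>A bound on [0, 1] from the majorant: its q-th root, with \<open>k\<close>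
      undoing the weight of exponent \<beta>, which is bounded on that interval.\<close>
    define U where "U = k * z powr (1 / q)"
    have "cmod (wave_profile e G t s) \<le> U" if s: "s \<in> {0..1}" for s
    proof -
      have "((1 + s) powr \<beta> * cmod (wave_profile e G t s)) powr q \<le> z"
        using \<zeta>[of s] s real by (simp add: ennreal_le_iff)
      then have "(((1 + s) powr \<beta> * cmod (wave_profile e G t s)) powr q) powr (1 / q) \<le> z powr (1 / q)"
        using q by (intro powr_mono2) auto
      then have le: "(1 + s) powr \<beta> * cmod (wave_profile e G t s) \<le> z powr (1 / q)"
        using q by (simp add: powr_powr)
      have "1 \<le> k * (1 + s) powr \<beta>"
        using powr_shift_le[of 0 s \<beta>] s by (simp add: k_def)
      then have "1 * cmod (wave_profile e G t s) \<le> (k * (1 + s) powr \<beta>) * cmod (wave_profile e G t s)"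
        by (rule mult_right_mono) simp
      also have "\<dots> \<le> k * z powr (1 / q)" unfolding mult.assoc using le k by (intro mult_left_mono) auto
      finally show ?thesis by (simp add: U_def)
    qed
    then have "spatial_integral e \<alpha> p G t \<le> ennreal c * ennreal (U powr p) + ennreal c * shifted_integral e \<alpha> p G t"
      unfolding spatial_integral_def shifted_integral_def by (intro c(2)) auto
    then have "ennpowr (spatial_integral e \<alpha> p G t) \<theta> \<le> ennpowr (ennreal c * ennreal (U powr p) + ennreal c * shifted_integral e \<alpha> p G t) \<theta>"
      using \<theta> by (intro ennpowr_mono) auto
    also have "\<dots> \<le> ennreal (2 powr \<theta>) * ennpowr (ennreal c * ennreal (U powr p)) \<theta> + ennreal (2 powr \<theta>) * ennpowr (ennreal c * shifted_integral e \<alpha> p G t) \<theta>"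
      using \<theta> by (intro ennpowr_add_le) auto
    also have "ennpowr (ennreal c * ennreal (U powr p)) \<theta> = ennreal (c powr \<theta> * (k powr q * z))"
    proof -
      have "(U powr p) powr \<theta> = U powr q" using p by (simp add: powr_powr \<theta>_def)
      also have "\<dots> = k powr q * z" using k real q by (simp add: U_def powr_mult powr_powr)
      finally show ?thesis using c(1) by (simp add: ennpowr_cmult ennpowr_ennreal ennreal_mult real)
    qed
    also have "ennreal (2 powr \<theta>) * ennreal (c powr \<theta> * (k powr q * z)) = ennreal C * \<zeta>"
      using real by (simp add: C_def ennreal_mult[symmetric] mult_ac)
    also have "ennreal (2 powr \<theta>) * ennpowr (ennreal c * shifted_integral e \<alpha> p G t) \<theta> = ennreal (2 powr \<theta> * c powr \<theta>) * ennpowr (shifted_integral e \<alpha> p G t) \<theta>"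
      using c(1) by (simp add: ennpowr_cmult ennreal_mult mult.assoc)
    also have "\<dots> \<le> ennreal C * ennpowr (shifted_integral e \<alpha> p G t) \<theta>"
    proof (intro mult_right_mono ennreal_leI)
      show "2 powr \<theta> * c powr \<theta> \<le> C"
        unfolding C_def using mult_left_mono[OF kq, of "2 powr \<theta> * c powr \<theta>"] by simp
    qed simp
    finally show ?thesis by (simp add: add_left_mono)
  qed
  then show ?thesis using C unfolding \<theta>_def by blast
qed


text \<open>Since q / p \<ge> 1, Jensen moves this power inside the space integral, taken against
  the measure with density the square of v, of mass at most \<open>M\<^sup>2\<close>. A single
  space-time bound remains.\<close>

lemma shifted_integral_time_ge:
  fixes e :: "'a::euclidean_space"
  assumes e: "e \<in> Basis" and p: "2 \<le> p" and q: "p \<le> q"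
    and \<alpha>: "\<alpha> < (real DIM('a) - 1) / 2 * (1 - 2 / p) - 1 / q"
  shows "\<exists>C>0. \<forall>\<delta> M G. band_profile e \<delta> M G \<longrightarrow>
    (\<integral>\<^sup>+t. ennpowr (shifted_integral e \<alpha> p G t) (q / p) \<partial>lborel) \<le> ennreal (C * (sqrt \<delta> powr (q - 2 * q / p) * M powr q))"
proof -
  define a where "a = (real DIM('a) - 1) / 2"
  define \<theta> where "\<theta> = q / p"
  define \<gamma> where "\<gamma> = \<alpha> * p - a * (p - 2)"
  have \<theta>: "1 \<le> \<theta>" using p q by (simp add: \<theta>_def)
  \<comment> \<open>The hypothesis on \<alpha> is the requirement that the weight after Jensen lies
    below the threshold -1 of the space-time bound.\<close>
  have "\<gamma> * \<theta> = q * (\<alpha> - a * (1 - 2 / p))" using p by (simp add: \<gamma>_def \<theta>_def field_simps)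
  also have "\<dots> < q * (- 1 / q)" using \<alpha> p q by (intro mult_strict_left_mono) (auto simp: a_def)
  finally have w: "\<gamma> * \<theta> < - 1" using p q by simp
  obtain K where K: "0 < K" "\<And>\<delta> M G t s. band_profile e \<delta> M G \<Longrightarrow> 0 \<le> s \<Longrightarrow> cmod (wave_profile e G t s) \<le> K * sqrt \<delta> * M * (1 + s) powr (- a)"
    using wave_profile_le[OF e] unfolding a_def by (auto simp: minus_divide_left)
  obtain C where C: "0 < C" "\<And>\<delta> M G. band_profile e \<delta> M G \<Longrightarrow>
    (\<integral>\<^sup>+t. \<integral>\<^sup>+x. ennreal ((1 + norm (x::'a)) powr (\<gamma> * \<theta>) * (cmod (wave_profile e G t (norm x)))\<^sup>2) \<partial>lborel \<partial>lborel) \<le> ennreal (C * M\<^sup>2)"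
    using wave_profile_weighted[OF e w] by blast
  have "(\<integral>\<^sup>+t. ennpowr (shifted_integral e \<alpha> p G t) \<theta> \<partial>lborel) \<le> ennreal ((K powr ((p - 2) * \<theta>) * 2 powr \<theta> * C) * (sqrt \<delta> powr (q - 2 * q / p) * M powr q))"
    if b: "band_profile e \<delta> M G" for \<delta> M G
  proof -
    note [measurable] = band_profileD(1)[OF b]
    note \<delta>M = band_profileD(2,3,4)[OF b]
    define D where "D = K * sqrt \<delta> * M"
    have D: "0 < D" using K(1) \<delta>M by (simp add: D_def)
    define c where "c = D powr ((p - 2) * \<theta>) * (2 powr \<theta> * (M\<^sup>2) powr (\<theta> - 1))"
    define Y where "Y t = (\<integral>\<^sup>+x. ennreal ((1 + norm (x::'a)) powr (\<gamma> * \<theta>) * (cmod (wave_profile e G t (norm x)))\<^sup>2) \<partial>lborel)" for t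
    have [measurable]: "Y \<in> borel_measurable borel" unfolding Y_def by measurable
    have pt: "ennpowr (shifted_integral e \<alpha> p G t) \<theta> \<le> ennreal c * Y t" for t
    proof -
      define B where "B = (\<integral>\<^sup>+x. ennreal ((1 + norm (x::'a)) powr \<gamma> * (cmod (wave_profile e G t (norm x)))\<^sup>2) \<partial>lborel)"
      have "shifted_integral e \<alpha> p G t \<le> (\<integral>\<^sup>+x. ennreal (D powr (p - 2)) * ennreal ((1 + norm (x::'a)) powr \<gamma> * (cmod (wave_profile e G t (norm x)))\<^sup>2) \<partial>lborel)"
        unfolding shifted_integral_def
      proof (rule nn_integral_mono)
        fix x :: 'a
        have "((1 + norm x) powr \<alpha> * cmod (wave_profile e G t (norm x))) powr p
          \<le> D powr (p - 2) * ((1 + norm x) powr \<gamma> * (cmod (wave_profile e G t (norm x)))\<^sup>2)"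
          unfolding \<gamma>_def
          by (rule powr_le_powr_square[OF norm_ge_zero _ D norm_ge_zero p]) (use K(2)[OF b norm_ge_zero[of x], of t] in \<open>simp add: D_def\<close>)
        then show "ennreal (((1 + norm x) powr \<alpha> * cmod (wave_profile e G t (norm x))) powr p) \<le> ennreal (D powr (p - 2)) * ennreal ((1 + norm x) powr \<gamma> * (cmod (wave_profile e G t (norm x)))\<^sup>2)"
          by (simp add: ennreal_mult[symmetric] ennreal_leI)
      qed
      also have "\<dots> = ennreal (D powr (p - 2)) * B" unfolding B_def by (rule nn_integral_cmult) measurable
      finally have "ennpowr (shifted_integral e \<alpha> p G t) \<theta> \<le> ennpowr (ennreal (D powr (p - 2)) * B) \<theta>"
        using \<theta> by (intro ennpowr_mono) auto
      also have "\<dots> = ennreal (D powr ((p - 2) * \<theta>)) * ennpowr B \<theta>"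
        using D by (simp add: ennpowr_cmult powr_powr)
      also have "ennpowr B \<theta> \<le> ennreal (2 powr \<theta> * (M\<^sup>2) powr (\<theta> - 1)) * (\<integral>\<^sup>+x. ennreal (((1 + norm (x::'a)) powr \<gamma>) powr \<theta> * (cmod (wave_profile e G t (norm x)))\<^sup>2) \<partial>lborel)"
        unfolding B_def
      proof (rule nn_integral_jensen_powr[OF _ _ _ _ wave_profile_energy[OF e b] _ \<theta>])
        show "0 < (1 + norm x) powr \<gamma>" for x :: 'a using norm_ge_zero[of x] by (simp add: add_nonneg_eq_0_iff)
        show "0 < M\<^sup>2" using \<delta>M by simp
      qed auto
      also have "(\<integral>\<^sup>+x. ennreal (((1 + norm (x::'a)) powr \<gamma>) powr \<theta> * (cmod (wave_profile e G t (norm x)))\<^sup>2) \<partial>lborel) = Y t"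
        by (simp add: Y_def powr_powr)
      finally show ?thesis by (simp add: c_def ennreal_mult mult.assoc mult_left_mono)
    qed
    have "(\<integral>\<^sup>+t. ennpowr (shifted_integral e \<alpha> p G t) \<theta> \<partial>lborel) \<le> (\<integral>\<^sup>+t. ennreal c * Y t \<partial>lborel)"
      by (intro nn_integral_mono pt)
    also have "\<dots> = ennreal c * (\<integral>\<^sup>+t. Y t \<partial>lborel)" by (rule nn_integral_cmult) measurable
    also have "\<dots> \<le> ennreal c * ennreal (C * M\<^sup>2)"
      unfolding Y_def by (intro mult_left_mono C(2)[OF b]) simp
    also have "\<dots> = ennreal (c * (C * M\<^sup>2))" using C(1) by (simp add: c_def ennreal_mult)
    also have "c * (C * M\<^sup>2) = (K powr ((p - 2) * \<theta>) * 2 powr \<theta> * C) * (sqrt \<delta> powr ((p - 2) * \<theta>) * (M powr ((p - 2) * \<theta>) * ((M\<^sup>2) powr (\<theta> - 1) * M\<^sup>2)))"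
      using K(1) \<delta>M by (simp add: c_def D_def powr_mult mult_ac)
    also have "(M\<^sup>2) powr (\<theta> - 1) * M\<^sup>2 = M powr (2 * \<theta>)"
    proof -
      have "M\<^sup>2 = M powr 2" using \<delta>M by simp
      then have "(M\<^sup>2) powr (\<theta> - 1) * M\<^sup>2 = M powr (2 * (\<theta> - 1) + 2)"
        by (simp only: powr_powr powr_add)
      also have "2 * (\<theta> - 1) + 2 = 2 * \<theta>" by simp
      finally show ?thesis .
    qed
    also have "M powr ((p - 2) * \<theta>) * M powr (2 * \<theta>) = M powr q"
      using p by (simp add: powr_add[symmetric] \<theta>_def field_simps)
    also have "(p - 2) * \<theta> = q - 2 * q / p" using p by (simp add: \<theta>_def field_simps)
    finally show ?thesis using p by (simp add: \<theta>_def field_simps)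
  qed
  moreover have "0 < K powr ((p - 2) * \<theta>) * 2 powr \<theta> * C" using K(1) C(1) by simp
  ultimately show ?thesis unfolding \<theta>_def by blast
qed

lemma shifted_integral_time_less:
  fixes e :: "'a::euclidean_space"
  assumes e: "e \<in> Basis" and q: "2 \<le> q" and p: "q < p"
    and \<alpha>: "\<alpha> < (real DIM('a) - 1) / 2 * (1 - 2 / p) - 1 / q"
  shows "\<exists>C>0. \<forall>\<delta> M G. band_profile e \<delta> M G \<longrightarrow>
    (\<integral>\<^sup>+t. ennpowr (shifted_integral e \<alpha> p G t) (q / p) \<partial>lborel) \<le> ennreal (C * (sqrt \<delta> powr (q - 2) * M powr q))"
proof -
  define a where "a = (real DIM('a) - 1) / 2"
  define \<theta> where "\<theta> = q / p"
  have \<theta>: "0 < \<theta>" "\<theta> < 1" using p q by (simp_all add: \<theta>_def)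
  define \<kappa> where "\<kappa> = a * (p - 2) - p / q - \<alpha> * p"
  have "p * \<alpha> < p * (a * (1 - 2 / p) - 1 / q)" using \<alpha> p q by (intro mult_strict_left_mono) (auto simp: a_def)
  also have "\<dots> = a * (p - 2) - p / q" using p q by (simp add: field_simps)
  finally have \<kappa>: "0 < \<kappa>" by (simp add: \<kappa>_def mult.commute)
  \<comment> \<open>\<kappa> > 0 is the slack in the hypothesis on \<alpha>, multiplied by p. Half
    of it puts \<open>\<alpha>\<^sub>1\<close> strictly below the threshold of the maximal function;
    \<open>\<alpha>\<^sub>2\<close> takes the rest of the weight, and the other half leaves
    \<open>w\<close> at -1 - \<kappa>/2.\<close>
  define \<alpha>\<^sub>1 where "\<alpha>\<^sub>1 = a - 1 / q - \<kappa> / (2 * (p - q))"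
  define \<alpha>\<^sub>2 where "\<alpha>\<^sub>2 = (\<alpha> * p - \<alpha>\<^sub>1 * (p - q)) / q"
  define w where "w = \<alpha>\<^sub>2 * q - a * (q - 2)"
  have \<alpha>1: "\<alpha>\<^sub>1 < (real DIM('a) - 1) / 2 - 1 / q" using \<kappa> p by (simp add: \<alpha>\<^sub>1_def a_def)
  have \<alpha>2q: "\<alpha>\<^sub>2 * q = \<alpha> * p - \<alpha>\<^sub>1 * (p - q)" using q by (simp add: \<alpha>\<^sub>2_def)
  have "\<alpha>\<^sub>1 * (p - q) = (a - 1 / q) * (p - q) - \<kappa> / 2" using p by (simp add: \<alpha>\<^sub>1_def field_simps)
  then have "w = \<alpha> * p - (a - 1 / q) * (p - q) + \<kappa> / 2 - a * (q - 2)" by (simp add: w_def \<alpha>2q)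
  also have "\<dots> = - 1 - \<kappa> / 2" using q by (simp add: \<kappa>_def field_simps)
  finally have w: "w < - 1" using \<kappa> by simp
  obtain K where K: "0 < K" "\<And>\<delta> M G t s. band_profile e \<delta> M G \<Longrightarrow> 0 \<le> s \<Longrightarrow> cmod (wave_profile e G t s) \<le> K * sqrt \<delta> * M * (1 + s) powr (- a)"
    using wave_profile_le[OF e] unfolding a_def by (auto simp: minus_divide_left)
  obtain C where C: "0 < C" "\<And>\<delta> M G. band_profile e \<delta> M G \<Longrightarrow>
    (\<integral>\<^sup>+t. \<integral>\<^sup>+x. ennreal ((1 + norm (x::'a)) powr w * (cmod (wave_profile e G t (norm x)))\<^sup>2) \<partial>lborel \<partial>lborel) \<le> ennreal (C * M\<^sup>2)"
    using wave_profile_weighted[OF e w] by blast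
  obtain C' where C': "0 < C'" "\<And>\<delta> M G. band_profile e \<delta> M G \<Longrightarrow> (\<exists>\<zeta>. \<zeta> \<in> borel_measurable borel \<and>
    (\<forall>t. \<forall>s\<ge>0. ennreal (((1 + s) powr \<alpha>\<^sub>1 * cmod (wave_profile e G t s)) powr q) \<le> \<zeta> t) \<and>
    (\<integral>\<^sup>+t. \<zeta> t \<partial>lborel) \<le> ennreal (C' * (sqrt \<delta> powr (q - 2) * M powr q)))"
    using wave_profile_maximal_powr[OF e q \<alpha>1] by blast
  have "(\<integral>\<^sup>+t. ennpowr (shifted_integral e \<alpha> p G t) \<theta> \<partial>lborel) \<le> ennreal ((C' + K powr (q - 2) * C) * (sqrt \<delta> powr (q - 2) * M powr q))"
    if b: "band_profile e \<delta> M G" for \<delta> M G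
  proof -
    note [measurable] = band_profileD(1)[OF b]
    note \<delta>M = band_profileD(2,3,4)[OF b]
    define D where "D = K * sqrt \<delta> * M"
    have D: "0 < D" using K(1) \<delta>M by (simp add: D_def)
    obtain \<zeta> where \<zeta>[measurable]: "\<zeta> \<in> borel_measurable borel" and
      \<zeta>s: "\<And>t s. 0 \<le> s \<Longrightarrow> ennreal (((1 + s) powr \<alpha>\<^sub>1 * cmod (wave_profile e G t s)) powr q) \<le> \<zeta> t" and
      \<zeta>i: "(\<integral>\<^sup>+t. \<zeta> t \<partial>lborel) \<le> ennreal (C' * (sqrt \<delta> powr (q - 2) * M powr q))"
      using C'(2)[OF b] by blast
    define Y where "Y t = (\<integral>\<^sup>+x. ennreal ((1 + norm (x::'a)) powr w * (cmod (wave_profile e G t (norm x)))\<^sup>2) \<partial>lborel)" for t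
    have [measurable]: "Y \<in> borel_measurable borel" unfolding Y_def by measurable
    define c where "c = D powr (q - 2)"
    have c: "0 < c" using D by (simp add: c_def)
    have pt: "ennpowr (shifted_integral e \<alpha> p G t) \<theta> \<le> \<zeta> t + ennreal c * Y t" for t
    proof (cases "\<zeta> t = \<infinity> \<or> Y t = \<infinity>")
      case True
      then show ?thesis using c by (auto simp: ennreal_mult_top)
    next
      case False
      then obtain z y where z: "\<zeta> t = ennreal z" "0 \<le> z" and y: "Y t = ennreal y" "0 \<le> y"
        by (cases "\<zeta> t"; cases "Y t") auto
      define z' where "z' = z powr ((p - q) / q)"
      have "shifted_integral e \<alpha> p G t \<le> (\<integral>\<^sup>+x. ennreal (z' * c) * ennreal ((1 + norm (x::'a)) powr w * (cmod (wave_profile e G t (norm x)))\<^sup>2) \<partial>lborel)"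
        unfolding shifted_integral_def
      proof (rule nn_integral_mono)
        fix x :: 'a
        let ?s = "norm x" and ?u = "cmod (wave_profile e G t (norm x))"
        have 1: "((1 + ?s) powr \<alpha>\<^sub>1 * ?u) powr (p - q) \<le> z'"
        proof -
          have "((1 + ?s) powr \<alpha>\<^sub>1 * ?u) powr q \<le> z"
            using \<zeta>s[of ?s t] z by (simp add: ennreal_le_iff)
          then have "(((1 + ?s) powr \<alpha>\<^sub>1 * ?u) powr q) powr ((p - q) / q) \<le> z powr ((p - q) / q)"
            using p q by (intro powr_mono2) auto
          then show ?thesis using q by (simp add: powr_powr z'_def)
        qed
        have 2: "((1 + ?s) powr \<alpha>\<^sub>2 * ?u) powr q \<le> c * ((1 + ?s) powr w * ?u\<^sup>2)"
          unfolding c_def w_def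
          by (rule powr_le_powr_square[OF norm_ge_zero _ D norm_ge_zero q]) (use K(2)[OF b norm_ge_zero[of x], of t] in \<open>simp add: D_def\<close>)
        have "((1 + ?s) powr \<alpha> * ?u) powr p = ((1 + ?s) powr \<alpha>\<^sub>1 * ?u) powr (p - q) * ((1 + ?s) powr \<alpha>\<^sub>2 * ?u) powr q"
        proof -
          have "(1 + ?s) powr (\<alpha>\<^sub>1 * (p - q)) * (1 + ?s) powr (\<alpha>\<^sub>2 * q) = (1 + ?s) powr (\<alpha> * p)"
            unfolding \<alpha>2q powr_add[symmetric] by simp
          moreover have "?u powr (p - q) * ?u powr q = ?u powr p" unfolding powr_add[symmetric] by simp
          ultimately show ?thesis
            by (simp add: powr_mult powr_powr) (metis mult.assoc mult.left_commute)
        qed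
        also have "\<dots> \<le> z' * (c * ((1 + ?s) powr w * ?u\<^sup>2))"
          by (intro mult_mono 1 2) (auto simp: z'_def)
        finally show "ennreal (((1 + ?s) powr \<alpha> * ?u) powr p) \<le> ennreal (z' * c) * ennreal ((1 + ?s) powr w * ?u\<^sup>2)"
          using c by (simp add: ennreal_mult[symmetric] z'_def ennreal_leI mult.assoc)
      qed
      also have "\<dots> = ennreal (z' * c) * Y t" unfolding Y_def by (rule nn_integral_cmult) measurable
      also have "\<dots> = ennreal (z' * (c * y))" using c y by (simp add: ennreal_mult[symmetric] z'_def mult.assoc)
      finally have "ennpowr (shifted_integral e \<alpha> p G t) \<theta> \<le> ennpowr (ennreal (z' * (c * y))) \<theta>"
        using \<theta> by (intro ennpowr_mono) auto
      also have "\<dots> = ennreal (z powr (1 - \<theta>) * (c * y) powr \<theta>)"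
      proof -
        have "(p - q) / q * \<theta> = 1 - \<theta>" using p q by (simp add: \<theta>_def field_simps)
        then show ?thesis using c y by (simp add: ennpowr_ennreal z'_def powr_mult powr_powr)
      qed
      \<comment> \<open>Replacing the geometric mean by the sum loses nothing essential: the time
        integrals of both terms carry the same powers of \<delta> and M.\<close>
      also have "\<dots> \<le> ennreal (z + c * y)"
        using z c y \<theta> by (intro ennreal_leI powr_interpolate_le) auto
      finally show ?thesis using z y c by (simp add: ennreal_plus ennreal_mult)
    qed
    have "(\<integral>\<^sup>+t. ennpowr (shifted_integral e \<alpha> p G t) \<theta> \<partial>lborel) \<le> (\<integral>\<^sup>+t. \<zeta> t + ennreal c * Y t \<partial>lborel)"
      by (intro nn_integral_mono pt)
    also have "\<dots> = (\<integral>\<^sup>+t. \<zeta> t \<partial>lborel) + ennreal c * (\<integral>\<^sup>+t. Y t \<partial>lborel)"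
      by (simp add: nn_integral_add nn_integral_cmult)
    also have "\<dots> \<le> ennreal (C' * (sqrt \<delta> powr (q - 2) * M powr q)) + ennreal c * ennreal (C * M\<^sup>2)"
      unfolding Y_def by (intro add_mono \<zeta>i mult_left_mono C(2)[OF b]) simp
    also have "\<dots> = ennreal (C' * (sqrt \<delta> powr (q - 2) * M powr q) + c * (C * M\<^sup>2))"
      using C(1) C'(1) c by (simp add: ennreal_mult ennreal_plus)
    also have "c * (C * M\<^sup>2) = (K powr (q - 2) * C) * (sqrt \<delta> powr (q - 2) * (M powr (q - 2) * M\<^sup>2))"
      using K(1) \<delta>M by (simp add: c_def D_def powr_mult)
    also have "M powr (q - 2) * M\<^sup>2 = M powr q"
      using \<delta>M powr_add[of M "q - 2" 2] by simp
    finally show ?thesis by (simp add: distrib_right)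
  qed
  moreover have "0 < C' + K powr (q - 2) * C" using K(1) C(1) C'(1) by (simp add: add_pos_pos)
  ultimately show ?thesis unfolding \<theta>_def by blast
qed

lemma spatial_integral_time:
  fixes e :: "'a::euclidean_space"
  assumes e: "e \<in> Basis" and p: "2 \<le> p" and q: "2 \<le> q" and \<alpha>0: "- real DIM('a) < \<alpha> * p"
    and \<alpha>: "\<alpha> < (real DIM('a) - 1) / 2 * (1 - 2 / p) - 1 / q"
  shows "\<exists>C>0. \<forall>\<delta> M G. band_profile e \<delta> M G \<longrightarrow>
    (\<integral>\<^sup>+t. ennpowr (spatial_integral e \<alpha> p G t) (q / p) \<partial>lborel) \<le> ennreal (C * (sqrt \<delta> powr (q - 2 * q / min p q) * M powr q))"
proof -
  define \<kappa> where "\<kappa> = q - 2 * q / min p q"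
  \<comment> \<open>Any exponent below the threshold of the maximal function will do, since the
    majorant is used only for s in [0, 1].\<close>
  define \<beta> where "\<beta> = (real DIM('a) - 1) / 2 - 1 / q - 1"
  have \<beta>: "\<beta> < (real DIM('a) - 1) / 2 - 1 / q" by (simp add: \<beta>_def)
  have pq0: "0 < p" "0 < q" using p q by simp_all
  have "\<exists>C>0. \<forall>\<delta> M G. band_profile e \<delta> M G \<longrightarrow>
    (\<integral>\<^sup>+t. ennpowr (shifted_integral e \<alpha> p G t) (q / p) \<partial>lborel) \<le> ennreal (C * (sqrt \<delta> powr \<kappa> * M powr q))"
  proof (cases "p \<le> q")
    case True
    then show ?thesis using shifted_integral_time_ge[OF e p True \<alpha>] by (simp add: \<kappa>_def min_def)
  next
    case False
    then have "\<kappa> = q - 2" using q by (simp add: \<kappa>_def min_def)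
    then show ?thesis using shifted_integral_time_less[OF e q _ \<alpha>] False by simp
  qed
  then obtain A where A: "0 < A" "\<And>\<delta> M G. band_profile e \<delta> M G \<Longrightarrow>
    (\<integral>\<^sup>+t. ennpowr (shifted_integral e \<alpha> p G t) (q / p) \<partial>lborel) \<le> ennreal (A * (sqrt \<delta> powr \<kappa> * M powr q))"
    by blast
  obtain C' where C': "0 < C'" "\<And>\<delta> M G. band_profile e \<delta> M G \<Longrightarrow> (\<exists>\<zeta>. \<zeta> \<in> borel_measurable borel \<and>
    (\<forall>t. \<forall>s\<ge>0. ennreal (((1 + s) powr \<beta> * cmod (wave_profile e G t s)) powr q) \<le> \<zeta> t) \<and>
    (\<integral>\<^sup>+t. \<zeta> t \<partial>lborel) \<le> ennreal (C' * (sqrt \<delta> powr (q - 2) * M powr q)))"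
    using wave_profile_maximal_powr[OF e q \<beta>] by blast
  obtain C where C: "0 < C" "\<And>G t \<zeta>. G \<in> borel_measurable borel \<Longrightarrow>
    (\<And>s. 0 \<le> s \<Longrightarrow> ennreal (((1 + s) powr \<beta> * cmod (wave_profile e G t s)) powr q) \<le> \<zeta>) \<Longrightarrow>
    ennpowr (spatial_integral e \<alpha> p G t) (q / p) \<le> ennreal C * \<zeta> + ennreal C * ennpowr (shifted_integral e \<alpha> p G t) (q / p)"
    using spatial_integral_powr_le[OF pq0 \<alpha>0, where e=e and \<beta>=\<beta>] by blast
  have "(\<integral>\<^sup>+t. ennpowr (spatial_integral e \<alpha> p G t) (q / p) \<partial>lborel) \<le> ennreal ((C * (C' + A)) * (sqrt \<delta> powr \<kappa> * M powr q))"
    if b: "band_profile e \<delta> M G" for \<delta> M G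
  proof -
    note G[measurable] = band_profileD(1)[OF b]
    note [measurable] = measurable_spatial_integral[OF G]
    note \<delta>M = band_profileD(2,3,4)[OF b]
    obtain \<zeta> where \<zeta>[measurable]: "\<zeta> \<in> borel_measurable borel" and
      \<zeta>s: "\<And>t s. 0 \<le> s \<Longrightarrow> ennreal (((1 + s) powr \<beta> * cmod (wave_profile e G t s)) powr q) \<le> \<zeta> t" and
      \<zeta>i: "(\<integral>\<^sup>+t. \<zeta> t \<partial>lborel) \<le> ennreal (C' * (sqrt \<delta> powr (q - 2) * M powr q))"
      using C'(2)[OF b] by blast
    \<comment> \<open>The part near the origin gains q - 2 factors, at least as many as claimed
      since min p q \<le> q; the surplus is dropped because \<delta> \<le> 1.\<close>
    have "sqrt \<delta> powr (q - 2) \<le> sqrt \<delta> powr \<kappa>"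
    proof (rule powr_mono')
      have "2 * 1 \<le> 2 * (q / min p q)" using pq0 by (intro mult_left_mono) (auto simp: min_def)
      then show "\<kappa> \<le> q - 2" by (simp add: \<kappa>_def)
    qed (use \<delta>M in auto)
    then have "C' * (sqrt \<delta> powr (q - 2) * M powr q) \<le> C' * (sqrt \<delta> powr \<kappa> * M powr q)"
      using C'(1) by (intro mult_left_mono mult_right_mono) auto
    then have \<zeta>i': "(\<integral>\<^sup>+t. \<zeta> t \<partial>lborel) \<le> ennreal (C' * (sqrt \<delta> powr \<kappa> * M powr q))"
      using \<zeta>i ennreal_leI order_trans by blast
    have "(\<integral>\<^sup>+t. ennpowr (spatial_integral e \<alpha> p G t) (q / p) \<partial>lborel)
      \<le> (\<integral>\<^sup>+t. ennreal C * \<zeta> t + ennreal C * ennpowr (shifted_integral e \<alpha> p G t) (q / p) \<partial>lborel)"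
      by (intro nn_integral_mono C(2) \<zeta>s G)
    also have "\<dots> = ennreal C * (\<integral>\<^sup>+t. \<zeta> t \<partial>lborel) + ennreal C * (\<integral>\<^sup>+t. ennpowr (shifted_integral e \<alpha> p G t) (q / p) \<partial>lborel)"
      by (simp add: nn_integral_add nn_integral_cmult)
    also have "\<dots> \<le> ennreal C * ennreal (C' * (sqrt \<delta> powr \<kappa> * M powr q)) + ennreal C * ennreal (A * (sqrt \<delta> powr \<kappa> * M powr q))"
      by (intro add_mono mult_left_mono \<zeta>i' A(2)[OF b]) auto
    also have "\<dots> = ennreal (C * (C' * (sqrt \<delta> powr \<kappa> * M powr q)) + C * (A * (sqrt \<delta> powr \<kappa> * M powr q)))"
      using C(1) C'(1) A(1) by (simp add: ennreal_mult ennreal_plus)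
    finally show ?thesis by (simp add: algebra_simps)
  qed
  moreover have "0 < C * (C' + A)" using C(1) C'(1) A(1) by simp
  ultimately show ?thesis unfolding \<kappa>_def by blast
qed


section \<open>Mixed norms in the four ranges of exponents\<close>

definition spatial_norm :: "'a::euclidean_space \<Rightarrow> real \<Rightarrow> ennreal \<Rightarrow> (real \<Rightarrow> complex) \<Rightarrow> real \<Rightarrow> ennreal" where
  "spatial_norm e \<alpha> p G t = Lp_norm p lborel (\<lambda>x::'a. ennreal (norm x powr \<alpha> * cmod (wave_profile e G t (norm x))))"

lemma spatial_norm_finite_exponent:
  assumes "0 < p"
  shows "spatial_norm e \<alpha> (ennreal p) G t = ennpowr (spatial_integral e \<alpha> p G t) (1 / p)"
  using assms by (simp add: spatial_norm_def Lp_norm_def spatial_integral_def ennpowr_ennreal recip_ennreal)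

lemma spatial_norm_infinity:
  fixes e :: "'a::euclidean_space"
  shows "spatial_norm e \<alpha> \<infinity> G t = esssup lborel (\<lambda>x::'a. ennreal (norm x powr \<alpha> * cmod (wave_profile e G t (norm x))))"
  by (simp add: spatial_norm_def Lp_norm_def)

lemma measurable_spatial_norm:
  fixes e :: "'a::euclidean_space"
  assumes G[measurable]: "G \<in> borel_measurable borel" and p: "0 < p"
  shows "spatial_norm e \<alpha> p G \<in> borel_measurable borel"
proof (cases p)
  case (real r)
  then have "spatial_norm e \<alpha> p G = (\<lambda>t. ennpowr (spatial_integral e \<alpha> r G t) (1 / r))"
    using p by (auto simp: spatial_norm_finite_exponent fun_eq_iff)
  then show ?thesis using measurable_spatial_integral(1)[OF G, of e \<alpha> r] by simp
next
  case top
  have "(\<lambda>t. esssup lborel (\<lambda>x::'a. ennreal (norm x powr \<alpha> * cmod (wave_profile e G t (norm x))))) \<in> borel_measurable borel"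
    by (rule measurable_esssup_Pair) measurable
  then have "spatial_norm e \<alpha> \<infinity> G \<in> borel_measurable borel"
    unfolding spatial_norm_infinity[abs_def] .
  then show ?thesis using top by simp
qed

text \<open>The two signs of the propagator are one estimate up to time reversal, which preserves
  the norm in time.\<close>

lemma Lp_norm_time_finite_le:
  assumes [measurable]: "N \<in> borel_measurable borel" and \<sigma>: "\<sigma> \<in> {1, - 1 :: real}" and q: "0 < q" and B: "0 \<le> B"
    and le: "(\<integral>\<^sup>+t. ennpowr (N t) q \<partial>lborel) \<le> ennreal (B powr q)"
  shows "Lp_norm (ennreal q) lborel (\<lambda>t. N (\<sigma> * t)) \<le> ennreal B"
proof -
  have T: "orthogonal_transformation (\<lambda>t. \<sigma> * t)"
    using \<sigma> by (auto simp: orthogonal_transformation_neg)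
  have "(\<integral>\<^sup>+t. ennpowr (N (\<sigma> * t)) q \<partial>lborel) = (\<integral>\<^sup>+t. ennpowr (N t) q \<partial>lborel)"
    by (rule nn_integral_orthogonal_transformation[OF T, where h="\<lambda>t. ennpowr (N t) q"]) measurable
  then have "ennpowr (\<integral>\<^sup>+t. ennpowr (N (\<sigma> * t)) q \<partial>lborel) (1 / q) \<le> ennpowr (ennreal (B powr q)) (1 / q)"
    using le q by (intro ennpowr_mono) auto
  also have "\<dots> = ennreal B" using q B by (simp add: ennpowr_ennreal powr_powr)
  finally show ?thesis using q by (simp add: Lp_norm_def recip_ennreal)
qed

lemma Lp_norm_time_infinity_le:
  fixes N :: "real \<Rightarrow> ennreal" and \<sigma> :: real
  assumes [measurable]: "N \<in> borel_measurable borel" and le: "\<And>t. N t \<le> ennreal B"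
  shows "Lp_norm \<infinity> lborel (\<lambda>t. N (\<sigma> * t)) \<le> ennreal B"
proof -
  have "(\<lambda>t. \<sigma> * t) \<in> borel_measurable borel"
    by (intro borel_measurable_continuous_onI continuous_intros)
  then have "(\<lambda>t. N (\<sigma> * t)) \<in> borel_measurable lborel"
    using measurable_compose[OF _ assms(1)] by simp
  then have "esssup lborel (\<lambda>t. N (\<sigma> * t)) \<le> ennreal B" by (rule esssup_I) (simp add: le)
  then show ?thesis by (simp add: Lp_norm_def)
qed

lemma sqrt_powr_eq:
  assumes "0 < \<delta>"
  shows "sqrt \<delta> powr x = \<delta> powr (x / 2)"
  using assms by (simp add: powr_half_sqrt[symmetric] powr_powr)

text \<open>The weight is at most the reciprocal of the pointwise decay; nonnegativity of \<alpha>
  keeps it bounded at the origin.\<close>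

lemma admissible_infinite_exponents:
  fixes e :: "'a::euclidean_space"
  assumes e: "e \<in> Basis" and \<alpha>: "0 \<le> \<alpha>" "\<alpha> \<le> (real DIM('a) - 1) / 2"
  shows "\<exists>C>0. \<forall>\<delta> M G. band_profile e \<delta> M G \<longrightarrow> (\<forall>t. spatial_norm e \<alpha> \<infinity> G t \<le> ennreal (C * sqrt \<delta> * M))"
proof -
  define a where "a = (real DIM('a) - 1) / 2"
  obtain K where K: "0 < K" "\<And>\<delta> M G t s. band_profile e \<delta> M G \<Longrightarrow> 0 \<le> s \<Longrightarrow> cmod (wave_profile e G t s) \<le> K * sqrt \<delta> * M * (1 + s) powr (- a)"
    using wave_profile_le[OF e] unfolding a_def by (auto simp: minus_divide_left)
  have "spatial_norm e \<alpha> \<infinity> G t \<le> ennreal (K * sqrt \<delta> * M)" if b: "band_profile e \<delta> M G" for \<delta> M G t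
  proof -
    note [measurable] = band_profileD(1)[OF b]
    have "norm x powr \<alpha> * cmod (wave_profile e G t (norm x)) \<le> K * sqrt \<delta> * M" for x :: 'a
    proof -
      have D: "0 \<le> K * sqrt \<delta> * M" using K(1) band_profileD(2,4)[OF b] by simp
      have "norm x powr \<alpha> * cmod (wave_profile e G t (norm x)) \<le> (1 + norm x) powr a * (K * sqrt \<delta> * M * (1 + norm x) powr (- a))"
      proof (intro mult_mono K(2)[OF b])
        have "norm x powr \<alpha> \<le> (1 + norm x) powr \<alpha>" using \<alpha> by (intro powr_mono2) auto
        also have "\<dots> \<le> (1 + norm x) powr a" using \<alpha> by (intro powr_mono) (auto simp: a_def)
        finally show "norm x powr \<alpha> \<le> (1 + norm x) powr a" .
      qed auto
      also have "\<dots> = K * sqrt \<delta> * M * ((1 + norm x) powr a * (1 + norm x) powr (- a))" by simp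
      also have "(1 + norm x) powr a * (1 + norm x) powr (- a) = 1"
        unfolding powr_add[symmetric] using norm_ge_zero[of x] by (simp add: add_nonneg_eq_0_iff)
      finally show ?thesis by simp
    qed
    then show ?thesis unfolding spatial_norm_infinity by (intro esssup_I) (auto intro!: AE_I2 ennreal_leI)
  qed
  then show ?thesis using K(1) by blast
qed

lemma admissible_infinite_space_exponent:
  fixes e :: "'a::euclidean_space"
  assumes e: "e \<in> Basis" and q: "2 \<le> q" and \<alpha>: "0 \<le> \<alpha>" "\<alpha> < (real DIM('a) - 1) / 2 - 1 / q"
  shows "\<exists>C>0. \<forall>\<delta> M G. band_profile e \<delta> M G \<longrightarrow>
    (\<integral>\<^sup>+t. ennpowr (spatial_norm e \<alpha> \<infinity> G t) q \<partial>lborel) \<le> ennreal (C * (sqrt \<delta> powr (q - 2) * M powr q))"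
proof -
  obtain C where C: "0 < C" "\<And>\<delta> M G. band_profile e \<delta> M G \<Longrightarrow> (\<exists>\<zeta>. \<zeta> \<in> borel_measurable borel \<and>
    (\<forall>t. \<forall>s\<ge>0. ennreal (((1 + s) powr \<alpha> * cmod (wave_profile e G t s)) powr q) \<le> \<zeta> t) \<and>
    (\<integral>\<^sup>+t. \<zeta> t \<partial>lborel) \<le> ennreal (C * (sqrt \<delta> powr (q - 2) * M powr q)))"
    using wave_profile_maximal_powr[OF e q \<alpha>(2)] by blast
  have "(\<integral>\<^sup>+t. ennpowr (spatial_norm e \<alpha> \<infinity> G t) q \<partial>lborel) \<le> ennreal (C * (sqrt \<delta> powr (q - 2) * M powr q))"
    if b: "band_profile e \<delta> M G" for \<delta> M G
  proof -
    note [measurable] = band_profileD(1)[OF b]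
    obtain \<zeta> where \<zeta>s: "\<And>t s. 0 \<le> s \<Longrightarrow> ennreal (((1 + s) powr \<alpha> * cmod (wave_profile e G t s)) powr q) \<le> \<zeta> t" and
      \<zeta>i: "(\<integral>\<^sup>+t. \<zeta> t \<partial>lborel) \<le> ennreal (C * (sqrt \<delta> powr (q - 2) * M powr q))"
      using C(2)[OF b] by blast
    have "ennpowr (spatial_norm e \<alpha> \<infinity> G t) q \<le> \<zeta> t" for t
    proof (cases "\<zeta> t")
      case (real z)
      have "norm x powr \<alpha> * cmod (wave_profile e G t (norm x)) \<le> z powr (1 / q)" for x :: 'a
      proof -
        have "((1 + norm x) powr \<alpha> * cmod (wave_profile e G t (norm x))) powr q \<le> z"
          using \<zeta>s[of "norm x" t] real by (simp add: ennreal_le_iff)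
        then have "(((1 + norm x) powr \<alpha> * cmod (wave_profile e G t (norm x))) powr q) powr (1 / q) \<le> z powr (1 / q)"
          using q by (intro powr_mono2) auto
        then have "(1 + norm x) powr \<alpha> * cmod (wave_profile e G t (norm x)) \<le> z powr (1 / q)"
          using q by (simp add: powr_powr)
        moreover have "norm x powr \<alpha> * cmod (wave_profile e G t (norm x)) \<le> (1 + norm x) powr \<alpha> * cmod (wave_profile e G t (norm x))"
          using \<alpha> by (intro mult_right_mono powr_mono2) auto
        ultimately show ?thesis by linarith
      qed
      then have "spatial_norm e \<alpha> \<infinity> G t \<le> ennreal (z powr (1 / q))"
        unfolding spatial_norm_infinity by (intro esssup_I) (auto intro!: AE_I2 ennreal_leI)
      then have "ennpowr (spatial_norm e \<alpha> \<infinity> G t) q \<le> ennpowr (ennreal (z powr (1 / q))) q"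
        using q by (intro ennpowr_mono) auto
      then show ?thesis using real q by (simp add: ennpowr_ennreal powr_powr)
    qed simp
    then have "(\<integral>\<^sup>+t. ennpowr (spatial_norm e \<alpha> \<infinity> G t) q \<partial>lborel) \<le> (\<integral>\<^sup>+t. \<zeta> t \<partial>lborel)"
      by (rule nn_integral_mono)
    then show ?thesis using \<zeta>i by (rule order_trans)
  qed
  then show ?thesis using C(1) by blast
qed

text \<open>Origin of the exponent in the theorem: m is the smaller of the two exponents, and q
  powers of the square root of \<delta>, reduced by 2 q / m, are the q-th power of
  \<open>\<delta> powr (1/2 - 1/m)\<close>. With m = q it covers q - 2 factors.\<close>

lemma time_bound_root:
  assumes C: "0 < C" and \<delta>: "0 < \<delta>" and M: "0 < M" and q: "0 < q"
  shows "C * (sqrt \<delta> powr (q - 2 * q / m) * M powr q) = (C powr (1 / q) * \<delta> powr (1 / 2 - 1 / m) * M) powr q"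
proof -
  have "(q - 2 * q / m) / 2 = (1 / 2 - 1 / m) * q" by (simp add: field_simps)
  then show ?thesis using assms by (simp add: powr_mult powr_powr sqrt_powr_eq)
qed

lemma ennreal_exponent_cases:
  fixes p :: ennreal
  assumes "2 \<le> p"
  obtains "p = \<infinity>" | r where "p = ennreal r" "2 \<le> r"
proof (cases p)
  case (real r)
  then have "ennreal 2 \<le> ennreal r" using assms by simp
  then have "2 \<le> r" using real by (subst (asm) ennreal_le_iff) auto
  then show thesis using real that(2) by blast
next
  case top
  then show thesis using that(1) by simp
qed

lemma wave_profile_estimate:
  fixes e :: "'a::euclidean_space"
  assumes e: "e \<in> Basis" and adm: "admissible DIM('a) \<alpha> q p"
  shows "\<exists>C>0. \<forall>\<delta> M G. band_profile e \<delta> M G \<longrightarrow> (\<forall>\<sigma>\<in>{1, - 1}.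
    Lp_norm q lborel (\<lambda>t. spatial_norm e \<alpha> p G (\<sigma> * t)) \<le> ennreal (C * \<delta> powr (1 / 2 - recip (min p q)) * M))"
proof -
  have 2: "2 \<le> p" "2 \<le> q" using adm by (auto simp: admissible_def)
  have p0: "0 < p" using 2(1) by (rule less_le_trans[rotated]) simp
  have Nm: "spatial_norm e \<alpha> p G \<in> borel_measurable borel" if "band_profile e \<delta> M G" for \<delta> M G
    by (rule measurable_spatial_norm[OF band_profileD(1)[OF that] p0])
  show ?thesis
  proof (cases rule: ennreal_exponent_cases[OF 2(1)])
    case 1
    show ?thesis
    proof (cases rule: ennreal_exponent_cases[OF 2(2)])
      case q: 1
      have \<alpha>: "0 \<le> \<alpha>" "\<alpha> \<le> (real DIM('a) - 1) / 2" using adm 1 q by (auto simp: admissible_def)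
      obtain C where C: "0 < C" "\<And>\<delta> M G t. band_profile e \<delta> M G \<Longrightarrow> spatial_norm e \<alpha> \<infinity> G t \<le> ennreal (C * sqrt \<delta> * M)"
        using admissible_infinite_exponents[OF e \<alpha>] by blast
      have "Lp_norm q lborel (\<lambda>t. spatial_norm e \<alpha> p G (\<sigma> * t)) \<le> ennreal (C * \<delta> powr (1 / 2 - recip (min p q)) * M)"
        if b: "band_profile e \<delta> M G" for \<delta> M G \<sigma>
      proof -
        have "Lp_norm \<infinity> lborel (\<lambda>t. spatial_norm e \<alpha> p G (\<sigma> * t)) \<le> ennreal (C * sqrt \<delta> * M)"
          using C(2)[OF b] 1 by (intro Lp_norm_time_infinity_le Nm[OF b]) simp
        then show ?thesis using 1 q band_profileD(2)[OF b] recip_top by (simp add: powr_half_sqrt)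
      qed
      then show ?thesis using C(1) by blast
    next
      case q: (2 r)
      have \<alpha>: "0 \<le> \<alpha>" "\<alpha> < (real DIM('a) - 1) / 2 - 1 / r"
        using adm 1 q recip_ennreal[of r] by (auto simp: admissible_def)
      obtain C where C: "0 < C" "\<And>\<delta> M G. band_profile e \<delta> M G \<Longrightarrow>
          (\<integral>\<^sup>+t. ennpowr (spatial_norm e \<alpha> \<infinity> G t) r \<partial>lborel) \<le> ennreal (C * (sqrt \<delta> powr (r - 2) * M powr r))"
        using admissible_infinite_space_exponent[OF e q(2) \<alpha>] by blast
      have m: "recip (min p q) = 1 / r" using 1 q recip_ennreal[of r] by simp
      have "Lp_norm q lborel (\<lambda>t. spatial_norm e \<alpha> p G (\<sigma> * t)) \<le> ennreal (C powr (1 / r) * \<delta> powr (1 / 2 - recip (min p q)) * M)"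
        if b: "band_profile e \<delta> M G" and \<sigma>: "\<sigma> \<in> {1, - 1}" for \<delta> M G \<sigma>
      proof -
        have "(\<integral>\<^sup>+t. ennpowr (spatial_norm e \<alpha> p G t) r \<partial>lborel) \<le> ennreal ((C powr (1 / r) * \<delta> powr (1 / 2 - 1 / r) * M) powr r)"
          using C(2)[OF b] time_bound_root[OF C(1) band_profileD(2,4)[OF b], of r r] q 1 by simp
        then have "Lp_norm (ennreal r) lborel (\<lambda>t. spatial_norm e \<alpha> p G (\<sigma> * t)) \<le> ennreal (C powr (1 / r) * \<delta> powr (1 / 2 - 1 / r) * M)"
          using q band_profileD(4)[OF b] by (intro Lp_norm_time_finite_le[OF Nm[OF b] \<sigma>]) auto
        then show ?thesis unfolding m unfolding q(1) .
      qed
      moreover have "0 < C powr (1 / r)" using C(1) by simp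
      ultimately show ?thesis by blast
    qed
  next
    case p: (2 s)
    have s: "0 < s" using p by simp
    have rp: "recip p = 1 / s" using p recip_ennreal[of s] by simp
    have "- (real DIM('a) * recip p) < \<alpha>" using adm p by (auto simp: admissible_def)
    then have \<alpha>0: "- real DIM('a) < \<alpha> * s" using s by (simp add: rp field_simps)
    show ?thesis
    proof (cases rule: ennreal_exponent_cases[OF 2(2)])
      case 1
      have "\<alpha> \<le> (real DIM('a) - 1) * (1 / 2 - 1 / s)" using adm p 1 rp by (auto simp: admissible_def)
      then have "\<alpha> * s \<le> (real DIM('a) - 1) * (1 / 2 - 1 / s) * s" using s by (intro mult_right_mono) auto
      also have "\<dots> = (real DIM('a) - 1) / 2 * (s - 2)" using s by (simp add: field_simps)
      finally have \<alpha>s: "\<alpha> * s \<le> (real DIM('a) - 1) / 2 * (s - 2)" .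
      obtain C where C: "0 < C" "\<And>\<delta> M G t. band_profile e \<delta> M G \<Longrightarrow> spatial_integral e \<alpha> s G t \<le> ennreal (C * (sqrt \<delta> powr (s - 2) * M powr s))"
        using spatial_integral_bounded[OF e p(2) \<alpha>0 \<alpha>s] by blast
      have m: "recip (min p q) = 1 / s" using 1 p recip_ennreal[of s] by simp
      have "Lp_norm q lborel (\<lambda>t. spatial_norm e \<alpha> p G (\<sigma> * t)) \<le> ennreal (C powr (1 / s) * \<delta> powr (1 / 2 - recip (min p q)) * M)"
        if b: "band_profile e \<delta> M G" for \<delta> M G \<sigma>
        unfolding m unfolding 1
      proof (rule Lp_norm_time_infinity_le[OF Nm[OF b]])
        fix t
        have "spatial_norm e \<alpha> p G t = ennpowr (spatial_integral e \<alpha> s G t) (1 / s)"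
          unfolding p(1) by (rule spatial_norm_finite_exponent[OF s])
        \<comment> \<open>Here the root is taken in space, so the root formula is used with both of
          its exponents equal to s.\<close>
        also have "\<dots> \<le> ennpowr (ennreal ((C powr (1 / s) * \<delta> powr (1 / 2 - 1 / s) * M) powr s)) (1 / s)"
          using C(2)[OF b, of t] time_bound_root[OF C(1) band_profileD(2,4)[OF b] s, of s] s
          by (intro ennpowr_mono) auto
        also have "\<dots> = ennreal (C powr (1 / s) * \<delta> powr (1 / 2 - 1 / s) * M)"
          using s band_profileD(4)[OF b] by (simp add: ennpowr_ennreal powr_powr)
        finally show "spatial_norm e \<alpha> p G t \<le> ennreal (C powr (1 / s) * \<delta> powr (1 / 2 - 1 / s) * M)" .
      qed
      moreover have "0 < C powr (1 / s)" using C(1) by simp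
      ultimately show ?thesis by blast
    next
      case q: (2 r)
      have r: "0 < r" using q by simp
      have rq: "recip q = 1 / r" using q recip_ennreal[of r] by simp
      have "\<alpha> < (real DIM('a) - 1) * (1 / 2 - 1 / s) - 1 / r" using adm p q rp rq by (auto simp: admissible_def)
      also have "\<dots> = (real DIM('a) - 1) / 2 * (1 - 2 / s) - 1 / r" by (simp add: field_simps)
      finally have \<alpha>s: "\<alpha> < (real DIM('a) - 1) / 2 * (1 - 2 / s) - 1 / r" .
      obtain C where C: "0 < C" "\<And>\<delta> M G. band_profile e \<delta> M G \<Longrightarrow>
          (\<integral>\<^sup>+t. ennpowr (spatial_integral e \<alpha> s G t) (r / s) \<partial>lborel) \<le> ennreal (C * (sqrt \<delta> powr (r - 2 * r / min s r) * M powr r))"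
        using spatial_integral_time[OF e p(2) q(2) \<alpha>0 \<alpha>s] by blast
      have m: "recip (min p q) = 1 / min s r" using rp rq p q s r by (auto simp: min_def ennreal_le_iff)
      have "Lp_norm q lborel (\<lambda>t. spatial_norm e \<alpha> p G (\<sigma> * t)) \<le> ennreal (C powr (1 / r) * \<delta> powr (1 / 2 - recip (min p q)) * M)"
        if b: "band_profile e \<delta> M G" and \<sigma>: "\<sigma> \<in> {1, - 1}" for \<delta> M G \<sigma>
        unfolding m unfolding q(1)
      proof (rule Lp_norm_time_finite_le[OF Nm[OF b] \<sigma> r])
        have "ennpowr (spatial_norm e \<alpha> p G t) r = ennpowr (spatial_integral e \<alpha> s G t) (r / s)" for t
          using s p spatial_norm_finite_exponent[OF s, of e \<alpha> G t] by (simp add: ennpowr_ennpowr)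
        then show "(\<integral>\<^sup>+t. ennpowr (spatial_norm e \<alpha> p G t) r \<partial>lborel) \<le> ennreal ((C powr (1 / r) * \<delta> powr (1 / 2 - 1 / min s r) * M) powr r)"
          using C(2)[OF b] time_bound_root[OF C(1) band_profileD(2,4)[OF b] r, of "min s r"] by simp
        show "0 \<le> C powr (1 / r) * \<delta> powr (1 / 2 - 1 / min s r) * M" using band_profileD(4)[OF b] by simp
      qed
      moreover have "0 < C powr (1 / r)" using C(1) by simp
      ultimately show ?thesis by blast
    qed
  qed
qed

section \<open>From the profile back to the wave\<close>

lemma measurable_fourier_L2:
  assumes "in_L2 f"
  shows "fourier_L2 f \<in> borel_measurable borel"
  using has_fourier_L2_fourier_L2[OF assms] unfolding has_fourier_L2_def in_L2_def by blast

text \<open>\<open>esssup\<close> takes the value top on functions that are not measurable, so for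
  infinite p the almost everywhere identity with the profile would not be enough by itself.\<close>

lemma measurable_half_wave:
  fixes f :: "'a::euclidean_space \<Rightarrow> complex"
  assumes f: "in_L2 f"
  shows "half_wave t f \<in> borel_measurable borel"
proof -
  note [measurable] = measurable_fourier_L2[OF f]
  have "sqint (\<lambda>\<xi>. cis (t * norm \<xi>) * fourier_L2 f \<xi>) = sqint (fourier_L2 f)"
    by (simp add: sqint_def norm_mult)
  then have "in_L2 (\<lambda>\<xi>. cis (t * norm \<xi>) * fourier_L2 f \<xi>)"
    using sqint_fourier_L2_le[OF f] f by (auto simp: in_L2_iff)
  then have "fourier_L2 (\<lambda>\<xi>. cis (t * norm \<xi>) * fourier_L2 f \<xi>) \<in> borel_measurable borel"
    by (rule measurable_fourier_L2)
  then show ?thesis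
    unfolding half_wave_def fourier_multiplier_def inverse_fourier_L2_def by measurable
qed

lemma Lp_norm_cong_AE:
  assumes "g \<in> borel_measurable M" "h \<in> borel_measurable M" "AE x in M. g x = h x"
  shows "Lp_norm p M g = Lp_norm p M h"
proof (cases "p = \<infinity>")
  case True
  then show ?thesis using esssup_AE_cong[OF assms] by (simp add: Lp_norm_def)
next
  case False
  have "(\<integral>\<^sup>+x. ennpowr (g x) (enn2real p) \<partial>M) = (\<integral>\<^sup>+x. ennpowr (h x) (enn2real p) \<partial>M)"
    by (rule nn_integral_cong_AE) (use assms(3) in \<open>auto elim: eventually_mono\<close>)
  then show ?thesis using False by (simp add: Lp_norm_def)
qed

theorem proposition3p1:
  fixes \<alpha> :: real and q p :: ennreal
  assumes "admissible DIM('a::euclidean_space) \<alpha> q p"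
  shows "\<exists>C::real. C > 0 \<and>
    (\<forall>(f :: 'a \<Rightarrow> complex) (\<delta>::real) (I :: real set). \<forall>\<sigma>\<in>{1, -1::real}.
       in_L2 f \<and> radial f \<and> 0 < \<delta> \<and> \<delta> \<le> 1 \<and>
       is_interval I \<and> I \<subseteq> {1/2..2} \<and> measure lborel I \<le> \<delta> \<and>
       ess_support (fourier_L2 f) \<subseteq> {\<xi>. norm \<xi> \<in> I}
       \<longrightarrow> weighted_mixed_norm \<alpha> q p (\<lambda>t. half_wave (\<sigma> * t) f)
            \<le> ennreal (C * \<delta> powr (1/2 - recip (min p q))) * L2_norm f)"
proof -
  obtain e :: 'a where e: "e \<in> Basis" using nonempty_Basis by blast
  obtain C where C: "0 < C" "\<And>\<delta> M G \<sigma>. band_profile e \<delta> M G \<Longrightarrow> \<sigma> \<in> {1, - 1} \<Longrightarrow>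
    Lp_norm q lborel (\<lambda>t. spatial_norm e \<alpha> p G (\<sigma> * t)) \<le> ennreal (C * \<delta> powr (1 / 2 - recip (min p q)) * M)"
    using wave_profile_estimate[OF e assms] by blast
  have "weighted_mixed_norm \<alpha> q p (\<lambda>t. half_wave (\<sigma> * t) f) \<le> ennreal (C * \<delta> powr (1/2 - recip (min p q))) * L2_norm f"
    if \<sigma>: "\<sigma> \<in> {1, -1}" and f: "in_L2 f" "radial f" and \<delta>: "0 < \<delta>" "\<delta> \<le> 1"
      and I: "is_interval I" "I \<subseteq> {1/2..2}" "measure lborel I \<le> \<delta>"
      and supp: "ess_support (fourier_L2 f) \<subseteq> {\<xi>. norm \<xi> \<in> I}"
    for f :: "'a \<Rightarrow> complex" and \<delta> I \<sigma>
  proof -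
    have Ib: "I \<in> sets borel" by (rule real_interval_borel_measurable[OF I(1)])
    obtain G where Gm[measurable]: "G \<in> borel_measurable borel" and G0: "\<And>r. r \<notin> I \<Longrightarrow> G r = 0"
      and G: "AE \<xi> in lborel. fourier_L2 f \<xi> = G (norm \<xi>)"
      using fourier_L2_radial_support[OF f Ib supp] by blast
    obtain m where m: "sqint f = ennreal m" "0 \<le> m"
      using f(1) by (cases "sqint f") (auto simp: in_L2_iff)
    define N where "N = sqrt m"
    have N: "0 \<le> N" "L2_norm f = ennreal N" using m by (simp_all add: N_def L2_norm_eq_sqrt)
    have Gf: "sqint (\<lambda>\<xi>::'a. G (norm \<xi>)) \<le> ennreal (N\<^sup>2)"
      using sqint_fourier_L2_le[OF f(1)] m by (simp add: sqint_cong_AE[OF G, symmetric] N_def)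
    \<comment> \<open>A \<open>band_profile\<close> requires a positive bound M, while the norm N
      may be 0. The bound is enlarged by \<epsilon>, which tends to 0 at the end; the constant does
      not depend on M.\<close>
    have b: "band_profile e \<delta> (N + \<epsilon>) G" if "0 < \<epsilon>" for \<epsilon>
    proof -
      have "ennreal (N\<^sup>2) \<le> ennreal ((N + \<epsilon>)\<^sup>2)" using N that by (intro ennreal_leI power_mono) auto
      then have "sqint (\<lambda>\<xi>::'a. G (norm \<xi>)) \<le> ennreal ((N + \<epsilon>)\<^sup>2)" using Gf by (rule order_trans[rotated])
      then show ?thesis
        unfolding band_profile_def using \<delta> N that Ib I(2,3) G0 by auto
    qed
    have hw: "AE x in lborel. half_wave t f x = wave_profile e G t (norm x)" for t
    proof -
      have "AE x in lborel. half_wave t f x = fourier_integral (\<lambda>\<xi>. cis (t * norm \<xi>) * G (norm \<xi>)) (- x)"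
        by (rule half_wave_AE_eq[OF f(1) Gm G, where R=2]) (use G0 I(2) in fastforce)
      then show ?thesis unfolding fourier_integral_band_profile(1)[OF e b[OF zero_less_one]] .
    qed
    have sn: "Lp_norm p lborel (\<lambda>x. ennreal (norm x powr \<alpha> * cmod (half_wave t f x))) = spatial_norm e \<alpha> p G t" for t
      unfolding spatial_norm_def
    proof (rule Lp_norm_cong_AE)
      note [measurable] = measurable_half_wave[OF f(1), of t]
      show "(\<lambda>x. ennreal (norm x powr \<alpha> * cmod (half_wave t f x))) \<in> borel_measurable lborel" by measurable
      show "(\<lambda>x::'a. ennreal (norm x powr \<alpha> * cmod (wave_profile e G t (norm x)))) \<in> borel_measurable lborel" by measurable
      show "AE x in lborel. ennreal (norm x powr \<alpha> * cmod (half_wave t f x)) = ennreal (norm x powr \<alpha> * cmod (wave_profile e G t (norm x)))"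
        using hw[of t] by eventually_elim simp
    qed
    define c where "c = C * \<delta> powr (1/2 - recip (min p q))"
    have le: "weighted_mixed_norm \<alpha> q p (\<lambda>t. half_wave (\<sigma> * t) f) \<le> ennreal (c * (N + \<epsilon>))" if "0 < \<epsilon>" for \<epsilon>
      unfolding weighted_mixed_norm_def sn c_def by (rule C(2)[OF b[OF that] \<sigma>])
    have "(\<lambda>n. ennreal (c * (N + 1 / real (Suc n)))) \<longlonglongrightarrow> ennreal (c * (N + 0))"
      by (intro tendsto_intros LIMSEQ_Suc[OF lim_1_over_n])
    then have "weighted_mixed_norm \<alpha> q p (\<lambda>t. half_wave (\<sigma> * t) f) \<le> ennreal (c * (N + 0))"
      by (rule LIMSEQ_le_const) (use le in \<open>auto intro!: exI[of _ 0]\<close>)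
    also have "\<dots> = ennreal c * L2_norm f"
      using C(1) N by (simp add: c_def ennreal_mult)
    finally show ?thesis by (simp only: c_def)
  qed
  then show ?thesis using C(1) by blast
qed

end
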